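(* Let $K$ be a strongly proper atomistic commutative semiring. Then for each finite alphabet $\Sigma$, $K^{\mathrm{rat}}\langle\!\langle\Sigma^*\rangle\!\rangle$ (with the proper rational series as distinguished $K$-ideal) is a free partial iteration $K$-semialgebra on $\Sigma$; that is, for every partial iteration $K$-semialgebra $(A,I,{}^* )$ and every function $h:\Sigma\to I$ there is a unique morphism of partial iteration $K$-semialgebras $K^{\mathrm{rat}}\langle\!\langle\Sigma^*\rangle\!\rangle\to A$ extending $h$.
   Context: All semirings are nontrivial ($0\neq1$), with $x0=0=0x$. Let $K$ be a commutative semiring. A $K$-semialgebra is a semiring $A$ (with unit $e$) that is also a $K$-semimodule (action with $(k+k')a=ka+k'a$, $k(a+b)=ka+kb$, $(kk')a=k(k'a)$, $1a=a$, $0a=0$, $k0=0$) satisfying $k(ab)=(ka)b=a(kb)$. A $K$-ideal of $A$ is a subset $I$ with $0\in I$, $I+I\subseteq I$, $AI\cup IA\subseteq I$, $KI\subseteq I$. A partial Conway $K$-semialgebra $(A,I,{}^* )$ is a $K$-semialgebra $A$ with a distinguished $K$-ideal $I$ and a function ${}^*:I\to A$ such that $(a+b)^*=(a^*b)^*a^*$ for $a,b\in I$ and $(ab)^*=e+a(ba)^*b$ whenever $a\in I$ or $b\in I$ ($a,b\in A$). Morphisms preserve the semiring operations and constants, the $K$-action, the distinguished $K$-ideal and the star. Matrix star: for $M\in I^{n\times n}$, $M^*\in A^{n\times n}$ is defined inductively: $(a)^*=(a^* )$ for $n=1$, and for $n>1$, with $X$ of size $(n-1)\times(n-1)$ and $V$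 of size $1\times1$, $$\begin{pmatrix}X&Y\\ U&V\end{pmatrix}^*=\begin{pmatrix}\alpha&\alpha YV^*\\ \delta UX^*&\delta\end{pmatrix},\quad \alpha=(X+YV^*U)^*,\ \delta=(V+UX^*Y)^*.$$ Group identities: for a finite group $G$ with elements $\{1,\dots,n\}$ let $M_G$ be the $n\times n$ matrix whose $(i,j)$ entry is the variable $x_{i^{-1}\cdot j}$ (inverse and product in $G$). The group identity of $G$ is $r_1+\dots+r_n=(x_1+\dots+x_n)^*$, where $r_1,\dots,r_n$ is the first row of $M_G^*$. A partial iteration $K$-semialgebra is a partial Conway $K$-semialgebra $(A,I,{}^* )$ satisfying the group identities of all finite groups when the variables range over $I$. Its morphisms are the partial Conway $K$-semialgebra morphisms. Series: $K\langle\!\langle\Sigma^*\rangle\!\rangle$ is the $K$-semialgebra of functions $s:\Sigma^*\to K$ with pointwise sum and action and Cauchy product; letters and elements of $K$ are identified with the corresponding series. $s$ is proper if its coefficient at the empty word is $0$; for proper $s$, $s^*$ is the unique solution of $x=sx+1$ and $s^+:=ss^*$. $K^{\mathrm{rat}}\langle\!\langle\Sigma^*\rangle\!\rangle$ is the set of series $k+b$ with $k\in K$ and $b$ generated from $\Sigma\cup\{0\}$ by sum, product, $K$-action and $^+$; with its proper series as distinguished $K$-ideal it is a partial iteration $K$-semialgebra. A $K$-automaton in $K\langle\!\langle\Sigma^*\rangle\!\rangle$ of dimension $n\ge1$ is a triple $(\alpha,M,\beta)$ with $\alpha\in K^{1\times n}$, $\beta\in K^{n\times1}$, $M\in(K\Sigma)^{n\times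 n}$, $K\Sigma$ being the set of $K$-linear combinations of letters. Its behavior is $\alpha M^*\beta$; automata are equivalent if they have the same behavior. A simulation $(\alpha,M,\beta)\to(\gamma,N,\delta)$ (dimensions $m,n$) is $X\in K^{m\times n}$ with $\alpha X=\gamma$, $MX=XN$, $\beta=X\delta$. It is functional if each row of $X$ has exactly one entry $1$ and all other entries $0$; dual functional if the same holds for columns; invertible diagonal if $X$ is diagonal with all diagonal entries units of $K$. $K$ is strongly proper if for every finite alphabet $\Sigma$, any two equivalent $K$-automata in $K\langle\!\langle\Sigma^*\rangle\!\rangle$ can be connected by a finite chain of functional, dual functional and invertible diagonal simulations (each link in either direction). A semiring $S$ is atomistic if whenever $x_1+\dots+x_m=y_1+\dots+y_n$ in $S$ ($m,n\ge1$), there are $z_1,\dots,z_k\in S$ and partitions $I_1,\dots,I_m$ and $J_1,\dots,J_n$ of $\{1,\dots,k\}$ into pairwise disjoint, possibly empty sets with $x_i=\sum_{\ell\in I_i}z_\ell$ and $y_j=\sum_{\ell\in J_j}z_\ell$ for all $i,j$. *)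

theory Defs
  imports
    "Jordan_Normal_Form.Matrix"
    "HOL-Algebra.Group"
    "HOL-Library.FuncSet"
    "HOL-Library.Disjoint_Sets"
begin

section \<open>Partial iteration semialgebras\<close>

text \<open>
  The semiring \<open>K\<close> is a type of class \<^class>\<open>comm_semiring_1\<close>. A \<open>K\<close>-semialgebra is a subset \<open>A\<close> of a
  type of class \<^class>\<open>semiring_1\<close> closed under the operations (possibly the whole type), so that
  its sum, product and constants are those of the type. The action is only constrained on \<open>A\<close> and
  the star only on the distinguished ideal \<open>I\<close>. Both type classes include \<open>0 \<noteq> 1\<close>.
\<close>

locale semialgebra =
  fixes A :: "'a::semiring_1 set"
    and act :: "'k::comm_semiring_1 \<Rightarrow> 'a \<Rightarrow> 'a"
  assumes zero_closed: "0 \<in> A"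
    and one_closed: "1 \<in> A"
    and add_closed: "a \<in> A \<Longrightarrow> b \<in> A \<Longrightarrow> a + b \<in> A"
    and mult_closed: "a \<in> A \<Longrightarrow> b \<in> A \<Longrightarrow> a * b \<in> A"
    and act_closed: "a \<in> A \<Longrightarrow> act k a \<in> A"
    and act_add_left: "a \<in> A \<Longrightarrow> act (k + k') a = act k a + act k' a"
    and act_add_right: "a \<in> A \<Longrightarrow> b \<in> A \<Longrightarrow> act k (a + b) = act k a + act k b"
    and act_mult: "a \<in> A \<Longrightarrow> act (k * k') a = act k (act k' a)"
    and act_one: "a \<in> A \<Longrightarrow> act 1 a = a"
    and act_zero_left: "a \<in> A \<Longrightarrow> act 0 a = 0"
    and act_zero_right: "act k 0 = 0"
    and act_mult_left: "a \<in> A \<Longrightarrow> b \<in> A \<Longrightarrow> act k (a * b) = act k a * b"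
    and act_mult_right: "a \<in> A \<Longrightarrow> b \<in> A \<Longrightarrow> act k (a * b) = a * act k b"

locale semialgebra_ideal = semialgebra A act
  for A :: "'a::semiring_1 set" and act :: "'k::comm_semiring_1 \<Rightarrow> 'a \<Rightarrow> 'a" +
  fixes I :: "'a set"
  assumes ideal_subset: "I \<subseteq> A"
    and ideal_zero: "0 \<in> I"
    and ideal_add: "a \<in> I \<Longrightarrow> b \<in> I \<Longrightarrow> a + b \<in> I"
    and ideal_mult_left: "a \<in> A \<Longrightarrow> b \<in> I \<Longrightarrow> a * b \<in> I"
    and ideal_mult_right: "a \<in> I \<Longrightarrow> b \<in> A \<Longrightarrow> a * b \<in> I"
    and ideal_act: "a \<in> I \<Longrightarrow> act k a \<in> I"

locale partial_conway_semialgebra = semialgebra_ideal A act I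
  for A :: "'a::semiring_1 set" and act :: "'k::comm_semiring_1 \<Rightarrow> 'a \<Rightarrow> 'a" and I :: "'a set" +
  fixes star :: "'a \<Rightarrow> 'a"
  assumes star_closed: "a \<in> I \<Longrightarrow> star a \<in> A"
    and sum_star: "a \<in> I \<Longrightarrow> b \<in> I \<Longrightarrow> star (a + b) = star (star a * b) * star a"
    and product_star: "a \<in> A \<Longrightarrow> b \<in> A \<Longrightarrow> a \<in> I \<or> b \<in> I \<Longrightarrow>
      star (a * b) = 1 + a * star (b * a) * b"

text \<open>The star of an \<open>n \<times> n\<close> matrix with entries in the ideal. For such matrices \<open>star\<close> is only
  ever applied to elements of the ideal. The value for \<open>n = 0\<close> is irrelevant.\<close>

fun mat_star :: "('a::semiring_1 \<Rightarrow> 'a) \<Rightarrow> nat \<Rightarrow> 'a mat \<Rightarrow> 'a mat" where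
  "mat_star star 0 M = M"
| "mat_star star (Suc 0) M = map_mat star M"
| "mat_star star (Suc (Suc n)) M =
    (case split_block M (Suc n) (Suc n) of (X, Y, U, V) \<Rightarrow>
      let X' = mat_star star (Suc n) X;
          V' = mat_star star (Suc 0) V;
          \<alpha> = mat_star star (Suc n) (X + Y * V' * U);
          \<delta> = mat_star star (Suc 0) (V + U * X' * Y)
      in four_block_mat \<alpha> (\<alpha> * Y * V') (\<delta> * U * X') \<delta>)"

text \<open>The elements of the group are numbered from \<open>0\<close>, as are the rows and columns of matrices.
  The numbering is arbitrary; in particular \<open>0\<close> need not be the neutral element.\<close>

definition group_mat :: "nat monoid \<Rightarrow> nat \<Rightarrow> (nat \<Rightarrow> 'a) \<Rightarrow> 'a mat" where
  "group_mat G n x = mat n n (\<lambda>(i, j). x (inv\<^bsub>G\<^esub> i \<otimes>\<^bsub>G\<^esub> j))"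

locale partial_iteration_semialgebra = partial_conway_semialgebra A act I star
  for A :: "'a::semiring_1 set" and act :: "'k::comm_semiring_1 \<Rightarrow> 'a \<Rightarrow> 'a" and I :: "'a set"
    and star :: "'a \<Rightarrow> 'a" +
  assumes group_identity: "group G \<Longrightarrow> carrier G = {..<n} \<Longrightarrow> x \<in> {..<n} \<rightarrow> I \<Longrightarrow>
      (\<Sum>j<n. mat_star star n (group_mat G n x) $$ (0, j)) = star (\<Sum>i<n. x i)"

text \<open>Only the values of \<open>f\<close> on \<open>A\<close> matter.\<close>

definition partial_iteration_morphism ::
  "'a::semiring_1 set \<Rightarrow> ('k::comm_semiring_1 \<Rightarrow> 'a \<Rightarrow> 'a) \<Rightarrow> 'a set \<Rightarrow> ('a \<Rightarrow> 'a) \<Rightarrow>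
   'b::semiring_1 set \<Rightarrow> ('k \<Rightarrow> 'b \<Rightarrow> 'b) \<Rightarrow> 'b set \<Rightarrow> ('b \<Rightarrow> 'b) \<Rightarrow> ('a \<Rightarrow> 'b) \<Rightarrow> bool" where
  "partial_iteration_morphism A act I star B act' J star' f \<longleftrightarrow>
     f \<in> A \<rightarrow> B \<and>
     f 0 = 0 \<and> f 1 = 1 \<and>
     (\<forall>a\<in>A. \<forall>b\<in>A. f (a + b) = f a + f b) \<and>
     (\<forall>a\<in>A. \<forall>b\<in>A. f (a * b) = f a * f b) \<and>
     (\<forall>k. \<forall>a\<in>A. f (act k a) = act' k (f a)) \<and>
     f \<in> I \<rightarrow> J \<and>
     (\<forall>a\<in>I. f (star a) = star' (f a))"


section \<open>Formal series\<close>

typedef ('s, 'k) series = "UNIV :: ('s list \<Rightarrow> 'k) set"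
  morphisms coeff Series ..

setup_lifting type_definition_series

lemma series_eqI: "(\<And>w. coeff s w = coeff t w) \<Longrightarrow> s = t"
  by (metis coeff_inverse ext)

instantiation series :: (type, semiring_1) semiring_1
begin

lift_definition zero_series :: "('a, 'b) series" is "\<lambda>_. 0" .

lift_definition one_series :: "('a, 'b) series" is "\<lambda>w. if w = [] then 1 else 0" .

lift_definition plus_series :: "('a, 'b) series \<Rightarrow> ('a, 'b) series \<Rightarrow> ('a, 'b) series"
  is "\<lambda>s t w. s w + t w" .

lift_definition times_series :: "('a, 'b) series \<Rightarrow> ('a, 'b) series \<Rightarrow> ('a, 'b) series"
  is "\<lambda>s t w. \<Sum>i\<le>length w. s (take i w) * t (drop i w)" .

instance
proof
  fix s t u :: "('a, 'b) series"
  show "s + t + u = s + (t + u)" by transfer (simp add: add.assoc)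
  show "s + t = t + s" by transfer (simp add: add.commute)
  show "0 + s = s" by transfer simp
  show "0 * s = 0" by transfer simp
  show "s * 0 = 0" by transfer simp
  show "(s + t) * u = s * u + t * u" by transfer (simp add: distrib_right sum.distrib)
  show "s * (t + u) = s * t + s * u" by transfer (simp add: distrib_left sum.distrib)
  show "(0 :: ('a, 'b) series) \<noteq> 1" by transfer (metis zero_neq_one)
  show "1 * s = s"
  proof (rule series_eqI)
    fix w
    have "coeff (1 * s) w = (\<Sum>i\<le>length w. if i = 0 then coeff s w else 0)"
      unfolding times_series.rep_eq one_series.rep_eq by (rule sum.cong) auto
    then show "coeff (1 * s) w = coeff s w" by simp
  qed
  show "s * 1 = s"
  proof (rule series_eqI)
    fix w
    have "coeff (s * 1) w = (\<Sum>i\<le>length w. if i = length w then coeff s w else 0)"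
      unfolding times_series.rep_eq one_series.rep_eq by (rule sum.cong) auto
    then show "coeff (s * 1) w = coeff s w" by simp
  qed
  show "s * t * u = s * (t * u)"
  proof (rule series_eqI)
    fix w :: "'a list"
    let ?n = "length w"
    let ?f = "\<lambda>j l. coeff s (take j w) * coeff t (take l (drop j w)) * coeff u (drop (j + l) w)"
    have "coeff (s * t * u) w = (\<Sum>i\<le>?n. \<Sum>j\<le>i. ?f j (i - j))"
      by (auto simp: times_series.rep_eq sum_distrib_right min_def drop_take intro!: sum.cong)
    also have "\<dots> = (\<Sum>(i, j)\<in>(SIGMA i:{..?n}. {..i}). ?f j (i - j))"
      by (rule sum.Sigma) auto
    also have "\<dots> = (\<Sum>(j, l)\<in>(SIGMA j:{..?n}. {..?n - j}). ?f j l)"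
      by (rule sum.reindex_bij_witness[of _ "\<lambda>(j, l). (j + l, j)" "\<lambda>(i, j). (j, i - j)"]) auto
    also have "\<dots> = (\<Sum>j\<le>?n. \<Sum>l\<le>?n - j. ?f j l)"
      by (rule sum.Sigma[symmetric]) auto
    also have "\<dots> = coeff (s * (t * u)) w"
      by (auto simp: times_series.rep_eq sum_distrib_left mult.assoc add.commute intro!: sum.cong)
    finally show "coeff (s * t * u) w = coeff (s * (t * u)) w" .
  qed
qed

end

lift_definition const :: "'k::zero \<Rightarrow> ('s, 'k) series" is "\<lambda>k w. if w = [] then k else 0" .

lift_definition letter :: "'s \<Rightarrow> ('s, 'k::zero_neq_one) series"
  is "\<lambda>a w. if w = [a] then 1 else 0" .

lift_definition scale :: "'k::times \<Rightarrow> ('s, 'k) series \<Rightarrow> ('s, 'k) series" is "\<lambda>k s w. k * s w" .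

definition proper :: "('s, 'k::zero) series \<Rightarrow> bool" where
  "proper s \<longleftrightarrow> coeff s [] = 0"

text \<open>Meaningful for proper \<open>s\<close>, where the solution exists and is unique.\<close>

definition series_star :: "('s, 'k::semiring_1) series \<Rightarrow> ('s, 'k) series" where
  "series_star s = (THE x. x = s * x + 1)"

text \<open>An alphabet is a finite set of letters, and the series over it are the series over the
  type of letters whose support consists of words over this set.\<close>

inductive_set rat_gen :: "'s set \<Rightarrow> ('s, 'k::comm_semiring_1) series set" for \<Sigma> :: "'s set" where
  zero: "0 \<in> rat_gen \<Sigma>"
| letter: "a \<in> \<Sigma> \<Longrightarrow> letter a \<in> rat_gen \<Sigma>"
| add: "s \<in> rat_gen \<Sigma> \<Longrightarrow> t \<in> rat_gen \<Sigma> \<Longrightarrow> s + t \<in> rat_gen \<Sigma>"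
| mult: "s \<in> rat_gen \<Sigma> \<Longrightarrow> t \<in> rat_gen \<Sigma> \<Longrightarrow> s * t \<in> rat_gen \<Sigma>"
| scale: "s \<in> rat_gen \<Sigma> \<Longrightarrow> scale k s \<in> rat_gen \<Sigma>"
| plus: "s \<in> rat_gen \<Sigma> \<Longrightarrow> s * series_star s \<in> rat_gen \<Sigma>"

definition rat_series :: "'s set \<Rightarrow> ('s, 'k::comm_semiring_1) series set" where
  "rat_series \<Sigma> = {const k + b | k b. b \<in> rat_gen \<Sigma>}"

definition proper_rat_series :: "'s set \<Rightarrow> ('s, 'k::comm_semiring_1) series set" where
  "proper_rat_series \<Sigma> = {s \<in> rat_series \<Sigma>. proper s}"


section \<open>Automata and simulations\<close>

type_synonym ('s, 'k) automaton = "'k mat \<times> ('s, 'k) series mat \<times> 'k mat"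

definition letter_combinations :: "'s set \<Rightarrow> ('s, 'k::comm_semiring_1) series set" where
  "letter_combinations \<Sigma> = {\<Sum>a\<in>\<Sigma>. scale (c a) (letter a) | c. True}"

definition is_automaton ::
  "'s set \<Rightarrow> nat \<Rightarrow> ('s, 'k::comm_semiring_1) automaton \<Rightarrow> bool" where
  "is_automaton \<Sigma> n = (\<lambda>(\<alpha>, M, \<beta>). 1 \<le> n \<and> \<alpha> \<in> carrier_mat 1 n \<and> M \<in> carrier_mat n n \<and>
     \<beta> \<in> carrier_mat n 1 \<and> elements_mat M \<subseteq> letter_combinations \<Sigma>)"

definition behavior :: "('s, 'k::comm_semiring_1) automaton \<Rightarrow> ('s, 'k) series" where
  "behavior = (\<lambda>(\<alpha>, M, \<beta>).
     (map_mat const \<alpha> * mat_star series_star (dim_row M) M * map_mat const \<beta>) $$ (0, 0))"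

definition simulation ::
  "'k::comm_semiring_1 mat \<Rightarrow> ('s, 'k) automaton \<Rightarrow> ('s, 'k) automaton \<Rightarrow> bool" where
  "simulation X = (\<lambda>(\<alpha>, M, \<beta>) (\<gamma>, N, \<delta>).
     X \<in> carrier_mat (dim_row M) (dim_row N) \<and>
     \<alpha> * X = \<gamma> \<and> M * map_mat const X = map_mat const X * N \<and> \<beta> = X * \<delta>)"

definition functional_mat :: "'k::comm_semiring_1 mat \<Rightarrow> bool" where
  "functional_mat X \<longleftrightarrow> (\<forall>i<dim_row X. \<exists>j<dim_col X. X $$ (i, j) = 1 \<and>
     (\<forall>j'<dim_col X. j' \<noteq> j \<longrightarrow> X $$ (i, j') = 0))"

definition dual_functional_mat :: "'k::comm_semiring_1 mat \<Rightarrow> bool" where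
  "dual_functional_mat X \<longleftrightarrow> (\<forall>j<dim_col X. \<exists>i<dim_row X. X $$ (i, j) = 1 \<and>
     (\<forall>i'<dim_row X. i' \<noteq> i \<longrightarrow> X $$ (i', j) = 0))"

definition invertible_diagonal_mat :: "'k::comm_semiring_1 mat \<Rightarrow> bool" where
  "invertible_diagonal_mat X \<longleftrightarrow> square_mat X \<and> diagonal_mat X \<and>
     (\<forall>i<dim_row X. X $$ (i, i) dvd 1)"

definition elementary_step ::
  "'s set \<Rightarrow> ('s, 'k::comm_semiring_1) automaton \<Rightarrow> ('s, 'k) automaton \<Rightarrow> bool" where
  "elementary_step \<Sigma> P Q \<longleftrightarrow> (\<exists>m. is_automaton \<Sigma> m P) \<and> (\<exists>n. is_automaton \<Sigma> n Q) \<and>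
     (\<exists>X. simulation X P Q \<and>
       (functional_mat X \<or> dual_functional_mat X \<or> invertible_diagonal_mat X))"


section \<open>Conditions on the semiring\<close>

text \<open>Every finite alphabet is a renaming of a set of natural numbers.\<close>

definition strongly_proper :: "'k::comm_semiring_1 itself \<Rightarrow> bool" where
  "strongly_proper _ \<longleftrightarrow> (\<forall>(\<Sigma> :: nat set) m n (P :: (nat, 'k) automaton) Q.
     finite \<Sigma> \<longrightarrow> is_automaton \<Sigma> m P \<longrightarrow> is_automaton \<Sigma> n Q \<longrightarrow> behavior P = behavior Q \<longrightarrow>
     equivclp (elementary_step \<Sigma>) P Q)"

definition indexed_partition :: "nat \<Rightarrow> nat \<Rightarrow> (nat \<Rightarrow> nat set) \<Rightarrow> bool" where
  "indexed_partition k m I \<longleftrightarrow> disjoint_family_on I {..<m} \<and> (\<Union>i<m. I i) = {..<k}"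

definition atomistic :: "'a::semiring_1 itself \<Rightarrow> bool" where
  "atomistic _ \<longleftrightarrow> (\<forall>m n (x :: nat \<Rightarrow> 'a) y. 1 \<le> m \<longrightarrow> 1 \<le> n \<longrightarrow>
     (\<Sum>i<m. x i) = (\<Sum>j<n. y j) \<longrightarrow>
     (\<exists>k z I J. indexed_partition k m I \<and> indexed_partition k n J \<and>
       (\<forall>i<m. x i = (\<Sum>l\<in>I i. z l)) \<and> (\<forall>j<n. y j = (\<Sum>l\<in>J j. z l))))"

end

theory Submission
  imports Defs "HOL-Algebra.Bij"
begin

text \<open>
  A rational series is the behavior \<open>\<alpha> M\<^sup>* \<beta>\<close> of an automaton. Morphisms
  preserve sums, products, the action and stars, hence also matrix stars, so that a morphism extending
  \<open>h\<close> must send this series to \<open>\<alpha> h(M)\<^sup>* \<beta>\<close>, the value of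
  the same automaton in \<open>A\<close>. Conversely, Kleene's constructions of automata for sums,
  products, scalar multiples and iterations compute the values in \<open>A\<close> as well as the
  behaviors, so this prescription is a morphism as soon as it does not depend on the automaton.
  Equivalent automata are connected by simulations, because \<open>K\<close> is strongly proper, and it
  remains to show that a simulation of one of the three kinds preserves the value in every partial
  iteration semialgebra (\<open>aut_val_simulation\<close>).

  Stars of matrices are computed by elimination of states: the elimination of \<open>k\<close> replaces
  the entry \<open>M i j\<close> by \<open>M i j + M i k (M k k)\<^sup>* M k j\<close>. By the Conway
  identities two such steps commute (\<open>elim1_commute\<close>). The states can therefore be
  eliminated in any order, and renaming of states, block decompositions and closed sets of states need
  no further computation. An entry need not lie in the ideal as long as every cycle passes through the
  ideal, so that auxiliary states can be entered with weight \<open>1\<close>.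

  An invertible diagonal simulation is a conjugation by central units, which commutes with elimination.
  A dual functional simulation is a functional one in the opposite semialgebra, which satisfies the
  group identities, too (\<open>opposite\<close>). For a functional simulation, the coefficients of the
  transitions from the states of one fibre into the states of another fibre add up to the same
  coefficient, whatever the state of the first fibre is. As \<open>K\<close> is atomistic, these
  decompositions have a common refinement. The simulating automaton thus becomes a system of
  transformations: over each transition of the simulated automaton, every summand of its weight acts as
  a map between the two fibres (\<open>functional_simulation\<close>).

  The core is the theorem \<open>all_lump\<close>: such a system lumps, that is, elimination commutes
  with summation over the fibres. The proof is by induction on the number \<open>n\<close> of points in
  a fibre. If all maps are permutations, the group identities, extended to matrices by elimination of
  one fibre after another (\<open>lumps_elim_group\<close>), give the result for the regular
  representation of the symmetric group, and hence for its action on points. A map that is not a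
  permutation factors through \<open>n - 1\<close> points; a new state with a fibre of
  \<open>n - 1\<close> points is inserted in the middle of its transition. Once the old states, on which only
  permutations act now, are eliminated, there remains a system of transformations on the new states, to
  which the induction hypothesis applies. This takes the place of the Krohn--Rhodes decomposition in the
  theory of group identities.
\<close>

section \<open>Elimination of states\<close>

context partial_conway_semialgebra
begin

lemma ideal_closed: "a \<in> I \<Longrightarrow> a \<in> A"
  using ideal_subset by auto

lemmas closed = zero_closed one_closed add_closed mult_closed act_closed star_closed ideal_closed
  ideal_zero ideal_add ideal_mult_left ideal_mult_right ideal_act

lemma sum_closed: "(\<And>x. x \<in> X \<Longrightarrow> f x \<in> A) \<Longrightarrow> sum f X \<in> A"
  by (induction X rule: infinite_finite_induct) (auto intro: closed)

lemma sum_ideal: "(\<And>x. x \<in> X \<Longrightarrow> f x \<in> I) \<Longrightarrow> sum f X \<in> I"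
  by (induction X rule: infinite_finite_induct) (auto intro: closed)

lemma star_unfold_left: "a \<in> I \<Longrightarrow> star a = 1 + a * star a"
  using product_star[of a 1] by (simp add: closed)

lemma star_unfold_right: "a \<in> I \<Longrightarrow> star a = 1 + star a * a"
  using product_star[of 1 a] by (simp add: closed)

lemma star_slide:
  assumes "a \<in> A" "b \<in> A" "a \<in> I \<or> b \<in> I"
  shows "star (a * b) * a = a * star (b * a)"
proof -
  have "b * a \<in> I"
    using assms by (auto intro: closed)
  then have "star (b * a) = 1 + star (b * a) * (b * a)"
    by (rule star_unfold_right)
  then have "a * star (b * a) = a * (1 + star (b * a) * (b * a))"
    by simp
  also have "\<dots> = (1 + a * star (b * a) * b) * a"
    by (simp add: distrib_left distrib_right mult.assoc)
  also have "\<dots> = star (a * b) * a"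
    using product_star[of a b] assms by simp
  finally show ?thesis by simp
qed

lemma star_commute: "a \<in> I \<Longrightarrow> a * star a = star a * a"
  using star_slide[of a 1] by (simp add: closed)

lemma sum_star': "a \<in> I \<Longrightarrow> b \<in> I \<Longrightarrow> star (a + b) = star a * star (b * star a)"
  using sum_star[of a b] star_slide[of "star a" b] by (simp add: closed)

lemma star_zero: "star 0 = 1"
  using star_unfold_left[of 0] by (simp add: closed)

text \<open>A matrix is a function of two indices, its states. It is guarded if its entries lie in \<open>A\<close>
  and every cycle has an entry in the ideal; the level function makes this condition checkable
  entry by entry.\<close>

definition guarded :: "('i \<Rightarrow> 'i \<Rightarrow> 'a) \<Rightarrow> bool" where
  "guarded M \<longleftrightarrow> (\<forall>i j. M i j \<in> A) \<and>
     (\<exists>lev :: 'i \<Rightarrow> nat. \<forall>i j. lev j \<le> lev i \<longrightarrow> M i j \<in> I)"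

text \<open>The elimination of the state \<open>k\<close>. The state is kept as an index.\<close>

definition elim1 :: "'i \<Rightarrow> ('i \<Rightarrow> 'i \<Rightarrow> 'a) \<Rightarrow> 'i \<Rightarrow> 'i \<Rightarrow> 'a" where
  "elim1 k M = (\<lambda>i j. M i j + M i k * star (M k k) * M k j)"

lemma guarded_closed: "guarded M \<Longrightarrow> M i j \<in> A"
  by (auto simp: guarded_def)

lemma guarded_diag: "guarded M \<Longrightarrow> M i i \<in> I"
  by (auto simp: guarded_def)

lemma guardedI:
  fixes lev :: "'i \<Rightarrow> nat"
  assumes "\<And>i j. M i j \<in> A" and "\<And>i j. lev j \<le> lev i \<Longrightarrow> M i j \<in> I"
  shows "guarded M"
  using assms unfolding guarded_def by blast

lemma guarded_ideal: "(\<And>i j. M i j \<in> I) \<Longrightarrow> guarded M"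
  unfolding guarded_def by (auto intro: closed)

lemma guarded_elim1:
  assumes "guarded M" shows "guarded (elim1 k M)"
proof -
  obtain lev :: "'b \<Rightarrow> nat" where lev: "\<And>i j. lev j \<le> lev i \<Longrightarrow> M i j \<in> I"
    using assms unfolding guarded_def by auto
  have A: "M i j \<in> A" for i j
    using assms by (rule guarded_closed)
  have s: "star (M k k) \<in> A"
    using assms by (intro closed guarded_diag)
  have I: "elim1 k M i j \<in> I" if "lev j \<le> lev i" for i j
  proof (cases "lev k \<le> lev i")
    case True
    then show ?thesis
      unfolding elim1_def using that A s lev by (simp add: closed)
  next
    case False
    then have "M k j \<in> I"
      using that by (intro lev) auto
    then show ?thesis
      unfolding elim1_def using that A s lev by (simp add: closed)
  qed
  have "elim1 k M i j \<in> A" for i j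
    unfolding elim1_def using A s by (simp add: closed)
  then show ?thesis
    using I by (rule guardedI)
qed

text \<open>Here \<open>\<alpha>\<close> and \<open>\<delta>\<close> are the diagonal entries of the star of the matrix with rows \<open>(a, b)\<close> and \<open>(c, d)\<close>.
  The two equations say that it is the same for both orders of elimination.\<close>

lemma two_state_star:
  assumes A: "a \<in> I" "b \<in> A" "c \<in> A" "d \<in> I" and bc: "b \<in> I \<or> c \<in> I"
  defines "\<alpha> \<equiv> star (a + b * star d * c)" and "\<delta> \<equiv> star (d + c * star a * b)"
  shows "\<alpha> = star a + star a * b * \<delta> * c * star a"
    and "\<alpha> * b * star d = star a * b * \<delta>"
proof -
  let ?x = "star a * b" and ?y = "star d * c"
  have xy: "?x \<in> A" "?y \<in> A" "?x \<in> I \<or> ?y \<in> I"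
    using A bc by (auto simp: closed)
  have 1: "b * star d * c \<in> I" "c * star a * b \<in> I"
    using A bc by (auto simp: closed)
  have \<alpha>: "\<alpha> = star (?x * ?y) * star a"
    unfolding \<alpha>_def using sum_star[OF A(1) 1(1)] by (simp add: mult.assoc)
  have \<delta>: "\<delta> = star (?y * ?x) * star d"
    unfolding \<delta>_def using sum_star[OF A(4) 1(2)] by (simp add: mult.assoc)
  show "\<alpha> = star a + star a * b * \<delta> * c * star a"
    unfolding \<alpha> \<delta> using product_star[OF xy] by (simp add: distrib_right mult.assoc)
  have "star (?x * ?y) * ?x = ?x * star (?y * ?x)"
    using xy by (rule star_slide)
  then show "\<alpha> * b * star d = star a * b * \<delta>"
    unfolding \<alpha> \<delta> by (simp add: mult.assoc)
qed

lemma elim1_elim1: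
  assumes M: "guarded M" and kl: "k \<noteq> l"
  defines "a \<equiv> M k k" and "b \<equiv> M k l" and "c \<equiv> M l k" and "d \<equiv> M l l"
  defines "\<alpha> \<equiv> star (a + b * star d * c)" and "\<delta> \<equiv> star (d + c * star a * b)"
  shows "elim1 l (elim1 k M) i j = M i j + M i k * \<alpha> * M k j + M i l * \<delta> * M l j
     + M i k * \<alpha> * b * star d * M l j + M i l * \<delta> * c * star a * M k j"
proof -
  have A: "a \<in> I" "b \<in> A" "c \<in> A" "d \<in> I"
    using M by (auto simp: a_def b_def c_def d_def guarded_closed guarded_diag)
  have bc: "b \<in> I \<or> c \<in> I"
  proof -
    obtain lev :: "'b \<Rightarrow> nat" where "\<And>i j. lev j \<le> lev i \<Longrightarrow> M i j \<in> I"
      using M unfolding guarded_def by auto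
    then show ?thesis
      unfolding b_def c_def using linear[of "lev k" "lev l"] by auto
  qed
  note 1 = two_state_star[OF A bc, folded \<alpha>_def \<delta>_def]
  have "elim1 l (elim1 k M) i j = M i j + M i k * star a * M k j
     + (M i l + M i k * star a * b) * \<delta> * (M l j + c * star a * M k j)"
    by (simp add: elim1_def a_def b_def c_def d_def \<delta>_def)
  also have "\<dots> = M i j + M i k * (star a + star a * b * \<delta> * c * star a) * M k j
     + M i l * \<delta> * M l j + M i k * (star a * b * \<delta>) * M l j + M i l * \<delta> * c * star a * M k j"
    by (simp add: distrib_left distrib_right mult.assoc add_ac)
  also have "\<dots> = M i j + M i k * \<alpha> * M k j
     + M i l * \<delta> * M l j + M i k * (\<alpha> * b * star d) * M l j + M i l * \<delta> * c * star a * M k j"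
    unfolding 1(2) by (simp only: 1(1)[symmetric])
  finally show ?thesis
    by (simp add: mult.assoc)
qed

lemma elim1_commute:
  assumes M: "guarded M"
  shows "elim1 l (elim1 k M) = elim1 k (elim1 l M)"
proof (cases "k = l")
  case False
  have "elim1 l (elim1 k M) i j = elim1 k (elim1 l M) i j" for i j
    unfolding elim1_elim1[OF M False] elim1_elim1[OF M False[symmetric]] by (simp only: add_ac)
  then show ?thesis by auto
qed simp

text \<open>The states of the finite set \<open>S\<close> are eliminated, in any order. The entry at \<open>(i, j)\<close> becomes
  the sum over the nonempty paths from \<open>i\<close> to \<open>j\<close> whose inner states lie in \<open>S\<close>, so that
  \<open>mstar S M\<close> is the star of the matrix \<open>M\<close> restricted to \<open>S\<close>. Matrices that are not guarded are
  left alone, so that the steps commute unconditionally.\<close>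

definition elim :: "'i set \<Rightarrow> ('i \<Rightarrow> 'i \<Rightarrow> 'a) \<Rightarrow> 'i \<Rightarrow> 'i \<Rightarrow> 'a" where
  "elim S M = Finite_Set.fold (\<lambda>k M. if guarded M then elim1 k M else M) M S"

definition mstar :: "'i set \<Rightarrow> ('i \<Rightarrow> 'i \<Rightarrow> 'a) \<Rightarrow> 'i \<Rightarrow> 'i \<Rightarrow> 'a" where
  "mstar S M i j = (if i = j then 1 else 0) + elim S M i j"

lemma comp_fun_commute_elim:
  "comp_fun_commute_on UNIV (\<lambda>k M. if guarded M then elim1 k M else M)"
  by standard (auto simp: fun_eq_iff guarded_elim1 elim1_commute[THEN fun_cong, THEN fun_cong])

lemma elim_empty [simp]: "elim {} M = M"
  by (simp add: elim_def)

lemma guarded_elim: "guarded M \<Longrightarrow> guarded (elim S M)"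
proof (induction S rule: infinite_finite_induct)
  case (insert k S)
  then show ?case
    unfolding elim_def comp_fun_commute_on.fold_insert[OF comp_fun_commute_elim subset_UNIV insert(1,2)]
    by (auto intro: guarded_elim1)
qed (auto simp: elim_def)

lemma elim_insert:
  "guarded M \<Longrightarrow> finite S \<Longrightarrow> k \<notin> S \<Longrightarrow> elim (insert k S) M = elim1 k (elim S M)"
  using guarded_elim[of M S]
  by (simp add: elim_def comp_fun_commute_on.fold_insert[OF comp_fun_commute_elim])

lemma elim_singleton: "guarded M \<Longrightarrow> elim {k} M = elim1 k M"
  by (simp add: elim_insert)

lemma elim_union:
  "guarded M \<Longrightarrow> finite S \<Longrightarrow> finite T \<Longrightarrow> S \<inter> T = {} \<Longrightarrow> elim (S \<union> T) M = elim T (elim S M)"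
  unfolding elim_def
  by (rule comp_fun_commute_on.fold_set_union_disj[OF comp_fun_commute_elim]) auto

lemma elim_commute:
  "guarded M \<Longrightarrow> finite S \<Longrightarrow> finite T \<Longrightarrow> S \<inter> T = {} \<Longrightarrow> elim S (elim T M) = elim T (elim S M)"
  using elim_union[of M S T] elim_union[of M T S] by (simp add: Un_commute Int_commute)

lemma elim1_ideal: "(\<And>i j. M i j \<in> I) \<Longrightarrow> elim1 k M i j \<in> I"
  unfolding elim1_def by (simp add: closed)

lemma elim_ideal:
  assumes "\<And>i j. M i j \<in> I" shows "elim S M i j \<in> I"
proof (induction S arbitrary: i j rule: infinite_finite_induct)
  case (insert k S)
  then show ?case
    using elim1_ideal[of "elim S M"] assms by (simp add: elim_insert guarded_ideal)
qed (use assms in \<open>auto simp: elim_def\<close>)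

lemma elim_closed: "guarded M \<Longrightarrow> elim S M i j \<in> A"
  by (intro guarded_closed guarded_elim)

lemma mstar_closed: "guarded M \<Longrightarrow> mstar S M i j \<in> A"
  by (simp add: mstar_def elim_closed closed)

lemma elim_unfold_left:
  assumes M: "guarded M" and S: "finite S"
  shows "elim S M i j = M i j + (\<Sum>s\<in>S. M i s * elim S M s j)"
  using S
proof (induction S arbitrary: i j)
  case (insert k S)
  define P where "P = elim S M"
  have E: "elim (insert k S) M = elim1 k P"
    using insert(1,2) M by (simp add: elim_insert P_def)
  have P: "guarded P"
    unfolding P_def using M by (rule guarded_elim)
  let ?s = "star (P k k)"
  have IH: "P i j = M i j + (\<Sum>s\<in>S. M i s * P s j)" for i j
    unfolding P_def by (rule insert.IH)
  have s: "P k j + P k k * ?s * P k j = ?s * P k j"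
  proof -
    have "P k j + P k k * ?s * P k j = (1 + P k k * ?s) * P k j"
      by (simp add: distrib_right)
    then show ?thesis
      by (simp only: star_unfold_left[OF guarded_diag[OF P, of k], symmetric])
  qed
  have "M i j + (\<Sum>s\<in>insert k S. M i s * elim1 k P s j) =
      (M i j + (\<Sum>s\<in>S. M i s * P s j)) + (\<Sum>s\<in>S. M i s * P s k) * ?s * P k j
        + M i k * (P k j + P k k * ?s * P k j)"
    using insert(1,2) by (simp add: elim1_def sum.distrib distrib_left sum_distrib_right mult.assoc add_ac)
  also have "\<dots> = P i j + (M i k + (\<Sum>s\<in>S. M i s * P s k)) * ?s * P k j"
    by (simp only: s IH[of i j, symmetric]) (simp add: distrib_right mult.assoc add_ac)
  also have "\<dots> = elim1 k P i j"
    by (simp only: IH[of i k, symmetric]) (simp add: elim1_def)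
  finally show ?case
    by (simp add: E)
qed simp

lemma elim_unfold_right:
  assumes M: "guarded M" and S: "finite S"
  shows "elim S M i j = M i j + (\<Sum>s\<in>S. elim S M i s * M s j)"
  using S
proof (induction S arbitrary: i j)
  case (insert k S)
  define P where "P = elim S M"
  have E: "elim (insert k S) M = elim1 k P"
    using insert(1,2) M by (simp add: elim_insert P_def)
  have P: "guarded P"
    unfolding P_def using M by (rule guarded_elim)
  let ?s = "star (P k k)"
  have IH: "P i j = M i j + (\<Sum>s\<in>S. P i s * M s j)" for i j
    unfolding P_def by (rule insert.IH)
  have s: "P i k + P i k * ?s * P k k = P i k * ?s"
  proof -
    have "P i k + P i k * ?s * P k k = P i k * (1 + ?s * P k k)"
      by (simp add: distrib_left mult.assoc)
    then show ?thesis
      by (simp only: star_unfold_right[OF guarded_diag[OF P, of k], symmetric])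
  qed
  have "M i j + (\<Sum>s\<in>insert k S. elim1 k P i s * M s j) =
      (M i j + (\<Sum>s\<in>S. P i s * M s j)) + P i k * ?s * (\<Sum>s\<in>S. P k s * M s j)
        + (P i k + P i k * ?s * P k k) * M k j"
    using insert(1,2) by (simp add: elim1_def sum.distrib distrib_right sum_distrib_left mult.assoc add_ac)
  also have "\<dots> = P i j + P i k * ?s * (M k j + (\<Sum>s\<in>S. P k s * M s j))"
    by (simp only: s IH[of i j, symmetric]) (simp add: distrib_left mult.assoc add_ac)
  also have "\<dots> = elim1 k P i j"
    by (simp only: IH[of k j, symmetric]) (simp add: elim1_def)
  finally show ?case
    by (simp add: E)
qed simp

lemma sum_delta_mult:
  assumes "finite S" "i \<in> S"
  shows "(\<Sum>s\<in>S. (if i = s then 1 else 0) * f s) = (f i :: 'a)"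
proof -
  have "(\<Sum>s\<in>S. (if i = s then 1 else 0) * f s) = (\<Sum>s\<in>S. if i = s then f s else 0)"
    by (rule sum.cong) auto
  then show ?thesis
    using assms by simp
qed

lemma sum_mult_delta:
  assumes "finite S" "j \<in> S"
  shows "(\<Sum>s\<in>S. f s * (if s = j then 1 else 0)) = (f j :: 'a)"
proof -
  have "(\<Sum>s\<in>S. f s * (if s = j then 1 else 0)) = (\<Sum>s\<in>S. if s = j then f s else 0)"
    by (rule sum.cong) auto
  then show ?thesis
    using assms by simp
qed

lemma elim_eq_mult_mstar:
  assumes M: "guarded M" and S: "finite S" and j: "j \<in> S"
  shows "elim S M i j = (\<Sum>s\<in>S. M i s * mstar S M s j)"
  unfolding mstar_def distrib_left sum.distrib sum_mult_delta[OF S j]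
  using M S by (rule elim_unfold_left)

lemma elim_eq_mstar_mult:
  assumes M: "guarded M" and S: "finite S" and i: "i \<in> S"
  shows "elim S M i j = (\<Sum>s\<in>S. mstar S M i s * M s j)"
  unfolding mstar_def distrib_right sum.distrib sum_delta_mult[OF S i]
  using M S by (rule elim_unfold_right)

text \<open>A whole set of states is eliminated at once by means of the star of its block.\<close>

lemma elim_eq_mstar:
  assumes M: "guarded M" and S: "finite S"
  shows "elim S M i j = M i j + (\<Sum>s\<in>S. \<Sum>t\<in>S. M i s * mstar S M s t * M t j)"
proof -
  have "(\<Sum>s\<in>S. M i s * elim S M s j) = (\<Sum>s\<in>S. \<Sum>t\<in>S. M i s * mstar S M s t * M t j)"
    by (rule sum.cong) (simp_all add: elim_eq_mstar_mult[OF M S] sum_distrib_left mult.assoc)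
  with elim_unfold_left[OF M S, of i j] show ?thesis
    by (rule trans[OF _ arg_cong])
qed

lemma elim_reindex:
  assumes M: "guarded M" and M': "guarded M'" and S: "finite S" "S \<subseteq> X"
    and \<phi>: "inj_on \<phi> X" and eq: "\<And>i j. i \<in> X \<Longrightarrow> j \<in> X \<Longrightarrow> M' (\<phi> i) (\<phi> j) = M i j"
    and ij: "i \<in> X" "j \<in> X"
  shows "elim (\<phi> ` S) M' (\<phi> i) (\<phi> j) = elim S M i j"
  using S ij
proof (induction S arbitrary: i j)
  case (insert k S)
  have k: "\<phi> k \<notin> \<phi> ` S" "k \<in> X" "S \<subseteq> X"
    using \<phi> insert(2) insert.prems by (auto simp: inj_on_def)
  have "elim (\<phi> ` insert k S) M' = elim1 (\<phi> k) (elim (\<phi> ` S) M')"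
    unfolding image_insert using M' insert(1) k(1) by (intro elim_insert) auto
  moreover have "elim (insert k S) M = elim1 k (elim S M)"
    using M insert(1,2) by (rule elim_insert)
  ultimately show ?case
    by (simp only: elim1_def insert.IH[OF k(3)] k(2) insert.prems)
qed (simp add: eq)

lemma elim_cong:
  assumes "guarded M" "guarded M'" "finite S" "S \<subseteq> X"
    and "\<And>i j. i \<in> X \<Longrightarrow> j \<in> X \<Longrightarrow> M' i j = M i j" and "i \<in> X" "j \<in> X"
  shows "elim S M' i j = elim S M i j"
proof -
  have "elim (id ` S) M' (id i) (id j) = elim S M i j"
    using assms by (intro elim_reindex[where X = X]) auto
  then show ?thesis by simp
qed

lemma elim_reindex_fst:
  assumes M: "guarded M" and M': "guarded M'" and fin: "finite P" "finite X" and e: "inj_on e P"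
    and eq: "\<And>p q i j. p \<in> P \<Longrightarrow> q \<in> P \<Longrightarrow> i \<in> X \<Longrightarrow> j \<in> X \<Longrightarrow> M' (e p, i) (e q, j) = M (p, i) (q, j)"
    and "p \<in> P" "q \<in> P" "i \<in> X" "j \<in> X"
  shows "elim (e ` P \<times> X) M' (e p, i) (e q, j) = elim (P \<times> X) M (p, i) (q, j)"
proof -
  have "elim (map_prod e id ` (P \<times> X)) M' (map_prod e id (p, i)) (map_prod e id (q, j)) =
      elim (P \<times> X) M (p, i) (q, j)"
    using assms by (intro elim_reindex[OF M M', where X = "P \<times> X"]) (auto intro: map_prod_inj_on)
  moreover have "map_prod e id ` (P \<times> X) = e ` P \<times> X"
    by (rule map_prod_surj_on) auto
  ultimately show ?thesis
    by simp
qed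

text \<open>No path leaves a set of states that no transition leaves.\<close>

lemma elim_closed_set:
  assumes M: "guarded M" and S: "finite S"
    and C: "\<And>i j. i \<in> C \<Longrightarrow> j \<notin> C \<Longrightarrow> M i j = 0"
    and i: "i \<in> C"
  shows "j \<notin> C \<Longrightarrow> elim S M i j = 0" and "j \<in> C \<Longrightarrow> elim S M i j = elim (S \<inter> C) M i j"
proof -
  have "(j \<notin> C \<longrightarrow> elim S M i j = 0) \<and> (j \<in> C \<longrightarrow> elim S M i j = elim (S \<inter> C) M i j)"
    if "i \<in> C" for i j
    using S that
  proof (induction S arbitrary: i j)
    case empty
    then show ?case using C by simp
  next
    case (insert k S)
    show ?case
    proof (cases "k \<in> C")
      case True
      then have "insert k S \<inter> C = insert k (S \<inter> C)"
        by auto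
      then show ?thesis
        using insert True M by (simp add: elim_insert elim1_def)
    next
      case False
      then have "insert k S \<inter> C = S \<inter> C"
        by auto
      then show ?thesis
        using insert False M by (simp add: elim_insert elim1_def)
    qed
  qed
  then show "j \<notin> C \<Longrightarrow> elim S M i j = 0" and "j \<in> C \<Longrightarrow> elim S M i j = elim (S \<inter> C) M i j"
    using i by auto
qed

end

subsection \<open>The star of a matrix\<close>

context partial_conway_semialgebra
begin

text \<open>The first \<open>n\<close> rows and columns of a matrix, extended by zeros.\<close>

definition entries :: "nat \<Rightarrow> 'a mat \<Rightarrow> nat \<Rightarrow> nat \<Rightarrow> 'a" where
  "entries n M i j = (if i < n \<and> j < n then M $$ (i, j) else 0)"

lemma elim1_same: "a \<in> I \<Longrightarrow> a + a * star a * a = star a * a"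
proof -
  assume a: "a \<in> I"
  have "a + a * star a * a = (1 + a * star a) * a"
    by (simp add: distrib_right)
  then show ?thesis
    by (simp only: star_unfold_left[OF a, symmetric])
qed

lemma elim1_diag:
  assumes "guarded M" shows "1 + elim1 k M k k = star (M k k)"
  using elim1_same[OF guarded_diag[OF assms, of k]] star_unfold_right[OF guarded_diag[OF assms, of k]]
  by (simp add: elim1_def)

lemma elim1_row:
  assumes "guarded M" shows "elim1 k M k j = star (M k k) * M k j"
proof -
  have "elim1 k M k j = (1 + M k k * star (M k k)) * M k j"
    by (simp add: elim1_def distrib_right)
  then show ?thesis
    by (simp only: star_unfold_left[OF guarded_diag[OF assms, of k], symmetric])
qed

lemma elim1_column:
  assumes "guarded M" shows "elim1 k M i k = M i k * star (M k k)"
proof -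
  have "elim1 k M i k = M i k * (1 + star (M k k) * M k k)"
    by (simp add: elim1_def distrib_left mult.assoc)
  then show ?thesis
    by (simp only: star_unfold_right[OF guarded_diag[OF assms, of k], symmetric])
qed

lemma mstar_cong:
  assumes "guarded M" "guarded M'" "finite S" "S \<subseteq> X"
    and "\<And>i j. i \<in> X \<Longrightarrow> j \<in> X \<Longrightarrow> M' i j = M i j" and "i \<in> X" "j \<in> X"
  shows "mstar S M' i j = mstar S M i j"
  unfolding mstar_def using elim_cong[OF assms] by simp

text \<open>The recursion splits off the last state. The other rows of the star are those of the elimination of
  the last state before the others, the last row is that of its elimination after them.\<close>

lemma mat_star_eq:
  assumes "1 \<le> n" "M \<in> carrier_mat n n" "\<And>i j. i < n \<Longrightarrow> j < n \<Longrightarrow> M $$ (i, j) \<in> I"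
  shows "mat_star star n M \<in> carrier_mat n n \<and>
    (\<forall>i<n. \<forall>j<n. mat_star star n M $$ (i, j) = mstar {..<n} (entries n M) i j)"
  using assms
proof (induction n arbitrary: M rule: dec_induct)
  case base
  have g: "guarded (entries 1 M)"
    using base by (intro guarded_ideal) (auto simp: entries_def closed)
  have "mstar {..<1} (entries 1 M) 0 0 = star (entries 1 M 0 0)"
    using elim1_diag[OF g, of 0] elim_singleton[OF g, of 0] by (simp add: mstar_def lessThan_Suc)
  moreover have "entries 1 M 0 0 = M $$ (0, 0)"
    by (simp add: entries_def)
  ultimately show ?case
    using base by simp
next
  case (step n)
  then obtain m where n: "n = Suc m"
    by (cases n) auto
  define f where "f = entries (Suc n) M"
  have fI: "f i j \<in> I" for i j
    unfolding f_def entries_def using step.prems by (auto simp: closed)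
  have f: "guarded f"
    using fI by (rule guarded_ideal)
  define P Q where "P = elim1 n f" and "Q = elim {..<n} f"
  have PI: "P i j \<in> I" and QI: "Q i j \<in> I" for i j
    unfolding P_def Q_def using fI by (auto intro: elim1_ideal elim_ideal)
  have P: "guarded P" and Q: "guarded Q"
    using PI QI by (auto intro: guarded_ideal)
  have S: "{..<Suc n} = insert n {..<n}"
    by auto
  have EP: "elim {..<Suc n} f = elim {..<n} P"
    using elim_union[OF f, of "{n}" "{..<n}"] elim_singleton[OF f] by (simp add: P_def S)
  have EQ: "elim {..<Suc n} f = elim1 n Q"
    unfolding S Q_def using f by (intro elim_insert) auto
  obtain X Y U V where split: "split_block M n n = (X, Y, U, V)"
    by (cases "split_block M n n")
  have dim: "dim_row M = Suc n" "dim_col M = Suc n"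
    using step.prems by auto
  have X: "X \<in> carrier_mat n n" and XI: "i < n \<Longrightarrow> j < n \<Longrightarrow> X $$ (i, j) = f i j"
    and Y: "Y \<in> carrier_mat n 1" and YI: "i < n \<Longrightarrow> Y $$ (i, 0) = f i n"
    and U: "U \<in> carrier_mat 1 n" and UI: "j < n \<Longrightarrow> U $$ (0, j) = f n j"
    and V: "V \<in> carrier_mat 1 1" and VI: "V $$ (0, 0) = f n n" for i j
    using split[symmetric] dim by (auto simp: split_block_def Let_def f_def entries_def)
  have star: "mat_star star n N \<in> carrier_mat n n"
      "\<And>i j. i < n \<Longrightarrow> j < n \<Longrightarrow> mat_star star n N $$ (i, j) = mstar {..<n} g i j"
    if N: "N \<in> carrier_mat n n" "\<And>i j. i < n \<Longrightarrow> j < n \<Longrightarrow> N $$ (i, j) = g i j" and g: "\<And>i j. g i j \<in> I" for N g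
  proof -
    have NI: "N $$ (i, j) \<in> I" if "i < n" "j < n" for i j
      using N(2)[OF that] g by simp
    note * = step.IH[OF N(1) NI]
    show "mat_star star n N \<in> carrier_mat n n"
      using * by blast
    fix i j assume ij: "i < n" "j < n"
    have "mstar {..<n} (entries n N) i j = mstar {..<n} g i j"
      using ij NI g N(2) by (intro mstar_cong[where X = "{..<n}"] guarded_ideal) (auto simp: entries_def closed)
    then show "mat_star star n N $$ (i, j) = mstar {..<n} g i j"
      using * ij by simp
  qed
  define X' V' where "X' = mat_star star n X" and "V' = mat_star star (Suc 0) V"
  define \<alpha> \<delta> where "\<alpha> = mat_star star n (X + Y * V' * U)" and "\<delta> = mat_star star (Suc 0) (V + U * X' * Y)"
  have V': "V' \<in> carrier_mat 1 1" "V' $$ (0, 0) = star (f n n)"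
    using V VI by (auto simp: V'_def)
  have X': "X' \<in> carrier_mat n n" "\<And>i j. i < n \<Longrightarrow> j < n \<Longrightarrow> X' $$ (i, j) = mstar {..<n} f i j"
    unfolding X'_def using star[OF X XI fI] by auto
  have "(X + Y * V' * U) $$ (i, j) = P i j" if "i < n" "j < n" for i j
    using that X Y U V' XI YI UI by (simp add: scalar_prod_def P_def elim1_def mult.assoc)
  then have \<alpha>: "\<alpha> \<in> carrier_mat n n" "\<And>i j. i < n \<Longrightarrow> j < n \<Longrightarrow> \<alpha> $$ (i, j) = mstar {..<n} P i j"
    unfolding \<alpha>_def using star[of "X + Y * V' * U" P] X Y U V' PI by auto
  have "(V + U * X' * Y) $$ (0, 0) = f n n + (\<Sum>s<n. \<Sum>t<n. f n s * mstar {..<n} f s t * f t n)"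
    using X' Y U V YI UI VI
    by (simp add: scalar_prod_def sum_distrib_left sum_distrib_right mult.assoc atLeast0LessThan)
  also have "\<dots> = Q n n"
    unfolding Q_def elim_eq_mstar[OF f finite_lessThan] by simp
  finally have \<delta>: "\<delta> \<in> carrier_mat 1 1" "\<delta> $$ (0, 0) = star (Q n n)"
    unfolding \<delta>_def using V X' U Y by auto
  have eq: "mat_star star (Suc n) M = four_block_mat \<alpha> (\<alpha> * Y * V') (\<delta> * U * X') \<delta>"
    using split by (simp add: n Let_def X'_def V'_def \<alpha>_def \<delta>_def)
  have "(\<alpha> * Y * V') $$ (i, 0) = elim {..<n} P i n" if i: "i < n" for i
  proof -
    have "(\<alpha> * Y * V') $$ (i, 0) = (\<Sum>s<n. mstar {..<n} P i s * f s n * star (f n n))"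
      using i \<alpha> Y V' YI by (simp add: scalar_prod_def sum_distrib_left sum_distrib_right mult.assoc atLeast0LessThan)
    also have "\<dots> = (\<Sum>s<n. mstar {..<n} P i s * P s n)"
      by (simp add: P_def elim1_column[OF f] mult.assoc)
    also have "\<dots> = elim {..<n} P i n"
      using i by (intro elim_eq_mstar_mult[OF P, symmetric]) auto
    finally show ?thesis .
  qed
  moreover have "(\<delta> * U * X') $$ (0, j) = elim1 n Q n j" if j: "j < n" for j
  proof -
    have "(\<delta> * U * X') $$ (0, j) = star (Q n n) * (\<Sum>s<n. f n s * mstar {..<n} f s j)"
      using j \<delta> U X' UI by (simp add: scalar_prod_def sum_distrib_left sum_distrib_right mult.assoc atLeast0LessThan)
    also have "\<dots> = star (Q n n) * Q n j"
      unfolding Q_def using j elim_eq_mult_mstar[OF f, of "{..<n}" j n] by simp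
    finally show ?thesis
      by (simp add: elim1_row[OF Q])
  qed
  moreover have "\<alpha> $$ (i, j) = mstar {..<Suc n} f i j" if "i < n" "j < n" for i j
    using \<alpha>(2)[OF that] by (simp add: mstar_def EP)
  moreover have "\<delta> $$ (0, 0) = mstar {..<Suc n} f n n"
    using \<delta>(2) elim1_diag[OF Q] by (simp add: mstar_def EQ)
  ultimately have "mat_star star (Suc n) M $$ (i, j) = mstar {..<Suc n} f i j" if "i < Suc n" "j < Suc n" for i j
    unfolding eq using that \<alpha>(1) \<delta>(1)
    by (cases "i < n"; cases "j < n") (auto simp: less_Suc_eq mstar_def EP EQ[symmetric])
  moreover have "mat_star star (Suc n) M \<in> carrier_mat (Suc n) (Suc n)"
    unfolding eq using \<alpha>(1) \<delta>(1) by (metis four_block_carrier_mat Suc_eq_plus1)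
  ultimately show ?case
    by (simp add: f_def)
qed

subsection \<open>Lumping of states\<close>

text \<open>The map \<open>\<rho>\<close> from \<open>X\<close> to \<open>Y\<close> is a functional simulation from \<open>M\<close> to \<open>N\<close>.\<close>

definition lumps :: "('i \<Rightarrow> 'j) \<Rightarrow> 'i set \<Rightarrow> ('i \<Rightarrow> 'i \<Rightarrow> 'a) \<Rightarrow> 'j set \<Rightarrow> ('j \<Rightarrow> 'j \<Rightarrow> 'a) \<Rightarrow> bool" where
  "lumps \<rho> X M Y N \<longleftrightarrow> (\<forall>i\<in>X. \<forall>q\<in>Y. (\<Sum>j\<in>{j \<in> X. \<rho> j = q}. M i j) = N (\<rho> i) q)"

lemma sum_lump:
  fixes f :: "'i \<Rightarrow> 'b::semiring_1"
  assumes "finite S" "finite T" "\<rho> ` S \<subseteq> T"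
  shows "(\<Sum>t\<in>S. f t * g (\<rho> t)) = (\<Sum>t'\<in>T. (\<Sum>t\<in>{t \<in> S. \<rho> t = t'}. f t) * g t')"
proof -
  have "(\<Sum>t\<in>S. f t * g (\<rho> t)) = (\<Sum>t'\<in>T. \<Sum>t\<in>{t \<in> S. \<rho> t = t'}. f t * g (\<rho> t))"
    using assms by (rule sum.group[symmetric])
  also have "\<dots> = (\<Sum>t'\<in>T. (\<Sum>t\<in>{t \<in> S. \<rho> t = t'}. f t) * g t')"
    unfolding sum_distrib_right by (rule sum.cong) (auto intro: sum.cong)
  finally show ?thesis .
qed

text \<open>If the star of the block over \<open>T\<close> is lumped, then the elimination of this block preserves
  lumping on all states.\<close>

lemma lumps_elim:
  assumes M: "guarded M" and N: "guarded N" and fin: "finite X" "finite Y"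
    and \<rho>: "\<rho> ` X \<subseteq> Y" and lump: "lumps \<rho> X M Y N"
    and T: "T \<subseteq> Y" and S: "S = {i \<in> X. \<rho> i \<in> T}"
    and block: "lumps \<rho> S (elim S M) T (elim T N)"
  shows "lumps \<rho> X (elim S M) Y (elim T N)"
  unfolding lumps_def
proof (intro ballI)
  fix i q assume i: "i \<in> X" and q: "q \<in> Y"
  have finS: "finite S" and finT: "finite T"
    using fin T by (auto simp: S intro: finite_subset)
  have \<rho>S: "\<rho> ` S \<subseteq> T"
    by (auto simp: S)
  let ?F = "{j \<in> X. \<rho> j = q}"
  have l: "(\<Sum>j\<in>?F. M i j) = N (\<rho> i) q" if "i \<in> X" for i
    using lump that q by (simp add: lumps_def)
  have l': "(\<Sum>t\<in>{t \<in> S. \<rho> t = t'}. M i t) = N (\<rho> i) t'" if t': "t' \<in> T" for t'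
  proof -
    have "{t \<in> S. \<rho> t = t'} = {t \<in> X. \<rho> t = t'}"
      using t' by (auto simp: S)
    moreover have "t' \<in> Y"
      using t' T by auto
    ultimately show ?thesis
      using lump i by (simp add: lumps_def)
  qed
  have inner: "(\<Sum>t\<in>S. mstar S M s t * N (\<rho> t) q) = elim T N (\<rho> s) q" if s: "s \<in> S" for s
  proof -
    have "(\<Sum>t\<in>{t \<in> S. \<rho> t = t'}. mstar S M s t) = mstar T N (\<rho> s) t'" if t': "t' \<in> T" for t'
    proof -
      have "(\<Sum>t\<in>{t \<in> S. \<rho> t = t'}. if s = t then 1 else 0 :: 'a) = (if \<rho> s = t' then 1 else 0)"
        using finS s by auto
      moreover have "(\<Sum>t\<in>{t \<in> S. \<rho> t = t'}. elim S M s t) = elim T N (\<rho> s) t'"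
        using block s t' by (simp add: lumps_def)
      ultimately show ?thesis
        by (simp add: mstar_def sum.distrib)
    qed
    then have "(\<Sum>t\<in>S. mstar S M s t * N (\<rho> t) q) = (\<Sum>t'\<in>T. mstar T N (\<rho> s) t' * N t' q)"
      using sum_lump[OF finS finT \<rho>S, of "mstar S M s" "\<lambda>t. N t q"] by simp
    also have "\<dots> = elim T N (\<rho> s) q"
      using s \<rho>S by (intro elim_eq_mstar_mult[OF N finT, symmetric]) auto
    finally show ?thesis .
  qed
  have "(\<Sum>j\<in>?F. elim S M i j) =
      (\<Sum>j\<in>?F. M i j) + (\<Sum>j\<in>?F. \<Sum>s\<in>S. \<Sum>t\<in>S. M i s * mstar S M s t * M t j)"
    by (simp only: elim_eq_mstar[OF M finS] sum.distrib)
  also have "(\<Sum>j\<in>?F. \<Sum>s\<in>S. \<Sum>t\<in>S. M i s * mstar S M s t * M t j) =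
      (\<Sum>s\<in>S. \<Sum>t\<in>S. \<Sum>j\<in>?F. M i s * mstar S M s t * M t j)"
    by (subst sum.swap, rule sum.cong[OF refl], rule sum.swap)
  also have "\<dots> = (\<Sum>s\<in>S. M i s * (\<Sum>t\<in>S. mstar S M s t * (\<Sum>j\<in>?F. M t j)))"
    by (simp add: sum_distrib_left mult.assoc)
  also have "\<dots> = (\<Sum>s\<in>S. M i s * (\<Sum>t\<in>S. mstar S M s t * N (\<rho> t) q))"
    by (intro sum.cong arg_cong2[where f = "(*)"] refl l) (simp add: S)
  also have "\<dots> = (\<Sum>s\<in>S. M i s * elim T N (\<rho> s) q)"
    using inner by simp
  also have "\<dots> = (\<Sum>s'\<in>T. N (\<rho> i) s' * elim T N s' q)"
    using l' sum_lump[OF finS finT \<rho>S, of "M i" "\<lambda>s. elim T N s q"] by simp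
  also have "(\<Sum>j\<in>?F. M i j) + \<dots> = elim T N (\<rho> i) q"
    by (simp only: l[OF i] elim_unfold_left[OF N finT, of "\<rho> i" q])
  finally show "(\<Sum>j\<in>?F. elim S M i j) = elim T N (\<rho> i) q" .
qed

lemma lumps_fst_iff:
  "lumps fst (SIGMA p:P. X p) M P N \<longleftrightarrow>
     (\<forall>p\<in>P. \<forall>x\<in>X p. \<forall>q\<in>P. (\<Sum>y\<in>X q. M (p, x) (q, y)) = N p q)"
proof -
  have "{j \<in> (SIGMA p:P. X p). fst j = q} = Pair q ` X q" if "q \<in> P" for q
    using that by auto
  then have "(\<Sum>j\<in>{j \<in> (SIGMA p:P. X p). fst j = q}. M i j) = (\<Sum>y\<in>X q. M i (q, y))"
    if "q \<in> P" for i q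
    using that by (simp add: sum.reindex inj_on_def)
  then show ?thesis
    unfolding lumps_def by (auto simp: Ball_def)
qed

end

subsection \<open>Matrices that are invariant under a group\<close>

lemma (in group) bij_betw_translate: "g \<in> carrier G \<Longrightarrow> bij_betw (\<lambda>h. g \<otimes> h) (carrier G) (carrier G)"
  by (simp add: bij_betw_def inj_on_cmult surj_const_mult)

context partial_iteration_semialgebra
begin

text \<open>A matrix that is invariant under left translations is the matrix of the group identity, for
  any numbering of the group. Here the group may have any type.\<close>

lemma group_row_sum:
  fixes G (structure) and K :: "'g \<Rightarrow> 'g \<Rightarrow> 'a"
  assumes G: "group G" and fin: "finite (carrier G)" and K: "\<And>g h. K g h \<in> I"
    and inv: "\<And>k g h. k \<in> carrier G \<Longrightarrow> g \<in> carrier G \<Longrightarrow> h \<in> carrier G \<Longrightarrow>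
      K (k \<otimes> g) (k \<otimes> h) = K g h"
    and g: "g \<in> carrier G"
  shows "(\<Sum>h\<in>carrier G. mstar (carrier G) K g h) = star (\<Sum>h\<in>carrier G. K g h)"
proof -
  interpret group G by (rule G)
  define n where "n = card (carrier G)"
  obtain e0 where "bij_betw e0 {..<n} (carrier G)"
    using fin unfolding n_def using ex_bij_betw_nat_finite[OF fin] by (auto simp: atLeast0LessThan)
  have n: "0 < n"
    using fin g by (auto simp: n_def card_gt_0_iff)
  \<comment> \<open>an enumeration of the group that starts with \<open>g\<close>, so that the row of \<open>g\<close> comes first\<close>
  define e where "e = (\<lambda>x. (g \<otimes> inv (e0 0)) \<otimes> x) \<circ> e0"
  have e00: "e0 0 \<in> carrier G"
    using n \<open>bij_betw e0 {..<n} (carrier G)\<close> by (auto simp: bij_betw_def)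
  have "bij_betw (\<lambda>x. (g \<otimes> inv (e0 0)) \<otimes> x) (carrier G) (carrier G)"
    using g e00 by (intro bij_betw_translate) auto
  then have e: "bij_betw e {..<n} (carrier G)"
    unfolding e_def using \<open>bij_betw e0 {..<n} (carrier G)\<close> by (rule bij_betw_trans[rotated])
  have e0: "e 0 = g"
    using g e00 by (simp add: e_def m_assoc)
  define d where "d = inv_into {..<n} e"
  have eC: "e a \<in> carrier G" if "a < n" for a
    using e that by (auto simp: bij_betw_def)
  have d: "d x < n" "e (d x) = x" if "x \<in> carrier G" for x
    using that e bij_betw_inv_into[OF e] by (auto simp: d_def bij_betw_def f_inv_into_f)
  have de: "d (e a) = a" if "a < n" for a
    using that e by (auto simp: d_def bij_betw_def)
  define H :: "nat monoid" where
    "H = \<lparr>carrier = {..<n}, monoid.mult = (\<lambda>a b. d (e a \<otimes> e b)), one = d \<one>\<rparr>"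
  have H: "carrier H = {..<n}" "a \<otimes>\<^bsub>H\<^esub> b = d (e a \<otimes> e b)" "\<one>\<^bsub>H\<^esub> = d \<one>" for a b
    by (simp_all add: H_def)
  have "group H"
  proof (rule groupI)
    fix a assume "a \<in> carrier H"
    then show "\<exists>b\<in>carrier H. b \<otimes>\<^bsub>H\<^esub> a = \<one>\<^bsub>H\<^esub>"
      by (intro bexI[of _ "d (inv (e a))"]) (auto simp: H d eC)
  qed (auto simp: H d eC m_assoc de)
  then interpret H: group H .
  have inv_H: "inv\<^bsub>H\<^esub> a = d (inv (e a))" if "a < n" for a
    using that by (intro H.inv_equality) (auto simp: H d eC)
  define x where "x a = K \<one> (e a)" for a
  let ?M = "group_mat H n x"
  have M: "?M $$ (a, b) = K (e a) (e b)" if "a < n" "b < n" for a b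
  proof -
    have "?M $$ (a, b) = K \<one> (inv (e a) \<otimes> e b)"
      using that by (simp add: group_mat_def x_def H inv_H d eC)
    also have "\<dots> = K (e a \<otimes> \<one>) (e a \<otimes> (inv (e a) \<otimes> e b))"
      using that by (intro inv[symmetric]) (auto simp: eC)
    also have "\<dots> = K (e a) (e b)"
      using that by (simp add: eC m_assoc[symmetric])
    finally show ?thesis .
  qed
  have gM: "guarded (entries n ?M)"
    using K by (intro guarded_ideal) (auto simp: entries_def M closed)
  have star_M: "mat_star star n ?M $$ (0, b) = mstar (carrier G) K g (e b)" if b: "b < n" for b
  proof -
    have "elim (e ` {..<n}) K (e 0) (e b) = elim {..<n} (entries n ?M) 0 b"
      using b n e K
      by (intro elim_reindex[OF gM guarded_ideal, where X = "{..<n}"])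
         (auto simp: entries_def M bij_betw_def)
    moreover have "e 0 = e b \<longleftrightarrow> 0 = b"
      using b n e by (auto simp: bij_betw_def inj_on_def)
    moreover have "mat_star star n ?M $$ (0, b) = mstar {..<n} (entries n ?M) 0 b"
      using mat_star_eq[of n ?M] n b K by (auto simp: M) (simp add: group_mat_def)
    ultimately show ?thesis
      using e by (simp add: mstar_def e0 bij_betw_def)
  qed
  have "(\<Sum>h\<in>carrier G. mstar (carrier G) K g h) = (\<Sum>b<n. mstar (carrier G) K g (e b))"
    using e by (rule sum.reindex_bij_betw[symmetric])
  also have "\<dots> = (\<Sum>b<n. mat_star star n ?M $$ (0, b))"
    using star_M by simp
  also have "\<dots> = star (\<Sum>b<n. x b)"
    using K by (intro group_identity \<open>group H\<close>) (auto simp: H x_def)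
  also have "(\<Sum>b<n. x b) = (\<Sum>h\<in>carrier G. K \<one> h)"
    unfolding x_def using e by (rule sum.reindex_bij_betw)
  also have "\<dots> = (\<Sum>h\<in>carrier G. K (g \<otimes> \<one>) (g \<otimes> h))"
    using g by (intro sum.cong refl inv[symmetric]) auto
  also have "\<dots> = (\<Sum>h\<in>carrier G. K g (g \<otimes> h))"
    using g by simp
  also have "\<dots> = (\<Sum>h\<in>carrier G. K g h)"
    using g by (intro sum.reindex_bij_betw bij_betw_translate)
  finally show ?thesis .
qed

text \<open>The group identities for matrices in place of scalars: states are pairs of a state of the
  quotient and an element of the group, and the group acts by left translation.\<close>

lemma lumps_elim_group:
  fixes G (structure) and R :: "'p \<times> 'g \<Rightarrow> 'p \<times> 'g \<Rightarrow> 'a"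
  assumes G: "group G" and fin: "finite (carrier G)" "finite P"
    and R: "\<And>i j. R i j \<in> I" and Y: "\<And>p q. Y p q \<in> I"
    and inv: "\<And>k g h p q. k \<in> carrier G \<Longrightarrow> g \<in> carrier G \<Longrightarrow> h \<in> carrier G \<Longrightarrow>
       p \<in> P \<Longrightarrow> q \<in> P \<Longrightarrow> R (p, k \<otimes> g) (q, k \<otimes> h) = R (p, g) (q, h)"
    and lump: "lumps fst (P \<times> carrier G) R P Y"
  shows "lumps fst (P \<times> carrier G) (elim (P \<times> carrier G) R) P (elim P Y)"
proof -
  interpret group G by (rule G)
  let ?C = "carrier G"
  have gR: "guarded R" and gY: "guarded Y"
    using R Y by (auto intro: guarded_ideal)
  have "lumps fst (P \<times> ?C) (elim (S \<times> ?C) R) P (elim S Y)" if "finite S" "S \<subseteq> P" for S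
    using that
  proof (induction S)
    case empty
    then show ?case using lump by simp
  next
    case (insert r S)
    define R' where "R' = elim (S \<times> ?C) R"
    define Y' where "Y' = elim S Y"
    have r: "r \<in> P" and S: "S \<subseteq> P"
      using insert.prems by auto
    have R': "R' i j \<in> I" and Y': "Y' p q \<in> I" for i j p q
      unfolding R'_def Y'_def using R Y by (auto intro: elim_ideal)
    have gR': "guarded R'" and gY': "guarded Y'"
      using R' Y' by (auto intro: guarded_ideal)
    have lump': "lumps fst (P \<times> ?C) R' P Y'"
      unfolding R'_def Y'_def using insert S by auto
    have inv': "R' (p, k \<otimes> g) (q, k \<otimes> h) = R' (p, g) (q, h)"
      if "k \<in> ?C" "g \<in> ?C" "h \<in> ?C" "p \<in> P" "q \<in> P" for k g h p q
    proof -
      let ?\<phi> = "map_prod id (\<lambda>x. k \<otimes> x) :: 'p \<times> _ \<Rightarrow> _"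
      have "?\<phi> ` (S \<times> ?C) = S \<times> ?C"
        using \<open>k \<in> ?C\<close> surj_const_mult[of k] by (simp add: map_prod_surj_on)
      moreover have "elim (?\<phi> ` (S \<times> ?C)) R (?\<phi> (p, g)) (?\<phi> (q, h)) = elim (S \<times> ?C) R (p, g) (q, h)"
        using that insert(1) S fin inv
        by (intro elim_reindex[OF gR gR, where X = "P \<times> ?C"]) (auto simp: inj_on_def)
      ultimately show ?thesis
        by (simp add: R'_def)
    qed
    have block: "lumps fst ({r} \<times> ?C) (elim ({r} \<times> ?C) R') {r} (elim {r} Y')"
      unfolding lumps_fst_iff
    proof (clarsimp)
      fix g assume g: "g \<in> ?C"
      let ?K = "\<lambda>g h. R' (r, g) (r, h)"
      have gK: "guarded ?K"
        using R' by (intro guarded_ideal) auto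
      have row: "(\<Sum>h\<in>?C. ?K u h) = Y' r r" if "u \<in> ?C" for u
        using lump' that r by (simp add: lumps_fst_iff)
      have "elim ({r} \<times> ?C) R' (r, g) (r, h) = elim ?C ?K g h" if "h \<in> ?C" for h
      proof -
        have "elim (Pair r ` ?C) R' (r, g) (r, h) = elim ?C ?K g h"
          using g that fin by (intro elim_reindex[OF gK gR', where X = "?C"]) (auto simp: inj_on_def)
        moreover have "Pair r ` ?C = {r} \<times> ?C"
          by auto
        ultimately show ?thesis by simp
      qed
      then have "(\<Sum>h\<in>?C. elim ({r} \<times> ?C) R' (r, g) (r, h)) = (\<Sum>h\<in>?C. elim ?C ?K g h)"
        by simp
      also have "\<dots> = (\<Sum>h\<in>?C. \<Sum>u\<in>?C. ?K g u * mstar ?C ?K u h)"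
        by (intro sum.cong refl elim_eq_mult_mstar[OF gK fin(1)])
      also have "\<dots> = (\<Sum>u\<in>?C. ?K g u * (\<Sum>h\<in>?C. mstar ?C ?K u h))"
        by (subst sum.swap) (simp add: sum_distrib_left)
      also have "\<dots> = (\<Sum>u\<in>?C. ?K g u * star (Y' r r))"
      proof (intro sum.cong refl arg_cong2[where f = "(*)"])
        fix u assume u: "u \<in> ?C"
        have "(\<Sum>h\<in>?C. mstar ?C ?K u h) = star (\<Sum>h\<in>?C. ?K u h)"
          using R' inv' r u by (intro group_row_sum[OF G fin(1)]) auto
        then show "(\<Sum>h\<in>?C. mstar ?C ?K u h) = star (Y' r r)"
          using row[OF u] by simp
      qed
      also have "\<dots> = Y' r r * star (Y' r r)"
        using row[OF g] by (simp add: sum_distrib_right[symmetric])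
      also have "\<dots> = elim {r} Y' r r"
        by (simp add: elim_singleton[OF gY'] elim1_column[OF gY'])
      finally show "(\<Sum>h\<in>?C. elim ({r} \<times> ?C) R' (r, g) (r, h)) = elim {r} Y' r r" .
    qed
    have "lumps fst (P \<times> ?C) (elim ({r} \<times> ?C) R') P (elim {r} Y')"
      by (rule lumps_elim[OF gR' gY' _ _ _ lump' _ _ block]) (use r fin in auto)
    moreover have "elim ({r} \<times> ?C) R' = elim (insert r S \<times> ?C) R"
    proof -
      have "insert r S \<times> ?C = S \<times> ?C \<union> {r} \<times> ?C"
        by auto
      moreover have "S \<times> ?C \<inter> {r} \<times> ?C = {}"
        using insert(2) by auto
      ultimately show ?thesis
        unfolding R'_def using insert(1) fin elim_union[OF gR, of "S \<times> ?C" "{r} \<times> ?C"] by simp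
    qed
    moreover have "elim {r} Y' = elim (insert r S) Y"
      using elim_union[OF gY, of S "{r}"] insert(1,2) by (simp add: Y'_def)
    ultimately show ?case by simp
  qed
  then show ?thesis
    using fin by auto
qed

end

section \<open>Systems of transformations\<close>

text \<open>Over a set \<open>P\<close> of base states, \<open>y p q l\<close> is the weight of the transition with label \<open>l\<close> from \<open>p\<close>
  to \<open>q\<close>. In the labelled matrix every base state \<open>p\<close> is replaced by \<open>r p\<close> copies, and that transition
  takes copy \<open>i\<close> of \<open>p\<close> to copy \<open>d p q l i\<close> of \<open>q\<close>.\<close>

definition base_mat :: "'p set \<Rightarrow> 'l set \<Rightarrow> ('p \<Rightarrow> 'p \<Rightarrow> 'l \<Rightarrow> 'a::comm_monoid_add) \<Rightarrow> 'p \<Rightarrow> 'p \<Rightarrow> 'a" where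
  "base_mat P L y p q = (if p \<in> P \<and> q \<in> P then \<Sum>l\<in>L. y p q l else 0)"

definition label_mat :: "'p set \<Rightarrow> ('p \<Rightarrow> nat) \<Rightarrow> 'l set \<Rightarrow> ('p \<Rightarrow> 'p \<Rightarrow> 'l \<Rightarrow> nat \<Rightarrow> nat) \<Rightarrow>
    ('p \<Rightarrow> 'p \<Rightarrow> 'l \<Rightarrow> 'a::comm_monoid_add) \<Rightarrow> 'p \<times> nat \<Rightarrow> 'p \<times> nat \<Rightarrow> 'a" where
  "label_mat P r L d y = (\<lambda>(p, i) (q, j).
     if p \<in> P \<and> q \<in> P \<and> i < r p \<and> j < r q
     then \<Sum>l\<in>L. if d p q l i = j then y p q l else 0 else 0)"

lemma sum_if_eq:
  fixes f :: "'l \<Rightarrow> nat" and y :: "'l \<Rightarrow> 'a::comm_monoid_add"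
  assumes "\<And>l. l \<in> L \<Longrightarrow> y l \<noteq> 0 \<Longrightarrow> f l < m"
  shows "(\<Sum>j<m. \<Sum>l\<in>L. if f l = j then y l else 0) = (\<Sum>l\<in>L. y l)"
proof -
  have "(\<Sum>j<m. \<Sum>l\<in>L. if f l = j then y l else 0) = (\<Sum>l\<in>L. \<Sum>j<m. if f l = j then y l else 0)"
    by (rule sum.swap)
  also have "\<dots> = (\<Sum>l\<in>L. y l)"
    using assms by (intro sum.cong refl) (simp, blast)
  finally show ?thesis .
qed

text \<open>The symmetric group on \<open>n\<close> points with the product in the order of application, first \<open>f\<close> and then
  \<open>g\<close>, so that it acts on the points from the right, like a system of transformations.\<close>

definition perm_group :: "nat \<Rightarrow> (nat \<Rightarrow> nat) monoid" where
  "perm_group n = \<lparr>carrier = Bij {..<n}, monoid.mult = (\<lambda>f g. compose {..<n} g f),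
     one = (\<lambda>x\<in>{..<n}. x)\<rparr>"

lemma Bij_lessThan:
  "f \<in> Bij {..<n} \<Longrightarrow> i < n \<Longrightarrow> f i < n"
  "f \<in> Bij {..<n} \<Longrightarrow> f \<in> {..<n} \<rightarrow>\<^sub>E {..<n}"
  by (auto simp: Bij_def bij_betw_def PiE_def)

lemma finite_Bij_lessThan: "finite (Bij {..<n :: nat})"
proof (rule finite_subset)
  show "finite ({..<n} \<rightarrow>\<^sub>E {..<n})"
    by (intro finite_PiE) auto
qed (auto dest: Bij_lessThan(2))

lemma group_perm_group: "group (perm_group n)"
proof (rule groupI)
  fix f assume f: "f \<in> carrier (perm_group n)"
  then have "restrict (inv_into {..<n} f) {..<n} \<in> Bij {..<n}"
    by (auto simp: perm_group_def intro: restrict_inv_into_Bij)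
  moreover have "compose {..<n} f (restrict (inv_into {..<n} f) {..<n}) = (\<lambda>x\<in>{..<n}. x)"
    using f by (auto simp: perm_group_def compose_def Bij_def bij_betw_def fun_eq_iff f_inv_into_f)
  ultimately show "\<exists>g\<in>carrier (perm_group n). g \<otimes>\<^bsub>perm_group n\<^esub> f = \<one>\<^bsub>perm_group n\<^esub>"
    by (auto simp: perm_group_def)
next
  fix f g h assume "f \<in> carrier (perm_group n)" "g \<in> carrier (perm_group n)" "h \<in> carrier (perm_group n)"
  then show "f \<otimes>\<^bsub>perm_group n\<^esub> g \<otimes>\<^bsub>perm_group n\<^esub> h = f \<otimes>\<^bsub>perm_group n\<^esub> (g \<otimes>\<^bsub>perm_group n\<^esub> h)"
    by (auto simp: perm_group_def compose_def Bij_lessThan fun_eq_iff)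
next
  fix f assume "f \<in> carrier (perm_group n)"
  then have "f \<in> Bij {..<n}" "f \<in> extensional {..<n}"
    by (auto simp: perm_group_def Bij_def)
  then show "\<one>\<^bsub>perm_group n\<^esub> \<otimes>\<^bsub>perm_group n\<^esub> f = f"
    by (auto simp: perm_group_def compose_def fun_eq_iff extensional_def)
qed (auto simp: perm_group_def intro: compose_Bij id_Bij)

context partial_conway_semialgebra
begin

lemma base_mat_ideal: "(\<And>p q l. y p q l \<in> I) \<Longrightarrow> base_mat P L y p q \<in> I"
  by (simp add: base_mat_def sum_ideal closed)

lemma label_mat_ideal: "(\<And>p q l. y p q l \<in> I) \<Longrightarrow> label_mat P r L d y i j \<in> I"
  by (cases i; cases j) (auto simp: label_mat_def closed intro!: sum_ideal)

lemma lumps_label_mat: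
  assumes "\<And>p q l i. p \<in> P \<Longrightarrow> q \<in> P \<Longrightarrow> l \<in> L \<Longrightarrow> i < r p \<Longrightarrow> y p q l \<noteq> 0 \<Longrightarrow> d p q l i < r q"
  shows "lumps fst (SIGMA p:P. {..<r p}) (label_mat P r L d y) P (base_mat P L y)"
  unfolding lumps_fst_iff
proof (intro ballI)
  fix p i q assume p: "p \<in> P" and i: "i \<in> {..<r p}" and q: "q \<in> P"
  then have "(\<Sum>j<r q. label_mat P r L d y (p, i) (q, j)) =
      (\<Sum>j<r q. \<Sum>l\<in>L. if d p q l i = j then y p q l else 0)"
    by (simp add: label_mat_def)
  also have "\<dots> = (\<Sum>l\<in>L. y p q l)"
    using assms[OF p q] i by (intro sum_if_eq) auto
  finally show "(\<Sum>j<r q. label_mat P r L d y (p, i) (q, j)) = base_mat P L y p q"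
    using p q by (simp add: base_mat_def)
qed

text \<open>All systems with \<open>n\<close> copies of every base state lump. Base states are natural numbers and labels
  are the transformations themselves; the general case reduces to this one by renaming the base
  states and by merging the labels that act alike.\<close>

definition all_lump :: "nat \<Rightarrow> bool" where
  "all_lump n \<longleftrightarrow> (\<forall>P :: nat set. \<forall>y. finite P \<longrightarrow> (\<forall>p q f. y p q f \<in> I) \<longrightarrow>
     lumps fst (P \<times> {..<n})
       (elim (P \<times> {..<n}) (label_mat P (\<lambda>_. n) ({..<n} \<rightarrow>\<^sub>E {..<n}) (\<lambda>_ _ f. f) y))
       P (elim P (base_mat P ({..<n} \<rightarrow>\<^sub>E {..<n}) y)))"

lemma all_lumpD:
  fixes P :: "'p set" and L :: "'l set"
  assumes lump: "all_lump n" and fin: "finite P" "finite L" and y: "\<And>p q l. y p q l \<in> I"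
    and d: "\<And>p q l i. p \<in> P \<Longrightarrow> q \<in> P \<Longrightarrow> l \<in> L \<Longrightarrow> i < n \<Longrightarrow> d p q l i < n"
  shows "lumps fst (P \<times> {..<n}) (elim (P \<times> {..<n}) (label_mat P (\<lambda>_. n) L d y))
    P (elim P (base_mat P L y))"
proof -
  obtain e :: "'p \<Rightarrow> nat" where e: "inj_on e P"
    using finite_imp_inj_to_nat_seg[OF fin(1)] by blast
  let ?F = "{..<n} \<rightarrow>\<^sub>E {..<n}"
  let ?D = "\<lambda>p q l. restrict (d p q l) {..<n}"
  define y' where "y' a b f =
    (\<Sum>l\<in>{l \<in> L. ?D (inv_into P e a) (inv_into P e b) l = f}. y (inv_into P e a) (inv_into P e b) l)" for a b f
  have y': "y' a b f \<in> I" for a b f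
    unfolding y'_def using y by (auto intro: sum_ideal)
  have y'_eq: "y' (e p) (e q) f = (\<Sum>l\<in>{l \<in> L. ?D p q l = f}. y p q l)" if "p \<in> P" "q \<in> P" for p q f
    unfolding y'_def using that e by (simp add: inv_into_f_f)
  let ?M = "label_mat P (\<lambda>_. n) L d y" and ?N = "base_mat P L y"
  let ?M' = "label_mat (e ` P) (\<lambda>_. n) ?F (\<lambda>_ _ f. f) y'" and ?N' = "base_mat (e ` P) ?F y'"
  have gM: "guarded ?M" "guarded ?M'" and gN: "guarded ?N" "guarded ?N'"
    using y y' by (auto intro!: guarded_ideal label_mat_ideal base_mat_ideal)
  have DF: "?D p q ` L \<subseteq> ?F" if "p \<in> P" "q \<in> P" for p q
    using d that by (auto split: if_splits)
  have finF: "finite ?F"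
    by (intro finite_PiE) auto
  have M': "?M' (map_prod e id i) (map_prod e id j) = ?M i j"
    if i: "i \<in> P \<times> {..<n}" and j: "j \<in> P \<times> {..<n}" for i j
  proof -
    obtain p i' q j' where ij: "i = (p, i')" "j = (q, j')" "p \<in> P" "q \<in> P" "i' < n" "j' < n"
      using i j by auto
    have "?M' (map_prod e id i) (map_prod e id j) =
        (\<Sum>f\<in>?F. if f i' = j' then y' (e p) (e q) f else 0)"
      using ij by (simp add: label_mat_def)
    also have "\<dots> = (\<Sum>f\<in>?F. \<Sum>l\<in>{l \<in> L. ?D p q l = f}. if f i' = j' then y p q l else 0)"
      by (rule sum.cong[OF refl], unfold y'_eq[OF ij(3,4)]) simp
    also have "\<dots> = (\<Sum>f\<in>?F. \<Sum>l\<in>{l \<in> L. ?D p q l = f}. if d p q l i' = j' then y p q l else 0)"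
      using ij by (intro sum.cong) auto
    also have "\<dots> = (\<Sum>l\<in>L. if d p q l i' = j' then y p q l else 0)"
      using fin finF DF ij by (intro sum.group) auto
    also have "\<dots> = ?M i j"
      using ij by (simp add: label_mat_def)
    finally show ?thesis .
  qed
  have N': "?N' (e p) (e q) = ?N p q" if "p \<in> P" "q \<in> P" for p q
    using that fin finF DF by (simp add: base_mat_def y'_eq sum.group)
  have EM: "elim (e ` P \<times> {..<n}) ?M' (e p, i) (e q, j) = elim (P \<times> {..<n}) ?M (p, i) (q, j)"
    if "p \<in> P" "q \<in> P" "i < n" "j < n" for p q i j
    using that fin e M'[of "(_, _)" "(_, _)"] by (intro elim_reindex_fst[OF gM]) auto
  have EN: "elim (e ` P) ?N' (e p) (e q) = elim P ?N p q" if "p \<in> P" "q \<in> P" for p q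
    using that fin e by (intro elim_reindex[OF gN, where X = P] N') auto
  have "lumps fst (e ` P \<times> {..<n}) (elim (e ` P \<times> {..<n}) ?M') (e ` P) (elim (e ` P) ?N')"
    using lump y' fin by (simp add: all_lump_def)
  then show ?thesis
    unfolding lumps_fst_iff by (simp add: EM EN)
qed

end

context partial_iteration_semialgebra
begin

text \<open>Systems of permutations. The regular representation gives weights \<open>W\<close> which describe the star
  of the system on the permuted points; the group identities are used over the base states and over
  the pairs of a base state and a point.\<close>

lemma elim_perm_system:
  fixes P :: "'p set" and n :: nat
  defines "B \<equiv> Bij {..<n}"
  assumes fin: "finite P" and y: "\<And>p q g. y p q g \<in> I"
  obtains W where "\<And>p q g. W p q g \<in> I"
    and "\<And>p q i j. p \<in> P \<Longrightarrow> q \<in> P \<Longrightarrow> i < n \<Longrightarrow> j < n \<Longrightarrow>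
      elim (P \<times> {..<n}) (label_mat P (\<lambda>_. n) B (\<lambda>_ _ g. g) y) (p, i) (q, j) =
        (\<Sum>g\<in>B. if g i = j then W p q g else 0)"
    and "\<And>p q. p \<in> P \<Longrightarrow> q \<in> P \<Longrightarrow> (\<Sum>g\<in>B. W p q g) = elim P (base_mat P B y) p q"
proof -
  define G where "G = perm_group n"
  interpret G: group G
    unfolding G_def by (rule group_perm_group)
  have C: "carrier G = B"
    by (simp add: G_def perm_group_def B_def)
  have finB: "finite B"
    by (simp add: B_def finite_Bij_lessThan)
  have mult: "(g \<otimes>\<^bsub>G\<^esub> h) i = h (g i)" if "i < n" for g h i
    using that by (simp add: G_def perm_group_def compose_def)
  have one: "\<one>\<^bsub>G\<^esub> i = i" if "i < n" for i
    using that by (simp add: G_def perm_group_def)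
  have Bn: "g i < n" if "g \<in> B" "i < n" for g i
    using that by (simp add: B_def Bij_lessThan)
  have translate: "(\<Sum>h\<in>B. f (inv\<^bsub>G\<^esub> g \<otimes>\<^bsub>G\<^esub> h)) = (\<Sum>h\<in>B. f h)" if "g \<in> B" for g and f :: "_ \<Rightarrow> 'a"
    using that unfolding C[symmetric] by (intro sum.reindex_bij_betw G.bij_betw_translate G.inv_closed)
  have cancel: "inv\<^bsub>G\<^esub> (k \<otimes>\<^bsub>G\<^esub> g) \<otimes>\<^bsub>G\<^esub> (k \<otimes>\<^bsub>G\<^esub> h) = inv\<^bsub>G\<^esub> g \<otimes>\<^bsub>G\<^esub> h" if "g \<in> B" "h \<in> B" "k \<in> B" for g h k
    using that unfolding C[symmetric]
    by (simp add: G.inv_mult_group G.m_assoc) (simp add: G.m_assoc[symmetric])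
  define R where "R = (\<lambda>(p, g) (q, h). if p \<in> P \<and> q \<in> P \<and> g \<in> B \<and> h \<in> B
    then y p q (inv\<^bsub>G\<^esub> g \<otimes>\<^bsub>G\<^esub> h) else 0)"
  define R' where "R' = (\<lambda>((p, i), g) ((q, j), h).
    if p \<in> P \<and> q \<in> P \<and> g \<in> B \<and> h \<in> B \<and> i < n \<and> j < n \<and> (inv\<^bsub>G\<^esub> g \<otimes>\<^bsub>G\<^esub> h) i = j
    then y p q (inv\<^bsub>G\<^esub> g \<otimes>\<^bsub>G\<^esub> h) else 0)"
  have RI: "R i j \<in> I" for i j
    using y by (auto simp: R_def closed split: prod.splits)
  have R'I: "R' i j \<in> I" for i j
    using y by (auto simp: R'_def closed split: prod.splits)
  let ?M = "label_mat P (\<lambda>_. n) B (\<lambda>_ _ g. g) y" and ?N = "base_mat P B y"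
  let ?E = "elim (P \<times> {..<n}) ?M"
  define W where "W p q g = elim (P \<times> B) R (p, \<one>\<^bsub>G\<^esub>) (q, g)" for p q g
  have "lumps fst (P \<times> carrier G) (elim (P \<times> carrier G) R) P (elim P ?N)"
  proof (rule lumps_elim_group)
    show "lumps fst (P \<times> carrier G) R P ?N"
      using translate by (auto simp: lumps_fst_iff C R_def base_mat_def)
  qed (use fin finB RI y in \<open>auto simp: C R_def cancel base_mat_ideal G.m_closed[unfolded C] group_perm_group G.is_group\<close>)
  then have W_sum: "(\<Sum>g\<in>B. W p q g) = elim P ?N p q" if "p \<in> P" "q \<in> P" for p q
    using that G.one_closed by (simp add: lumps_fst_iff C W_def)
  have "lumps fst ((P \<times> {..<n}) \<times> carrier G) (elim ((P \<times> {..<n}) \<times> carrier G) R') (P \<times> {..<n}) ?E"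
  proof (rule lumps_elim_group)
    show "lumps fst ((P \<times> {..<n}) \<times> carrier G) R' (P \<times> {..<n}) ?M"
      unfolding lumps_fst_iff C
    proof clarsimp
      fix p i g q j assume *: "p \<in> P" "i < n" "g \<in> B" "q \<in> P" "j < n"
      have "(\<Sum>h\<in>B. R' ((p, i), g) ((q, j), h)) =
          (\<Sum>h\<in>B. if (inv\<^bsub>G\<^esub> g \<otimes>\<^bsub>G\<^esub> h) i = j then y p q (inv\<^bsub>G\<^esub> g \<otimes>\<^bsub>G\<^esub> h) else 0)"
        using * by (simp add: R'_def)
      also have "\<dots> = ?M (p, i) (q, j)"
        using * translate[of g "\<lambda>h. if h i = j then y p q h else 0"] by (simp add: label_mat_def)
      finally show "(\<Sum>h\<in>B. R' ((p, i), g) ((q, j), h)) = ?M (p, i) (q, j)" .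
    qed
  qed (use fin finB R'I y in \<open>auto simp: C R'_def cancel label_mat_ideal G.m_closed[unfolded C] G.is_group\<close>)
  then have E_sum: "?E (p, i) (q, j) = (\<Sum>h\<in>B. elim ((P \<times> {..<n}) \<times> B) R' ((p, i), \<one>\<^bsub>G\<^esub>) ((q, j), h))"
    if "p \<in> P" "q \<in> P" "i < n" "j < n" for p q i j
    using that G.one_closed by (simp add: lumps_fst_iff C)
  have "elim ((P \<times> {..<n}) \<times> B) R' ((p, i), \<one>\<^bsub>G\<^esub>) ((q, j), h) = (if h i = j then W p q h else 0)"
    if pq: "p \<in> P" "q \<in> P" "i < n" "j < n" "h \<in> B" for p q i j h
  proof -
    \<comment> \<open>the states that are reachable from the neutral element over the point \<open>i\<close>\<close>
    define \<phi> where "\<phi> = (\<lambda>(p :: 'p, g :: nat \<Rightarrow> nat). ((p, g i), g))"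
    define D where "D = \<phi> ` (P \<times> B)"
    have gR: "guarded R" "guarded R'"
      using RI R'I by (auto intro: guarded_ideal)
    have D: "((p, k), g) \<in> D \<longleftrightarrow> p \<in> P \<and> g \<in> B \<and> k = g i" for p k g
      by (auto simp: D_def \<phi>_def)
    have act: "(inv\<^bsub>G\<^esub> g \<otimes>\<^bsub>G\<^esub> h) (g i) = h i" if "g \<in> B" "h \<in> B" for g h
    proof -
      have "(inv\<^bsub>G\<^esub> g \<otimes>\<^bsub>G\<^esub> h) (g i) = h ((g \<otimes>\<^bsub>G\<^esub> inv\<^bsub>G\<^esub> g) i)"
        using that pq Bn by (simp add: mult)
      then show ?thesis
        using that pq by (simp add: C one)
    qed
    have closedD: "R' a b = 0" if "a \<in> D" "b \<notin> D" for a b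
    proof -
      obtain p k g q l h where "a = ((p, k), g)" "b = ((q, l), h)"
        by (metis prod.exhaust)
      then show ?thesis
        using that act by (auto simp: D R'_def)
    qed
    have start: "((p, i), \<one>\<^bsub>G\<^esub>) \<in> D"
      using pq G.one_closed by (simp add: D C one)
    have fin': "finite ((P \<times> {..<n}) \<times> B)"
      using fin finB by simp
    note * = elim_closed_set[OF gR(2) fin' closedD start]
    show ?thesis
    proof (cases "h i = j")
      case False
      then have "((q, j), h) \<notin> D"
        by (auto simp: D)
      then show ?thesis
        using * False by simp
    next
      case True
      have "((P \<times> {..<n}) \<times> B) \<inter> D = D"
        using Bn pq by (auto simp: D)
      then have "elim ((P \<times> {..<n}) \<times> B) R' ((p, i), \<one>\<^bsub>G\<^esub>) ((q, j), h) = elim D R' ((p, i), \<one>\<^bsub>G\<^esub>) ((q, j), h)"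
        using * True pq by (simp add: D)
      also have "\<dots> = elim (\<phi> ` (P \<times> B)) R' (\<phi> (p, \<one>\<^bsub>G\<^esub>)) (\<phi> (q, h))"
        using True pq by (simp add: \<phi>_def one D_def)
      also have "\<dots> = elim (P \<times> B) R (p, \<one>\<^bsub>G\<^esub>) (q, h)"
      proof (rule elim_reindex[OF gR, where X = "P \<times> B"])
        show "R' (\<phi> a) (\<phi> b) = R a b" if "a \<in> P \<times> B" "b \<in> P \<times> B" for a b
          using that act Bn pq by (auto simp: R_def R'_def \<phi>_def)
      qed (use pq fin finB G.one_closed in \<open>auto simp: C inj_on_def \<phi>_def\<close>)
      finally show ?thesis
        using True by (simp add: W_def)
    qed
  qed
  then have E: "?E (p, i) (q, j) = (\<Sum>g\<in>B. if g i = j then W p q g else 0)"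
    if "p \<in> P" "q \<in> P" "i < n" "j < n" for p q i j
    using that E_sum by simp
  have WI: "W p q g \<in> I" for p q g
    unfolding W_def using RI by (rule elim_ideal)
  show ?thesis
    by (rule that[OF WI E W_sum])
qed

text \<open>Every transformation of \<open>Suc n\<close> points that is not a permutation factors through \<open>n\<close> points. A new
  base state with \<open>n\<close> copies is put in the middle of each such transition, the first half of which
  has weight \<open>1\<close>. Elimination of the old states, on which only permutations act now, leaves a system
  of transformations of \<open>n\<close> points on the new states.\<close>

lemma all_lump_Suc:
  assumes lump: "all_lump n"
  shows "all_lump (Suc n)"
  unfolding all_lump_def
proof (intro allI impI)
  fix P :: "nat set" and y :: "nat \<Rightarrow> nat \<Rightarrow> (nat \<Rightarrow> nat) \<Rightarrow> 'a"
  assume fin: "finite P" and "\<forall>p q f. y p q f \<in> I"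
  then have y: "y p q f \<in> I" for p q f
    by blast
  define N where "N = Suc n"
  define F where "F = {..<N} \<rightarrow>\<^sub>E {..<N}"
  define B where "B = Bij {..<N}"
  have finF: "finite F"
    unfolding F_def by (intro finite_PiE) auto
  have BF: "B \<subseteq> F"
    unfolding B_def F_def using Bij_lessThan(2) by blast
  have finB: "finite B"
    using BF finF by (rule finite_subset)
  have Fn: "f i < N" if "f \<in> F" "i < N" for f i
    using that by (auto simp: F_def)
  have missed: "\<exists>c<N. c \<notin> f ` {..<N}" if "f \<in> F - B" for f
  proof (rule ccontr)
    assume "\<not> ?thesis"
    moreover have "f ` {..<N} \<subseteq> {..<N}" "f \<in> extensional {..<N}"
      using that by (auto simp: F_def PiE_def)
    ultimately have "f ` {..<N} = {..<N}" "f \<in> extensional {..<N}"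
      by auto
    then have "f \<in> B"
      by (simp add: B_def Bij_def bij_betw_def eq_card_imp_inj_on)
    then show False
      using that by simp
  qed
  \<comment> \<open>\<open>c f\<close> is a point missed by \<open>f\<close>; \<open>s f\<close> closes the gap at \<open>c f\<close> after \<open>f\<close>, and \<open>e f\<close> opens it again\<close>
  define c where "c f = (SOME c. c < N \<and> c \<notin> f ` {..<N})" for f :: "nat \<Rightarrow> nat"
  have c: "c f < N" "\<And>i. i < N \<Longrightarrow> f i \<noteq> c f" if "f \<in> F - B" for f
  proof -
    have *: "c f < N \<and> c f \<notin> f ` {..<N}"
      unfolding c_def using missed[OF that] by (rule someI_ex)
    show "c f < N" "\<And>i. i < N \<Longrightarrow> f i \<noteq> c f"
      using * by force+
  qed
  define s where "s f i = (if f i < c f then f i else f i - 1)" for f :: "nat \<Rightarrow> nat" and i :: nat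
  define e where "e f k = (if k < c f then k else Suc k)" for f :: "nat \<Rightarrow> nat" and k :: nat
  have s: "s f i < n" if "f \<in> F - B" "i < N" for f i
    using that c[of f] Fn[of f i] by (force simp: s_def N_def)
  have e: "e f k < N" if "k < n" for f k
    using that by (simp add: e_def N_def)
  have es: "e f (s f i) = f i" if "f \<in> F - B" "i < N" for f i
    using that c[of f] by (force simp: s_def e_def)

  \<comment> \<open>the new base states: one for each old state and each transformation that is not a permutation\<close>
  define T where "T = P \<times> (F - B)"
  have finT: "finite T"
    using fin finF by (simp add: T_def)
  define P' :: "(nat + nat \<times> (nat \<Rightarrow> nat)) set" where "P' = Inl ` P \<union> Inr ` T"
  define r :: "nat + nat \<times> (nat \<Rightarrow> nat) \<Rightarrow> nat" where "r = case_sum (\<lambda>_. N) (\<lambda>_. n)"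
  define d' :: "nat + nat \<times> (nat \<Rightarrow> nat) \<Rightarrow> nat + nat \<times> (nat \<Rightarrow> nat) \<Rightarrow> (nat \<Rightarrow> nat) \<Rightarrow> nat \<Rightarrow> nat"
    where "d' a b f = (case a of Inl _ \<Rightarrow> (case b of Inl _ \<Rightarrow> f | Inr _ \<Rightarrow> s f) | Inr _ \<Rightarrow> e f)" for a b f
  define y' where "y' a b f = (case a of
      Inl p \<Rightarrow> (case b of Inl q \<Rightarrow> if f \<in> B then y p q f else 0 | Inr t \<Rightarrow> if t = (p, f) then 1 else 0)
    | Inr t \<Rightarrow> (case b of Inl q \<Rightarrow> if snd t = f then y (fst t) q f else 0 | Inr _ \<Rightarrow> 0))" for a b f
  define M where "M = label_mat P' r F d' y'"
  define K where "K = base_mat P' F y'"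
  define S1 :: "((nat + nat \<times> (nat \<Rightarrow> nat)) \<times> nat) set" where "S1 = Inl ` P \<times> {..<N}"
  define S2 :: "((nat + nat \<times> (nat \<Rightarrow> nat)) \<times> nat) set" where "S2 = Inr ` T \<times> {..<n}"
  have X: "(SIGMA p:P'. {..<r p}) = S1 \<union> S2"
    by (auto simp: P'_def r_def S1_def S2_def)
  have finS: "finite S1" "finite S2" "S1 \<inter> S2 = {}"
    using fin finT by (auto simp: S1_def S2_def)
  let ?M0 = "label_mat P (\<lambda>_. N) F (\<lambda>_ _ f. f) y" and ?K0 = "base_mat P F y"
  let ?M1 = "label_mat P (\<lambda>_. N) B (\<lambda>_ _ f. f) y" and ?K1 = "base_mat P B y"

  have M1: "M (Inl p, i) (Inl q, j) = ?M1 (p, i) (q, j)"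
    if "p \<in> P" "q \<in> P" "i < N" "j < N" for p q i j
    using that finF BF by (auto simp: M_def label_mat_def P'_def r_def d'_def y'_def intro!: sum.mono_neutral_cong_right)
  have M2: "M (Inl p, i) (Inr t, k) = (if fst t = p \<and> s (snd t) i = k then 1 else 0)"
    if "p \<in> P" "t \<in> T" "i < N" "k < n" for p t i k
  proof -
    have "M (Inl p, i) (Inr t, k) = (\<Sum>f\<in>F. if s f i = k then if t = (p, f) then 1 else 0 else 0)"
      using that by (simp add: M_def label_mat_def P'_def r_def d'_def y'_def cong: if_cong)
    also have "\<dots> = (\<Sum>f\<in>F. if f = snd t then if fst t = p \<and> s (snd t) i = k then 1 else 0 else 0)"
      by (intro sum.cong refl) (cases t, auto)
    finally show ?thesis
      using that finF by (auto simp: T_def)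
  qed
  have M3: "M (Inr t, k) (Inl q, j) = (if e (snd t) k = j then y (fst t) q (snd t) else 0)"
    if "q \<in> P" "t \<in> T" "k < n" "j < N" for q t k j
  proof -
    have "M (Inr t, k) (Inl q, j) = (\<Sum>f\<in>F. if e f k = j then if snd t = f then y (fst t) q f else 0 else 0)"
      using that by (simp add: M_def label_mat_def P'_def r_def d'_def y'_def cong: if_cong)
    also have "\<dots> = (\<Sum>f\<in>F. if f = snd t then if e (snd t) k = j then y (fst t) q (snd t) else 0 else 0)"
      by (intro sum.cong refl) auto
    finally show ?thesis
      using that finF by (auto simp: T_def)
  qed
  have M4: "M (Inr t, i) (Inr t', j) = 0" for t t' i j
    by (simp add: M_def label_mat_def y'_def cong: if_cong)
  have K1: "K (Inl p) (Inl q) = ?K1 p q" if "p \<in> P" "q \<in> P" for p q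
    using that finF BF by (auto simp: K_def base_mat_def P'_def y'_def intro!: sum.mono_neutral_cong_right)
  have K2: "K (Inl p) (Inr t) = (if fst t = p then 1 else 0)" if "p \<in> P" "t \<in> T" for p t
  proof -
    have "K (Inl p) (Inr t) = (\<Sum>f\<in>F. if t = (p, f) then 1 else 0)"
      using that by (simp add: K_def base_mat_def P'_def y'_def)
    also have "\<dots> = (\<Sum>f\<in>F. if f = snd t then if fst t = p then 1 else 0 else 0)"
      by (intro sum.cong refl) (cases t, auto)
    finally show ?thesis
      using that finF by (auto simp: T_def)
  qed
  have K3: "K (Inr t) (Inl q) = y (fst t) q (snd t)" if "q \<in> P" "t \<in> T" for q t
    using that finF by (auto simp: K_def base_mat_def P'_def y'_def T_def)
  have K4: "K (Inr t) (Inr t') = 0" for t t'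
    by (simp add: K_def base_mat_def y'_def)

  have y'A: "y' a b f \<in> A" for a b f
    using y by (auto simp: y'_def closed split: sum.splits)
  have y'I: "y' a b f \<in> I" if "isl b \<or> \<not> isl a" for a b f
    using y that by (auto simp: y'_def closed split: sum.splits)
  have gM: "guarded M"
  proof (rule guardedI)
    show "M i j \<in> A" for i j
      using y'A by (cases i; cases j) (auto simp: M_def label_mat_def closed intro!: sum_closed)
    show "M i j \<in> I" if "(if isl (fst j) then 0 else 1) \<le> (if isl (fst i) then 0 else 1 :: nat)" for i j
      using that y'I by (cases i; cases j) (auto simp: M_def label_mat_def closed split: if_splits intro!: sum_ideal)
  qed
  have gK: "guarded K"
  proof (rule guardedI)
    show "K i j \<in> A" for i j
      using y'A by (auto simp: K_def base_mat_def closed intro!: sum_closed)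
    show "K i j \<in> I" if "(if isl j then 0 else 1) \<le> (if isl i then 0 else 1 :: nat)" for i j
      using that y'I by (auto simp: K_def base_mat_def closed split: if_splits intro!: sum_ideal)
  qed
  have g0: "guarded ?M0" "guarded ?M1" "guarded ?K0" "guarded ?K1"
    using y by (auto intro!: guarded_ideal label_mat_ideal base_mat_ideal)
  have lumpM: "lumps fst (S1 \<union> S2) M P' K"
    unfolding X[symmetric] M_def K_def
  proof (rule lumps_label_mat)
    show "d' a b f i < r b" if "a \<in> P'" "b \<in> P'" "f \<in> F" "i < r a" "y' a b f \<noteq> 0" for a b f i
      using that s e Fn
      by (auto simp: P'_def d'_def y'_def r_def T_def split: sum.splits if_splits)
  qed

  \<comment> \<open>elimination of the old states\<close>
  obtain W where WI: "\<And>p q g. W p q g \<in> I"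
    and W: "\<And>p q i j. p \<in> P \<Longrightarrow> q \<in> P \<Longrightarrow> i < N \<Longrightarrow> j < N \<Longrightarrow>
      elim (P \<times> {..<N}) ?M1 (p, i) (q, j) = (\<Sum>g\<in>B. if g i = j then W p q g else 0)"
    and W_sum: "\<And>p q. p \<in> P \<Longrightarrow> q \<in> P \<Longrightarrow> (\<Sum>g\<in>B. W p q g) = elim P ?K1 p q"
    by (rule elim_perm_system[OF fin y, of N, folded B_def]) (rule that; assumption)
  have reindexM: "elim S1 M' (Inl p, i) (Inl q, j) = elim (P \<times> {..<N}) L (p, i) (q, j)"
    if "guarded M'" "guarded L" "p \<in> P" "q \<in> P" "i < N" "j < N"
      and eq: "\<And>p q i j. p \<in> P \<Longrightarrow> q \<in> P \<Longrightarrow> i < N \<Longrightarrow> j < N \<Longrightarrow> M' (Inl p, i) (Inl q, j) = L (p, i) (q, j)"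
    for M' L p q i j
    unfolding S1_def using that fin by (intro elim_reindex_fst) auto
  have reindexK: "elim (Inl ` P) K' (Inl p) (Inl q) = elim P L p q"
    if "guarded K'" "guarded L" "p \<in> P" "q \<in> P"
      and eq: "\<And>p q. p \<in> P \<Longrightarrow> q \<in> P \<Longrightarrow> K' (Inl p) (Inl q) = L p q"
    for K' L p q
    using that fin by (intro elim_reindex[where X = P]) (auto simp: inj_on_def)
  have EM1: "elim S1 M (Inl p, i) (Inl q, j) = (\<Sum>g\<in>B. if g i = j then W p q g else 0)"
    if "p \<in> P" "q \<in> P" "i < N" "j < N" for p q i j
    using reindexM[OF gM g0(2) that] M1 W[OF that] by simp
  have Bn: "g i < N" if "g \<in> B" "i < N" for g i
    using that BF Fn by blast
  have block1: "lumps fst S1 (elim S1 M) (Inl ` P) (elim (Inl ` P) K)"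
    unfolding S1_def lumps_fst_iff
  proof (clarsimp simp: S1_def[symmetric])
    fix p i q assume *: "p \<in> P" "i < N" "q \<in> P"
    have "(\<Sum>j<N. elim S1 M (Inl p, i) (Inl q, j)) = (\<Sum>j<N. \<Sum>g\<in>B. if g i = j then W p q g else 0)"
      using * by (simp add: EM1)
    also have "\<dots> = (\<Sum>g\<in>B. W p q g)"
      using Bn * by (intro sum_if_eq) auto
    also have "\<dots> = elim (Inl ` P) K (Inl p) (Inl q)"
      using reindexK[OF gK g0(4)] * K1 W_sum by simp
    finally show "(\<Sum>j<N. elim S1 M (Inl p, i) (Inl q, j)) = elim (Inl ` P) K (Inl p) (Inl q)" .
  qed
  define M' where "M' = elim S1 M"
  define K' where "K' = elim (Inl ` P) K"
  have gM': "guarded M'" and gK': "guarded K'"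
    unfolding M'_def K'_def using gM gK by (auto intro: guarded_elim)
  have finP': "finite P'" "finite (S1 \<union> S2)" "fst ` (S1 \<union> S2) \<subseteq> P'"
    using fin finT finS by (auto simp: P'_def S1_def S2_def)
  have lumpM': "lumps fst (S1 \<union> S2) M' P' K'"
    unfolding M'_def K'_def
    by (rule lumps_elim[OF gM gK finP'(2,1,3) lumpM _ _ block1]) (auto simp: P'_def S1_def S2_def)

  \<comment> \<open>the resulting system of transformations on the new states\<close>
  \<comment> \<open>the weights \<open>W\<close> describe nonempty paths; the empty path acts as the identity\<close>
  define W' where "W' p q g = W p q g + (if p = q \<and> g = (\<lambda>x\<in>{..<N}. x) then 1 else 0)" for p q g
  have mstar_M: "mstar S1 M (Inl p, i) (Inl q, j) = (\<Sum>g\<in>B. if g i = j then W' p q g else 0)"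
    if "p \<in> P" "q \<in> P" "i < N" "j < N" for p q i j
  proof -
    have "(\<Sum>g\<in>B. if g i = j then W' p q g else 0) = (\<Sum>g\<in>B. if g i = j then W p q g else 0) +
        (\<Sum>g\<in>B. if g = (\<lambda>x\<in>{..<N}. x) then if p = q \<and> i = j then 1 else 0 else 0)"
      unfolding sum.distrib[symmetric] W'_def using that by (intro sum.cong) auto
    moreover have "(\<lambda>x\<in>{..<N}. x) \<in> B"
      by (simp add: B_def id_Bij)
    ultimately show ?thesis
      using EM1[OF that] finB by (simp add: mstar_def add.commute)
  qed
  define V where "V t t' g = (\<Sum>p\<in>P. y (fst t) p (snd t) * W' p (fst t') g)" for t t' :: "nat \<times> (nat \<Rightarrow> nat)" and g
  have VI: "V t t' g \<in> I" for t t' g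
    using y WI by (auto simp: V_def W'_def closed intro!: sum_ideal)
  define d where "d t t' g = (\<lambda>i. s (snd t') (g (e (snd t) i)))" for t t' :: "nat \<times> (nat \<Rightarrow> nat)" and g :: "nat \<Rightarrow> nat"
  let ?M2 = "label_mat T (\<lambda>_. n) B d V" and ?K2 = "base_mat T B V"
  have sum_S1: "(\<Sum>u\<in>S1. f u) = (\<Sum>p\<in>P. \<Sum>i<N. f (Inl p, i))" for f :: "_ \<Rightarrow> 'a"
    by (simp add: S1_def sum.cartesian_product' sum.reindex)
  have M'_T: "M' (Inr t, i) (Inr t', j) = ?M2 (t, i) (t', j)"
    if t: "t \<in> T" "t' \<in> T" and i: "i < n" "j < n" for t t' i j
  proof -
    have t'P: "fst t' \<in> P"
      using t by (auto simp: T_def)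
    have inner: "(\<Sum>v\<in>S1. mstar S1 M (Inl p, k) v * M v (Inr t', j)) =
        (\<Sum>g\<in>B. if s (snd t') (g k) = j then W' p (fst t') g else 0)" if p: "p \<in> P" and k: "k < N" for p k
    proof -
      have "(\<Sum>v\<in>S1. mstar S1 M (Inl p, k) v * M v (Inr t', j)) =
          (\<Sum>q\<in>P. if fst t' = q then \<Sum>l<N. mstar S1 M (Inl p, k) (Inl (fst t'), l) * (if s (snd t') l = j then 1 else 0) else 0)"
        unfolding sum_S1 using t i by (intro sum.cong refl) (auto simp: M2)
      also have "\<dots> = (\<Sum>l<N. mstar S1 M (Inl p, k) (Inl (fst t'), l) * (if s (snd t') l = j then 1 else 0))"
        using t'P fin by simp
      also have "\<dots> = (\<Sum>l<N. \<Sum>g\<in>B. if g k = l then if s (snd t') (g k) = j then W' p (fst t') g else 0 else 0)"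
        using p k t'P by (intro sum.cong refl) (auto simp: mstar_M intro!: sum.cong sum.neutral[symmetric] sum.neutral)
      also have "\<dots> = (\<Sum>g\<in>B. if s (snd t') (g k) = j then W' p (fst t') g else 0)"
        using Bn k by (intro sum_if_eq) auto
      finally show ?thesis .
    qed
    have "M' (Inr t, i) (Inr t', j) = (\<Sum>u\<in>S1. M (Inr t, i) u * (\<Sum>v\<in>S1. mstar S1 M u v * M v (Inr t', j)))"
      unfolding M'_def elim_eq_mstar[OF gM finS(1)] by (simp add: M4 sum_distrib_left mult.assoc)
    also have "\<dots> = (\<Sum>p\<in>P. \<Sum>k<N. if e (snd t) i = k then y (fst t) p (snd t) *
        (\<Sum>g\<in>B. if s (snd t') (g (e (snd t) i)) = j then W' p (fst t') g else 0) else 0)"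
      unfolding sum_S1[of "\<lambda>u. M _ u * _ u"] using t i by (intro sum.cong refl) (auto simp: M3 inner)
    also have "\<dots> = (\<Sum>p\<in>P. y (fst t) p (snd t) *
        (\<Sum>g\<in>B. if s (snd t') (g (e (snd t) i)) = j then W' p (fst t') g else 0))"
      using e i by simp
    also have "\<dots> = (\<Sum>g\<in>B. \<Sum>p\<in>P. if d t t' g i = j then y (fst t) p (snd t) * W' p (fst t') g else 0)"
      by (subst sum.swap) (auto simp: d_def sum_distrib_left intro!: sum.cong)
    also have "\<dots> = ?M2 (t, i) (t', j)"
      using t i by (auto simp: label_mat_def V_def intro!: sum.cong)
    finally show ?thesis .
  qed
  have dn: "d t t' g i < n" if "t \<in> T" "t' \<in> T" "g \<in> B" "i < n" for t t' g i
    using that s Bn e by (auto simp: d_def T_def)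
  have g2: "guarded ?M2" "guarded ?K2"
    using VI by (auto intro!: guarded_ideal label_mat_ideal base_mat_ideal)
  have lump2: "lumps fst (T \<times> {..<n}) (elim (T \<times> {..<n}) ?M2) T (elim T ?K2)"
    using dn by (intro all_lumpD lump finT finB VI)
  have K'_T: "K' (Inr t) (Inr t') = ?K2 t t'" if t: "t \<in> T" "t' \<in> T" for t t'
  proof -
    have "s (snd t) 0 < n"
      using t s by (auto simp: T_def N_def)
    then have n: "0 < n"
      by simp
    have "K' (Inr t) (Inr t') = (\<Sum>j<n. M' (Inr t, 0) (Inr t', j))"
      using lumpM'[unfolded X[symmetric] lumps_fst_iff, rule_format, of "Inr t" 0 "Inr t'"] t n
      by (simp add: P'_def r_def)
    also have "\<dots> = (\<Sum>j<n. ?M2 (t, 0) (t', j))"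
      using t n by (simp add: M'_T)
    also have "\<dots> = ?K2 t t'"
      using lumps_label_mat[of T B "\<lambda>_. n" V d] dn t n by (simp add: lumps_fst_iff)
    finally show ?thesis .
  qed
  have EM2: "elim S2 M' (Inr t, i) (Inr t', j) = elim (T \<times> {..<n}) ?M2 (t, i) (t', j)"
    if "t \<in> T" "t' \<in> T" "i < n" "j < n" for t t' i j
    unfolding S2_def using that finT M'_T by (intro elim_reindex_fst[OF g2(1) gM']) auto
  have EK2: "elim (Inr ` T) K' (Inr t) (Inr t') = elim T ?K2 t t'" if "t \<in> T" "t' \<in> T" for t t'
    using that finT K'_T by (intro elim_reindex[OF g2(2) gK', where X = T]) (auto simp: inj_on_def)
  have block2: "lumps fst S2 (elim S2 M') (Inr ` T) (elim (Inr ` T) K')"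
    unfolding S2_def lumps_fst_iff using lump2[unfolded lumps_fst_iff]
    by (auto simp: S2_def[symmetric] EM2 EK2)
  have lump_all: "lumps fst (S1 \<union> S2) (elim S2 M') P' (elim (Inr ` T) K')"
    by (rule lumps_elim[OF gM' gK' finP'(2,1,3) lumpM' _ _ block2]) (auto simp: P'_def S1_def S2_def)

  \<comment> \<open>elimination of the new states first gives back the given system\<close>
  have swapM: "elim S2 M' = elim S1 (elim S2 M)"
    unfolding M'_def using finS by (intro elim_commute[OF gM]) auto
  have swapK: "elim (Inr ` T) K' = elim (Inl ` P) (elim (Inr ` T) K)"
    unfolding K'_def using fin finT by (intro elim_commute[OF gK]) auto
  have sum_S2: "(\<Sum>u\<in>S2. f u) = (\<Sum>t\<in>T. \<Sum>i<n. f (Inr t, i))" for f :: "_ \<Rightarrow> 'a"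
    by (simp add: S2_def sum.cartesian_product' sum.reindex)
  have split_F: "(\<Sum>f\<in>F. g f) = (\<Sum>f\<in>B. g f) + (\<Sum>f\<in>F - B. g f)" for g :: "_ \<Rightarrow> 'a"
    using sum.subset_diff[OF BF finF, of g] by (simp add: add.commute)
  have sum_T: "(\<Sum>t\<in>T. if fst t = p then g (snd t) else 0) = (\<Sum>f\<in>F - B. g f)" if "p \<in> P" for p and g :: "_ \<Rightarrow> 'a"
  proof -
    have "(\<Sum>t\<in>T. if fst t = p then g (snd t) else 0) = (\<Sum>p'\<in>P. \<Sum>f\<in>F - B. if p' = p then g f else 0)"
      unfolding T_def by (simp add: sum.cartesian_product case_prod_unfold)
    also have "\<dots> = (\<Sum>p'\<in>P. if p' = p then \<Sum>f\<in>F - B. g f else 0)"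
      by (intro sum.cong) auto
    finally show ?thesis
      using that fin by simp
  qed
  have EM0: "elim S2 M (Inl p, i) (Inl q, j) = ?M0 (p, i) (q, j)"
    if pq: "p \<in> P" "q \<in> P" "i < N" "j < N" for p q i j
  proof -
    have "elim S2 M u (Inl q, j) = M u (Inl q, j)" if "u \<in> S2" for u
    proof -
      have "M u v = 0" if "v \<in> S2" for v
        using M4 \<open>u \<in> S2\<close> that by (auto simp: S2_def)
      then show ?thesis
        by (subst elim_unfold_left[OF gM finS(2)]) simp
    qed
    then have "elim S2 M (Inl p, i) (Inl q, j) =
        M (Inl p, i) (Inl q, j) + (\<Sum>u\<in>S2. M (Inl p, i) u * M u (Inl q, j))"
      by (subst elim_unfold_left[OF gM finS(2)]) simp
    also have "(\<Sum>u\<in>S2. M (Inl p, i) u * M u (Inl q, j)) =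
        (\<Sum>t\<in>T. \<Sum>k<n. if s (snd t) i = k then if fst t = p then if snd t i = j then y p q (snd t) else 0 else 0 else 0)"
      unfolding sum_S2 using pq es by (intro sum.cong refl) (auto simp: M2 M3 T_def)
    also have "\<dots> = (\<Sum>t\<in>T. if fst t = p then if snd t i = j then y p q (snd t) else 0 else 0)"
      using s pq by (intro sum.cong refl) (auto simp: T_def)
    also have "\<dots> = (\<Sum>f\<in>F - B. if f i = j then y p q f else 0)"
      using sum_T[OF pq(1), of "\<lambda>f. if f i = j then y p q f else 0"] by simp
    also have "M (Inl p, i) (Inl q, j) + \<dots> = ?M0 (p, i) (q, j)"
      using pq by (simp add: M1 label_mat_def split_F)
    finally show ?thesis .
  qed
  have EK0: "elim (Inr ` T) K (Inl p) (Inl q) = ?K0 p q" if pq: "p \<in> P" "q \<in> P" for p q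
  proof -
    have finT': "finite (Inr ` T)"
      using finT by simp
    have "elim (Inr ` T) K u (Inl q) = K u (Inl q)" if "u \<in> Inr ` T" for u
    proof -
      have "K u v = 0" if "v \<in> Inr ` T" for v
        using K4 \<open>u \<in> Inr ` T\<close> that by auto
      then show ?thesis
        by (subst elim_unfold_left[OF gK finT']) simp
    qed
    then have "elim (Inr ` T) K (Inl p) (Inl q) = K (Inl p) (Inl q) + (\<Sum>u\<in>Inr ` T. K (Inl p) u * K u (Inl q))"
      by (subst elim_unfold_left[OF gK finT']) simp
    also have "(\<Sum>u\<in>Inr ` T. K (Inl p) u * K u (Inl q)) = (\<Sum>t\<in>T. if fst t = p then y p q (snd t) else 0)"
      using pq by (auto simp: sum.reindex K2 K3 intro!: sum.cong)
    also have "\<dots> = (\<Sum>f\<in>F - B. y p q f)"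
      using sum_T[OF pq(1)] .
    also have "K (Inl p) (Inl q) + \<dots> = ?K0 p q"
      using pq by (simp add: K1 base_mat_def split_F)
    finally show ?thesis .
  qed
  have EM: "elim S2 M' (Inl p, i) (Inl q, j) = elim (P \<times> {..<N}) ?M0 (p, i) (q, j)"
    if "p \<in> P" "q \<in> P" "i < N" "j < N" for p q i j
    unfolding swapM using that EM0 by (intro reindexM guarded_elim gM g0)
  have EK: "elim (Inr ` T) K' (Inl p) (Inl q) = elim P ?K0 p q" if "p \<in> P" "q \<in> P" for p q
    unfolding swapK using that EK0 by (intro reindexK guarded_elim gK g0)
  have "lumps fst (P \<times> {..<N}) (elim (P \<times> {..<N}) ?M0) P (elim P ?K0)"
    unfolding lumps_fst_iff
  proof (intro ballI)
    fix p i q assume *: "p \<in> P" "i \<in> {..<N}" "q \<in> P"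
    have "(\<Sum>j<N. elim (P \<times> {..<N}) ?M0 (p, i) (q, j)) = (\<Sum>j<N. elim S2 M' (Inl p, i) (Inl q, j))"
      using * by (simp add: EM)
    also have "\<dots> = elim (Inr ` T) K' (Inl p) (Inl q)"
      using lump_all[unfolded X[symmetric] lumps_fst_iff, rule_format, of "Inl p" i "Inl q"] *
      by (simp add: P'_def r_def)
    also have "\<dots> = elim P ?K0 p q"
      using * by (simp add: EK)
    finally show "(\<Sum>j<N. elim (P \<times> {..<N}) ?M0 (p, i) (q, j)) = elim P ?K0 p q" .
  qed
  then show "lumps fst (P \<times> {..<Suc n}) (elim (P \<times> {..<Suc n})
      (label_mat P (\<lambda>_. Suc n) ({..<Suc n} \<rightarrow>\<^sub>E {..<Suc n}) (\<lambda>_ _ f. f) y)) P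
      (elim P (base_mat P ({..<Suc n} \<rightarrow>\<^sub>E {..<Suc n}) y))"
    by (simp add: F_def N_def)
qed

theorem all_lump: "all_lump n"
proof (induction n)
  case 0
  show ?case
    by (simp add: all_lump_def lumps_def)
qed (rule all_lump_Suc)

end

section \<open>Functional simulations\<close>

subsection \<open>Common refinements in atomistic semirings\<close>

lemma indexed_partition_sum:
  fixes k m :: nat
  assumes "indexed_partition k m J"
  obtains f where "\<And>l. l < k \<Longrightarrow> f l < m"
    and "\<And>(z :: nat \<Rightarrow> 'a::comm_monoid_add) i. i < m \<Longrightarrow>
      (\<Sum>l\<in>J i. z l) = (\<Sum>l<k. if f l = i then z l else 0)"
proof -
  have J: "disjoint_family_on J {..<m}" "(\<Union>i<m. J i) = {..<k}"
    using assms by (auto simp: indexed_partition_def)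
  then have "\<forall>l\<in>{..<k}. \<exists>i. i < m \<and> l \<in> J i"
    by blast
  then obtain f where f: "\<And>l. l < k \<Longrightarrow> f l < m \<and> l \<in> J (f l)"
    by (metis lessThan_iff)
  have J_eq: "J i = {l \<in> {..<k}. f l = i}" if "i < m" for i
  proof -
    have "f l = i" if "l \<in> J i" "l < k" for l
      using f[OF \<open>l < k\<close>] \<open>i < m\<close> that J(1) by (auto simp: disjoint_family_on_def)
    moreover have "J i \<subseteq> {..<k}"
      using J(2) \<open>i < m\<close> by blast
    ultimately show ?thesis
      using f by auto
  qed
  have "(\<Sum>l\<in>J i. z l) = (\<Sum>l<k. if f l = i then z l else 0)" if "i < m" for z :: "nat \<Rightarrow> 'a" and i
    unfolding J_eq[OF that] by (rule sum.inter_filter) simp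
  then show ?thesis
    using f by (intro that) auto
qed

lemma atomistic_refinement:
  fixes m n :: nat and x y :: "nat \<Rightarrow> 'k::semiring_1"
  assumes atom: "atomistic TYPE('k)" and mn: "1 \<le> m" "1 \<le> n"
    and eq: "(\<Sum>i<m. x i) = (\<Sum>j<n. y j)"
  obtains k :: nat and z f g where "1 \<le> k" "\<And>l. l < k \<Longrightarrow> f l < m" "\<And>l. l < k \<Longrightarrow> g l < n"
    "\<And>i. i < m \<Longrightarrow> x i = (\<Sum>l<k. if f l = i then z l else 0)"
    "\<And>j. j < n \<Longrightarrow> y j = (\<Sum>l<k. if g l = j then z l else 0)"
proof -
  obtain k z I J where part: "indexed_partition k m I" "indexed_partition k n J"
    and xy: "\<forall>i<m. x i = (\<Sum>l\<in>I i. z l)" "\<forall>j<n. y j = (\<Sum>l\<in>J j. z l)"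
    using atom[unfolded atomistic_def] mn eq by blast
  obtain f where f: "\<And>l. l < k \<Longrightarrow> f l < m"
      "\<And>(z :: nat \<Rightarrow> 'k) i. i < m \<Longrightarrow> (\<Sum>l\<in>I i. z l) = (\<Sum>l<k. if f l = i then z l else 0)"
    using indexed_partition_sum[OF part(1)] by metis
  obtain g where g: "\<And>l. l < k \<Longrightarrow> g l < n"
      "\<And>(z :: nat \<Rightarrow> 'k) i. i < n \<Longrightarrow> (\<Sum>l\<in>J i. z l) = (\<Sum>l<k. if g l = i then z l else 0)"
    using indexed_partition_sum[OF part(2)] by metis
  show ?thesis
  proof (cases "k = 0")
    case True
    \<comment> \<open>all summands vanish, and one zero summand makes the refinement nonempty\<close>
    then show ?thesis
      using mn xy f g by (intro that[of 1 "\<lambda>_. 0" "\<lambda>_. 0" "\<lambda>_. 0"]) auto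
  next
    case False
    then show ?thesis
      using xy f g by (intro that[of k f g z]) auto
  qed
qed

text \<open>Finitely many decompositions of \<open>v\<close>, indexed by \<open>S\<close>, have a common refinement \<open>z\<close>. In the decomposition \<open>i\<close> the
  summand \<open>z l\<close> belongs to the part \<open>\<delta> i l\<close>.\<close>

lemma atomistic_common_refinement:
  fixes c :: "'i \<Rightarrow> nat \<Rightarrow> 'k::semiring_1"
  assumes atom: "atomistic TYPE('k)" and fin: "finite S" "finite J" and J: "J \<noteq> {}"
    and c: "\<And>i. i \<in> S \<Longrightarrow> (\<Sum>j\<in>J. c i j) = v"
  shows "\<exists>(m :: nat) z \<delta>. 1 \<le> m \<and> v = (\<Sum>l<m. z l) \<and> (\<forall>i\<in>S. (\<forall>l<m. \<delta> i l \<in> J) \<and>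
    (\<forall>j\<in>J. c i j = (\<Sum>l<m. if \<delta> i l = j then z l else 0)))"
  using fin(1) c
proof (induction S)
  case empty
  show ?case
    by (intro exI[of _ "1 :: nat"] exI[of _ "\<lambda>_. v"]) auto
next
  case (insert i' S)
  obtain m :: nat and z \<delta> where m: "1 \<le> m" and v: "v = (\<Sum>l<m. z l)"
    and \<delta>: "\<And>i l. i \<in> S \<Longrightarrow> l < m \<Longrightarrow> \<delta> i l \<in> J"
      "\<And>i j. i \<in> S \<Longrightarrow> j \<in> J \<Longrightarrow> c i j = (\<Sum>l<m. if \<delta> i l = j then z l else 0)"
    using insert.IH[OF insert.prems[OF insertI2]] by blast
  define n where "n = card J"
  obtain b where b: "bij_betw b {..<n} J"
    using ex_bij_betw_nat_finite[OF fin(2)] by (auto simp: n_def atLeast0LessThan)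
  have n: "1 \<le> n"
    using J fin by (simp add: n_def Suc_le_eq card_gt_0_iff)
  have "(\<Sum>l<m. z l) = (\<Sum>j<n. c i' (b j))"
    using insert.prems[of i'] sum.reindex_bij_betw[OF b, of "c i'"] v by simp
  then obtain k :: nat and z' f g where k: "1 \<le> k" and f: "\<And>l. l < k \<Longrightarrow> f l < m" and g: "\<And>l. l < k \<Longrightarrow> g l < n"
    and zf: "\<And>l. l < m \<Longrightarrow> z l = (\<Sum>l'<k. if f l' = l then z' l' else 0)"
    and cg: "\<And>j. j < n \<Longrightarrow> c i' (b j) = (\<Sum>l'<k. if g l' = j then z' l' else 0)"
    by (rule atomistic_refinement[OF atom m n]) (rule that; assumption)
  define \<delta>' where "\<delta>' i l = (if i = i' then b (g l) else \<delta> i (f l))" for i l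
  have "v = (\<Sum>l<m. \<Sum>l'<k. if f l' = l then z' l' else 0)"
    using v zf by simp
  also have "\<dots> = (\<Sum>l'<k. z' l')"
    using f by (intro sum_if_eq) auto
  finally have v': "v = (\<Sum>l'<k. z' l')" .
  have b_inj: "b x = b y \<longleftrightarrow> x = y" if "x < n" "y < n" for x y
    using b that by (auto simp: bij_betw_def inj_on_def)
  have "(\<forall>l<k. \<delta>' i l \<in> J) \<and> (\<forall>j\<in>J. c i j = (\<Sum>l<k. if \<delta>' i l = j then z' l else 0))"
    if i: "i \<in> insert i' S" for i
  proof (cases "i = i'")
    case True
    have "c i' j = (\<Sum>l<k. if b (g l) = j then z' l else 0)" if j: "j \<in> J" for j
    proof -
      obtain j' where j': "j = b j'" "j' < n"
        using b j by (auto simp: bij_betw_def)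
      then show ?thesis
        using cg g by (auto simp: b_inj intro!: sum.cong)
    qed
    then show ?thesis
      using True b g by (auto simp: \<delta>'_def bij_betw_def)
  next
    case False
    have "c i j = (\<Sum>l<k. if \<delta> i (f l) = j then z' l else 0)" if j: "j \<in> J" for j
    proof -
      have "c i j = (\<Sum>l<m. \<Sum>l'<k. if f l' = l then if \<delta> i (f l') = j then z' l' else 0 else 0)"
      proof -
        have "(if \<delta> i l = j then z l else 0) =
            (\<Sum>l'<k. if f l' = l then if \<delta> i (f l') = j then z' l' else 0 else 0)" if "l < m" for l
          unfolding zf[OF that] by (cases "\<delta> i l = j") (auto intro!: sum.cong sum.neutral)
        then show ?thesis
          using i False \<delta>(2)[of i j] j by simp
      qed
      also have "\<dots> = (\<Sum>l'<k. if \<delta> i (f l') = j then z' l' else 0)"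
        using f by (intro sum_if_eq) auto
      finally show ?thesis .
    qed
    then show ?thesis
      using False i \<delta>(1) f by (auto simp: \<delta>'_def)
  qed
  then show ?case
    using k v' by blast
qed

subsection \<open>Functional simulations\<close>

context semialgebra
begin

lemma act_sum_left: "a \<in> A \<Longrightarrow> act (sum f X) a = (\<Sum>x\<in>X. act (f x) a)"
  by (induction X rule: infinite_finite_induct) (simp_all add: act_zero_left act_add_left)

text \<open>The transition matrix of an automaton with states \<open>S\<close>, in which the letter \<open>a\<close> has the value
  \<open>h a\<close> and leads from \<open>i\<close> to \<open>j\<close> with coefficient \<open>c i j a\<close>.\<close>

definition trans_mat :: "'s set \<Rightarrow> ('s \<Rightarrow> 'a) \<Rightarrow> 'i set \<Rightarrow> ('i \<Rightarrow> 'i \<Rightarrow> 's \<Rightarrow> 'k) \<Rightarrow> 'i \<Rightarrow> 'i \<Rightarrow> 'a" where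
  "trans_mat \<Sigma> h S c i j = (if i \<in> S \<and> j \<in> S then \<Sum>a\<in>\<Sigma>. act (c i j a) (h a) else 0)"

end

lemma (in partial_conway_semialgebra) trans_mat_ideal:
  "h \<in> \<Sigma> \<rightarrow> I \<Longrightarrow> trans_mat \<Sigma> h S c i j \<in> I"
  by (auto simp: trans_mat_def closed Pi_iff intro!: sum_ideal)

context partial_iteration_semialgebra
begin

text \<open>The base states are those of the simulated automaton. For simplicity every fibre is enlarged to the whole set of
  states of the simulating automaton; the pairs \<open>(\<rho> i, i)\<close> form a closed set, on
  which the system of transformations is the simulating automaton.\<close>

theorem functional_simulation:
  fixes c d :: "nat \<Rightarrow> nat \<Rightarrow> 's \<Rightarrow> 'k" and \<Sigma> :: "'s set"
  assumes atom: "atomistic TYPE('k)" and \<Sigma>: "finite \<Sigma>" and h: "h \<in> \<Sigma> \<rightarrow> I"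
    and \<rho>: "\<And>i. i < m \<Longrightarrow> \<rho> i < n"
    and sim: "\<And>i q a. i < m \<Longrightarrow> q < n \<Longrightarrow> a \<in> \<Sigma> \<Longrightarrow> (\<Sum>j\<in>{j. j < m \<and> \<rho> j = q}. c i j a) = d (\<rho> i) q a"
  shows "lumps \<rho> {..<m} (elim {..<m} (trans_mat \<Sigma> h {..<m} c))
    {..<n} (elim {..<n} (trans_mat \<Sigma> h {..<n} d))"
proof -
  define R where "R p q a k z \<delta> \<longleftrightarrow> d p q a = (\<Sum>l<k. z l) \<and>
    (\<forall>i<m. \<rho> i = p \<longrightarrow> (\<forall>l<k. \<delta> i l < m \<and> \<rho> (\<delta> i l) = q) \<and>
      (\<forall>j<m. \<rho> j = q \<longrightarrow> c i j a = (\<Sum>l<k. if \<delta> i l = j then z l else 0)))" for p q a and k :: nat and z \<delta>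
  have "\<exists>k z \<delta>. R p q a k z \<delta>" if pqa: "p < n" "q < n" "a \<in> \<Sigma>" for p q a
  proof -
    define S where "S = {i. i < m \<and> \<rho> i = p}"
    define J where "J = {j. j < m \<and> \<rho> j = q}"
    have fin: "finite S" "finite J"
      by (auto simp: S_def J_def)
    have sum: "(\<Sum>j\<in>J. c i j a) = d p q a" if "i \<in> S" for i
      using sim[of i q a] that pqa by (auto simp: S_def J_def)
    consider "S = {}" | "S \<noteq> {}" "J = {}" | "J \<noteq> {}"
      by blast
    then show ?thesis
    proof cases
      case 1
      \<comment> \<open>no state lies over \<open>p\<close>, and one summand, acting on nothing, will do\<close>
      then have "R p q a 1 (\<lambda>_. d p q a) (\<lambda>_ _. 0)"
        by (auto simp: R_def S_def)
      then show ?thesis by blast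
    next
      case 2
      then have "d p q a = 0"
        using sum by auto
      then have "R p q a 0 (\<lambda>_. 0) (\<lambda>_ _. 0)"
        using 2 by (auto simp: R_def J_def)
      then show ?thesis by blast
    next
      case 3
      have "\<exists>(k :: nat) z \<delta>. 1 \<le> k \<and> d p q a = (\<Sum>l<k. z l) \<and> (\<forall>i\<in>S. (\<forall>l<k. \<delta> i l \<in> J) \<and>
          (\<forall>j\<in>J. c i j a = (\<Sum>l<k. if \<delta> i l = j then z l else 0)))"
        using sum by (rule atomistic_common_refinement[OF atom fin 3])
      then obtain k :: nat and z \<delta> where "d p q a = (\<Sum>l<k. z l)" "\<forall>i\<in>S. (\<forall>l<k. \<delta> i l \<in> J) \<and>
          (\<forall>j\<in>J. c i j a = (\<Sum>l<k. if \<delta> i l = j then z l else 0))"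
        by blast
      then have "R p q a k z \<delta>"
        by (auto simp: R_def S_def J_def)
      then show ?thesis by blast
    qed
  qed
  then have "\<forall>p q a. \<exists>k z \<delta>. p < n \<longrightarrow> q < n \<longrightarrow> a \<in> \<Sigma> \<longrightarrow> R p q a k z \<delta>"
    by blast
  then obtain k z \<delta> where R: "\<And>p q a. p < n \<Longrightarrow> q < n \<Longrightarrow> a \<in> \<Sigma> \<Longrightarrow> R p q a (k p q a) (z p q a) (\<delta> p q a)"
    by metis
  \<comment> \<open>all transitions use the same labels, with weight zero where the refinement has fewer summands\<close>
  define kmax where "kmax = (\<Sum>p<n. \<Sum>q<n. \<Sum>a\<in>\<Sigma>. k p q a)"
  have kmax: "k p q a \<le> kmax" if "p < n" "q < n" "a \<in> \<Sigma>" for p q a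
  proof -
    have "k p q a \<le> (\<Sum>a\<in>\<Sigma>. k p q a)"
      using \<Sigma> that by (intro member_le_sum) auto
    also have "\<dots> \<le> (\<Sum>q<n. \<Sum>a\<in>\<Sigma>. k p q a)"
      using that by (intro member_le_sum[of q _ "\<lambda>q. \<Sum>a\<in>\<Sigma>. k p q a"]) auto
    also have "\<dots> \<le> kmax"
      unfolding kmax_def using that by (intro member_le_sum[of p _ "\<lambda>p. \<Sum>q<n. \<Sum>a\<in>\<Sigma>. k p q a"]) auto
    finally show ?thesis .
  qed
  define L where "L = \<Sigma> \<times> {..<kmax}"
  define y where "y p q = (\<lambda>(a, l). if p < n \<and> q < n \<and> a \<in> \<Sigma> \<and> l < k p q a then act (z p q a l) (h a) else 0)" for p q
  define e where "e p q = (\<lambda>(a, l) i. if \<rho> i = p \<and> p < n \<and> q < n \<and> a \<in> \<Sigma> \<and> l < k p q a then \<delta> p q a i l else i)" for p q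
  have y: "y p q l \<in> I" for p q l
    using h by (auto simp: y_def closed Pi_iff split: prod.splits)
  have e: "e p q l i < m" if "i < m" for p q l i
    using that R by (auto simp: e_def R_def split: prod.splits)
  let ?M = "label_mat {..<n} (\<lambda>_. m) L e y" and ?N = "base_mat {..<n} L y"
  let ?C = "trans_mat \<Sigma> h {..<m} c" and ?D = "trans_mat \<Sigma> h {..<n} d"
  have lump: "lumps fst ({..<n} \<times> {..<m}) (elim ({..<n} \<times> {..<m}) ?M) {..<n} (elim {..<n} ?N)"
    using \<Sigma> y e by (intro all_lumpD all_lump) (auto simp: L_def)
  have sum_L: "(\<Sum>l\<in>L. if P l then y p q l else 0) =
      (\<Sum>a\<in>\<Sigma>. act (\<Sum>l<k p q a. if P (a, l) then z p q a l else 0) (h a))" if "p < n" "q < n" for P p q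
  proof -
    have "(\<Sum>l\<in>L. if P l then y p q l else 0) = (\<Sum>a\<in>\<Sigma>. \<Sum>l<kmax. if P (a, l) then y p q (a, l) else 0)"
      by (simp add: L_def sum.cartesian_product case_prod_unfold cong: if_cong)
    also have "\<dots> = (\<Sum>a\<in>\<Sigma>. \<Sum>l<k p q a. act (if P (a, l) then z p q a l else 0) (h a))"
    proof (rule sum.cong[OF refl])
      fix a assume a: "a \<in> \<Sigma>"
      then have ha: "h a \<in> A"
        using h by (auto intro: ideal_closed)
      show "(\<Sum>l<kmax. if P (a, l) then y p q (a, l) else 0) =
          (\<Sum>l<k p q a. act (if P (a, l) then z p q a l else 0) (h a))"
        using that a ha kmax[of p q a]
        by (intro sum.mono_neutral_cong_right) (auto simp: y_def act_zero_left)
    qed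
    also have "\<dots> = (\<Sum>a\<in>\<Sigma>. act (\<Sum>l<k p q a. if P (a, l) then z p q a l else 0) (h a))"
      using h by (intro sum.cong refl act_sum_left[symmetric]) (auto intro: ideal_closed)
    finally show ?thesis .
  qed
  have N: "?N = ?D"
  proof (intro ext)
    fix p q
    show "?N p q = ?D p q"
      using sum_L[of p q "\<lambda>_. True"] R by (auto simp: base_mat_def trans_mat_def R_def intro!: sum.cong)
  qed
  have M_C: "?M (\<rho> i, i) (\<rho> j, j) = ?C i j" if ij: "i < m" "j < m" for i j
  proof -
    let ?P = "\<lambda>l. e (\<rho> i) (\<rho> j) l i = j"
    have "?M (\<rho> i, i) (\<rho> j, j) = (\<Sum>l\<in>L. if ?P l then y (\<rho> i) (\<rho> j) l else 0)"
      using ij \<rho> by (simp add: label_mat_def)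
    also have "\<dots> = (\<Sum>a\<in>\<Sigma>. act (\<Sum>l<k (\<rho> i) (\<rho> j) a. if ?P (a, l) then z (\<rho> i) (\<rho> j) a l else 0) (h a))"
      using ij \<rho> by (intro sum_L) auto
    also have "\<dots> = (\<Sum>a\<in>\<Sigma>. act (c i j a) (h a))"
    proof (rule sum.cong[OF refl], rule arg_cong2[where f = act, OF _ refl])
      fix a assume a: "a \<in> \<Sigma>"
      show "(\<Sum>l<k (\<rho> i) (\<rho> j) a. if ?P (a, l) then z (\<rho> i) (\<rho> j) a l else 0) = c i j a"
        using R[of "\<rho> i" "\<rho> j" a] ij a \<rho> by (auto simp: R_def e_def intro!: sum.cong)
    qed
    finally show ?thesis
      using ij by (simp add: trans_mat_def)
  qed
  have gM: "guarded ?M" and gC: "guarded ?C"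
    using y h by (auto intro!: guarded_ideal label_mat_ideal trans_mat_ideal)
  define \<phi> where "\<phi> i = (\<rho> i, i)" for i
  define C where "C = \<phi> ` {..<m}"
  have C: "(q, j) \<in> C \<longleftrightarrow> j < m \<and> q = \<rho> j" for q j
    by (auto simp: C_def \<phi>_def)
  have closedC: "?M u v = 0" if uC: "u \<in> C" and vC: "v \<notin> C" for u v
  proof -
    obtain i q j where u: "u = (\<rho> i, i)" "i < m" and v: "v = (q, j)"
      using uC by (cases v) (auto simp: C_def \<phi>_def)
    have "(if e (\<rho> i) q l i = j then y (\<rho> i) q l else 0) = 0" if "q < n" "j < m" for l
    proof (rule ccontr)
      assume *: "\<not> ?thesis"
      obtain a l' where l: "l = (a, l')"
        by (cases l)
      have **: "a \<in> \<Sigma>" "l' < k (\<rho> i) q a" "j = \<delta> (\<rho> i) q a i l'"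
        using * l u \<rho> \<open>q < n\<close> by (auto simp: y_def e_def split: if_splits)
      then have "\<rho> j = q"
        using R[of "\<rho> i" q a] \<rho> u \<open>q < n\<close> by (auto simp: R_def)
      then show False
        using vC \<open>j < m\<close> v C by auto
    qed
    then show ?thesis
      unfolding u v label_mat_def by (simp only: split_conv) (auto intro!: sum.neutral)
  qed
  have fin: "finite ({..<n} \<times> {..<m})"
    by simp
  have E: "elim ({..<n} \<times> {..<m}) ?M (\<rho> i, i) (q, j) = (if \<rho> j = q then elim {..<m} ?C i j else 0)"
    if ij: "i < m" "j < m" for i j q
  proof -
    have i: "(\<rho> i, i) \<in> C"
      using ij C by auto
    note * = elim_closed_set[OF gM fin closedC i]
    show ?thesis
    proof (cases "\<rho> j = q")
      case True
      have "({..<n} \<times> {..<m}) \<inter> C = C"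
        using \<rho> by (auto simp: C_def \<phi>_def)
      then have "elim ({..<n} \<times> {..<m}) ?M (\<rho> i, i) (q, j) = elim C ?M (\<rho> i, i) (q, j)"
        using * True C ij by auto
      also have "\<dots> = elim (\<phi> ` {..<m}) ?M (\<phi> i) (\<phi> j)"
        using True by (simp add: C_def \<phi>_def)
      also have "\<dots> = elim {..<m} ?C i j"
        using ij M_C by (intro elim_reindex[OF gC gM, where X = "{..<m}"]) (auto simp: inj_on_def \<phi>_def)
      finally show ?thesis
        using True by simp
    next
      case False
      then show ?thesis
        using * C by auto
    qed
  qed
  show ?thesis
    unfolding lumps_def
  proof (intro ballI)
    fix i q assume i: "i \<in> {..<m}" and q: "q \<in> {..<n}"
    have "(\<Sum>j\<in>{j \<in> {..<m}. \<rho> j = q}. elim {..<m} ?C i j) = (\<Sum>j<m. if \<rho> j = q then elim {..<m} ?C i j else 0)"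
      by (rule sum.inter_filter) simp
    also have "\<dots> = (\<Sum>j<m. elim ({..<n} \<times> {..<m}) ?M (\<rho> i, i) (q, j))"
      using i by (simp add: E)
    also have "\<dots> = elim {..<n} ?D (\<rho> i) q"
      using lump[unfolded lumps_fst_iff, rule_format, of "\<rho> i" i q] i q \<rho> N by simp
    finally show "(\<Sum>j\<in>{j \<in> {..<m}. \<rho> j = q}. elim {..<m} ?C i j) = elim {..<n} ?D (\<rho> i) q" .
  qed
qed

end

section \<open>The value of an automaton\<close>

context partial_conway_semialgebra
begin

text \<open>The image of \<open>K\<close> in the centre of \<open>A\<close>, through which \<open>K\<close> acts.\<close>

definition scalar :: "'k \<Rightarrow> 'a" where
  "scalar k = act k 1"

lemma scalar_closed: "scalar k \<in> A"
  by (simp add: scalar_def closed)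

lemma act_eq_left: "a \<in> A \<Longrightarrow> act k a = scalar k * a"
  using act_mult_left[of 1 a k] by (simp add: scalar_def closed)

lemma act_eq_right: "a \<in> A \<Longrightarrow> act k a = a * scalar k"
  using act_mult_right[of a 1 k] by (simp add: scalar_def closed)

lemma scalar_commute: "a \<in> A \<Longrightarrow> scalar k * a = a * scalar k"
  using act_eq_left act_eq_right by metis

lemma scalar_simps: "scalar 0 = 0" "scalar 1 = 1" "scalar (k + l) = scalar k + scalar l"
  "scalar (k * l) = scalar k * scalar l"
  using act_eq_left[of "act l 1" k]
  by (simp_all add: scalar_def closed act_zero_left act_one act_add_left act_mult)

lemma act_mult_scalar: "a \<in> A \<Longrightarrow> act (k * l) a = act k a * scalar l"
  using act_mult[of a l k] act_eq_right[of "act k a" l] by (simp add: closed mult.commute)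

lemma scalar_sum: "scalar (sum f X) = (\<Sum>x\<in>X. scalar (f x))"
  by (induction X rule: infinite_finite_induct) (simp_all add: scalar_simps)

text \<open>The product of the initial row \<open>\<alpha>\<close>, the star of the transition matrix and the final column \<open>\<beta>\<close>. In the
  semialgebra of all series, with every letter as its own value, this is the behavior.\<close>

definition val :: "'s set \<Rightarrow> ('s \<Rightarrow> 'a) \<Rightarrow> 'i set \<Rightarrow> ('i \<Rightarrow> 'k) \<Rightarrow> ('i \<Rightarrow> 'i \<Rightarrow> 's \<Rightarrow> 'k) \<Rightarrow> ('i \<Rightarrow> 'k) \<Rightarrow> 'a" where
  "val \<Sigma> h S \<alpha> c \<beta> =
     (\<Sum>i\<in>S. \<Sum>j\<in>S. scalar (\<alpha> i) * mstar S (trans_mat \<Sigma> h S c) i j * scalar (\<beta> j))"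

lemma guarded_trans_mat: "h \<in> \<Sigma> \<rightarrow> I \<Longrightarrow> guarded (trans_mat \<Sigma> h S c)"
  by (intro guarded_ideal trans_mat_ideal)

lemma val_closed: "h \<in> \<Sigma> \<rightarrow> I \<Longrightarrow> val \<Sigma> h S \<alpha> c \<beta> \<in> A"
  unfolding val_def
  by (intro sum_closed mult_closed scalar_closed mstar_closed guarded_trans_mat)

lemma val_cong:
  assumes "\<And>i. i \<in> S \<Longrightarrow> \<alpha> i = \<alpha>' i" "\<And>i. i \<in> S \<Longrightarrow> \<beta> i = \<beta>' i"
    and "\<And>i j a. i \<in> S \<Longrightarrow> j \<in> S \<Longrightarrow> a \<in> \<Sigma> \<Longrightarrow> c i j a = c' i j a"
  shows "val \<Sigma> h S \<alpha> c \<beta> = val \<Sigma> h S \<alpha>' c' \<beta>'"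
proof -
  have "trans_mat \<Sigma> h S c = trans_mat \<Sigma> h S c'"
    using assms(3) by (auto simp: trans_mat_def fun_eq_iff intro!: sum.cong)
  then show ?thesis
    unfolding val_def using assms(1,2) by (auto intro!: sum.cong)
qed

lemma val_reindex:
  assumes h: "h \<in> \<Sigma> \<rightarrow> I" and S: "finite S" and e: "inj_on e S"
  shows "val \<Sigma> h (e ` S) \<alpha> c \<beta> = val \<Sigma> h S (\<lambda>i. \<alpha> (e i)) (\<lambda>i j. c (e i) (e j)) (\<lambda>i. \<beta> (e i))"
proof -
  have "elim (e ` S) (trans_mat \<Sigma> h (e ` S) c) (e i) (e j) =
      elim S (trans_mat \<Sigma> h S (\<lambda>i j. c (e i) (e j))) i j" if "i \<in> S" "j \<in> S" for i j
    using that S e by (intro elim_reindex[where X = S] guarded_trans_mat h) (auto simp: trans_mat_def)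
  moreover have "e i = e j \<longleftrightarrow> i = j" if "i \<in> S" "j \<in> S" for i j
    using that e by (auto simp: inj_on_def)
  ultimately show ?thesis
    unfolding val_def mstar_def using e by (simp add: sum.reindex)
qed

lemma val_split:
  assumes S: "finite S"
  shows "val \<Sigma> h S \<alpha> c \<beta> = scalar (\<Sum>i\<in>S. \<alpha> i * \<beta> i) +
    (\<Sum>i\<in>S. \<Sum>j\<in>S. scalar (\<alpha> i) * elim S (trans_mat \<Sigma> h S c) i j * scalar (\<beta> j))"
proof -
  have "(\<Sum>j\<in>S. scalar (\<alpha> i) * (if i = j then 1 else 0) * scalar (\<beta> j)) = scalar (\<alpha> i * \<beta> i)"
    if "i \<in> S" for i
  proof -
    have "(\<Sum>j\<in>S. scalar (\<alpha> i) * (if i = j then 1 else 0) * scalar (\<beta> j)) =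
        (\<Sum>j\<in>S. if i = j then scalar (\<alpha> i * \<beta> i) else 0)"
      by (intro sum.cong refl) (simp add: scalar_simps)
    then show ?thesis
      using that S by simp
  qed
  then show ?thesis
    by (simp add: val_def mstar_def distrib_left distrib_right sum.distrib scalar_sum)
qed

lemma elim_zero:
  assumes M: "guarded M" and S: "finite S" and "i \<in> S" and "\<And>j. M i j = 0"
  shows "elim S M i j = 0"
  by (subst elim_unfold_left[OF M S]) (simp add: assms)

lemma val_scale:
  "act k (val \<Sigma> h S \<alpha> c \<beta>) = val \<Sigma> h S (\<lambda>i. k * \<alpha> i) c \<beta>" if h: "h \<in> \<Sigma> \<rightarrow> I"
  unfolding act_eq_left[OF val_closed[OF h]] by (simp add: val_def scalar_simps sum_distrib_left mult.assoc)

lemma val_const: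
  assumes h: "h \<in> \<Sigma> \<rightarrow> I"
  shows "val \<Sigma> h {0 :: nat} (\<lambda>_. k) (\<lambda>_ _ _. 0) (\<lambda>_. 1) = scalar k"
proof -
  have "trans_mat \<Sigma> h {0 :: nat} (\<lambda>_ _ _. 0) i j = 0" for i j
    using h by (auto simp: trans_mat_def intro!: sum.neutral act_zero_left ideal_closed)
  then have "elim {0} (trans_mat \<Sigma> h {0 :: nat} (\<lambda>_ _ _. 0)) 0 0 = 0"
    by (intro elim_zero guarded_trans_mat h) auto
  then show ?thesis
    by (simp add: val_split scalar_simps)
qed

lemma val_letter:
  assumes h: "h \<in> \<Sigma> \<rightarrow> I" and a: "a \<in> \<Sigma>" "finite \<Sigma>"
  shows "val \<Sigma> h {0, 1 :: nat} (\<lambda>i. if i = 0 then 1 else 0)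
    (\<lambda>i j b. if i = 0 \<and> j = 1 \<and> b = a then 1 else 0) (\<lambda>j. if j = 0 then 0 else 1) = h a"
proof -
  define M where "M = trans_mat \<Sigma> h {0, 1 :: nat} (\<lambda>i j b. if i = 0 \<and> j = 1 \<and> b = a then 1 else 0)"
  have ha: "h b \<in> A" if "b \<in> \<Sigma>" for b
    using h that by (auto intro: ideal_closed)
  have M01: "M 0 1 = h a"
  proof -
    have "M 0 1 = (\<Sum>b\<in>\<Sigma>. if b = a then h a else 0)"
      unfolding M_def trans_mat_def using ha by (auto simp: act_one act_zero_left intro!: sum.cong)
    then show ?thesis
      using a by simp
  qed
  have M: "M i j = 0" if "i \<noteq> 0 \<or> j \<noteq> 1" for i j
    using that ha by (auto simp: M_def trans_mat_def act_zero_left intro!: sum.neutral)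
  have gM: "guarded M"
    unfolding M_def using h by (rule guarded_trans_mat)
  have 1: "elim {0, 1} M 1 1 = 0"
    by (rule elim_zero[OF gM]) (auto simp: M)
  have "elim {0, 1} M 0 1 = h a"
    by (subst elim_unfold_left[OF gM]) (simp_all add: M M01 1 1[simplified] del: One_nat_def)
  moreover have "finite {0, 1 :: nat}"
    by simp
  ultimately show ?thesis
    by (simp only: val_split M_def[symmetric]) (simp add: scalar_simps)
qed

subsection \<open>Sums and products\<close>

lemma elim_diag:
  fixes M :: "'i + 'j \<Rightarrow> 'i + 'j \<Rightarrow> 'a"
  assumes M: "guarded M" and M1: "guarded M1" and M2: "guarded M2" and fin: "finite S" "finite T"
    and eq1: "\<And>i j. i \<in> S \<Longrightarrow> j \<in> S \<Longrightarrow> M (Inl i) (Inl j) = M1 i j"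
    and eq2: "\<And>i j. i \<in> T \<Longrightarrow> j \<in> T \<Longrightarrow> M (Inr i) (Inr j) = M2 i j"
    and zero: "\<And>i j. M (Inl i) (Inr j) = 0" "\<And>i j. M (Inr j) (Inl i) = 0"
  shows "i \<in> S \<Longrightarrow> i' \<in> S \<Longrightarrow> elim (S <+> T) M (Inl i) (Inl i') = elim S M1 i i'"
    and "j \<in> T \<Longrightarrow> j' \<in> T \<Longrightarrow> elim (S <+> T) M (Inr j) (Inr j') = elim T M2 j j'"
    and "elim (S <+> T) M (Inl i) (Inr j) = 0" and "elim (S <+> T) M (Inr j) (Inl i) = 0"
proof -
  have fin': "finite (S <+> T)"
    using fin by simp
  have l: "M x y = 0" if "x \<in> range Inl" "y \<notin> range Inl" for x y
    using that zero by (cases y) auto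
  have r: "M x y = 0" if "x \<in> range Inr" "y \<notin> range Inr" for x y
    using that zero by (cases y) auto
  note L = elim_closed_set[where C = "range Inl" and i = "Inl i", OF M fin' l]
    and R = elim_closed_set[where C = "range Inr" and i = "Inr j", OF M fin' r]
  show "elim (S <+> T) M (Inl i) (Inr j) = 0" "elim (S <+> T) M (Inr j) (Inl i) = 0"
    using L(1)[where j = "Inr j"] R(1)[where j = "Inl i"] by auto
  have "(S <+> T) \<inter> range Inl = Inl ` S" "(S <+> T) \<inter> range Inr = Inr ` T"
    by auto
  then have "elim (S <+> T) M (Inl i) (Inl i') = elim (Inl ` S) M (Inl i) (Inl i')"
      "elim (S <+> T) M (Inr j) (Inr j') = elim (Inr ` T) M (Inr j) (Inr j')"
    using L(2)[where j = "Inl i'"] R(2)[where j = "Inr j'"] by auto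
  moreover have "elim (Inl ` S) M (Inl i) (Inl i') = elim S M1 i i'" if "i \<in> S" "i' \<in> S"
    using that fin eq1 by (intro elim_reindex[OF M1 M, where X = S]) auto
  moreover have "elim (Inr ` T) M (Inr j) (Inr j') = elim T M2 j j'" if "j \<in> T" "j' \<in> T"
    using that fin eq2 by (intro elim_reindex[OF M2 M, where X = T]) auto
  ultimately show "i \<in> S \<Longrightarrow> i' \<in> S \<Longrightarrow> elim (S <+> T) M (Inl i) (Inl i') = elim S M1 i i'"
      "j \<in> T \<Longrightarrow> j' \<in> T \<Longrightarrow> elim (S <+> T) M (Inr j) (Inr j') = elim T M2 j j'"
    by auto
qed

text \<open>The transitions of the disjoint union of two automata.\<close>

definition union_trans :: "('i \<Rightarrow> 'i \<Rightarrow> 's \<Rightarrow> 'k) \<Rightarrow> ('j \<Rightarrow> 'j \<Rightarrow> 's \<Rightarrow> 'k) \<Rightarrow> 'i + 'j \<Rightarrow> 'i + 'j \<Rightarrow> 's \<Rightarrow> 'k" where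
  "union_trans c d x y a = (case x of
      Inl i \<Rightarrow> (case y of Inl j \<Rightarrow> c i j a | Inr _ \<Rightarrow> 0)
    | Inr i \<Rightarrow> (case y of Inl _ \<Rightarrow> 0 | Inr j \<Rightarrow> d i j a))"

lemma elim_union_trans:
  fixes c :: "'i \<Rightarrow> 'i \<Rightarrow> 's \<Rightarrow> 'k" and d :: "'j \<Rightarrow> 'j \<Rightarrow> 's \<Rightarrow> 'k"
  assumes h: "h \<in> \<Sigma> \<rightarrow> I" and fin: "finite S" "finite T"
  defines "M \<equiv> trans_mat \<Sigma> h (S <+> T) (union_trans c d)"
  shows "i \<in> S \<Longrightarrow> i' \<in> S \<Longrightarrow> elim (S <+> T) M (Inl i) (Inl i') = elim S (trans_mat \<Sigma> h S c) i i'"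
    and "j \<in> T \<Longrightarrow> j' \<in> T \<Longrightarrow> elim (S <+> T) M (Inr j) (Inr j') = elim T (trans_mat \<Sigma> h T d) j j'"
    and "elim (S <+> T) M (Inl i) (Inr j) = 0" and "elim (S <+> T) M (Inr j) (Inl i) = 0"
proof -
  have ha: "act 0 (h a) = 0" if "a \<in> \<Sigma>" for a
    using h that by (intro act_zero_left) (auto intro: ideal_closed)
  have zero: "M (Inl i) (Inr j) = 0" "M (Inr j) (Inl i) = 0" for i j
    using ha by (simp_all add: M_def trans_mat_def union_trans_def)
  have gM: "guarded M"
    unfolding M_def using h by (rule guarded_trans_mat)
  note * = elim_diag[where M = M and ?M1.0 = "trans_mat \<Sigma> h S c" and ?M2.0 = "trans_mat \<Sigma> h T d",
      OF gM guarded_trans_mat[OF h] guarded_trans_mat[OF h] fin _ _ zero]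
  have eq: "M (Inl i) (Inl j) = trans_mat \<Sigma> h S c i j" if "i \<in> S" "j \<in> S" for i j
    using that by (simp add: M_def trans_mat_def union_trans_def InlI)
  have eq': "M (Inr i) (Inr j) = trans_mat \<Sigma> h T d i j" if "i \<in> T" "j \<in> T" for i j
    using that by (simp add: M_def trans_mat_def union_trans_def InrI)
  show "i \<in> S \<Longrightarrow> i' \<in> S \<Longrightarrow> elim (S <+> T) M (Inl i) (Inl i') = elim S (trans_mat \<Sigma> h S c) i i'"
      "j \<in> T \<Longrightarrow> j' \<in> T \<Longrightarrow> elim (S <+> T) M (Inr j) (Inr j') = elim T (trans_mat \<Sigma> h T d) j j'"
      "elim (S <+> T) M (Inl i) (Inr j) = 0" "elim (S <+> T) M (Inr j) (Inl i) = 0"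
    using *[OF eq eq'] by auto
qed

lemma sum_Plus': "finite S \<Longrightarrow> finite T \<Longrightarrow> (\<Sum>x\<in>S <+> T. f x) = (\<Sum>s\<in>S. f (Inl s)) + (\<Sum>t\<in>T. f (Inr t))"
  by (simp add: sum.Plus)

lemma val_union:
  assumes h: "h \<in> \<Sigma> \<rightarrow> I" and fin: "finite S" "finite T"
  shows "val \<Sigma> h (S <+> T) (case_sum \<alpha> \<gamma>) (union_trans c d) (case_sum \<beta> \<delta>) =
    val \<Sigma> h S \<alpha> c \<beta> + val \<Sigma> h T \<gamma> d \<delta>"
proof -
  have "finite (S <+> T)"
    using fin by simp
  then show ?thesis
    using fin by (simp add: val_split sum_Plus' elim_union_trans[OF h fin] scalar_simps add_ac)
qed

text \<open>New transitions let a run that may end, according to \<open>\<beta>\<close>, continue where a run may start,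
  according to \<open>\<alpha>\<close>. As a transition carries a letter, the last transition of the first run leads directly
  to the start of the second one. The proof adds a state in between and eliminates it first and last.\<close>

lemma val_bridge:
  assumes h: "h \<in> \<Sigma> \<rightarrow> I" and fin: "finite S" and proper: "(\<Sum>i\<in>S. \<alpha> i * \<beta> i) = 0"
  shows "val \<Sigma> h S \<alpha> c \<beta> \<in> I"
    and "val \<Sigma> h S \<gamma> (\<lambda>i j a. c i j a + (\<Sum>u\<in>S. c i u a * \<beta> u) * \<alpha> j) \<delta> =
      val \<Sigma> h S \<gamma> c \<delta> +
        (\<Sum>i\<in>S. \<Sum>j\<in>S. scalar (\<gamma> i) * elim S (trans_mat \<Sigma> h S c) i j * scalar (\<beta> j)) *
          star (val \<Sigma> h S \<alpha> c \<beta>) * val \<Sigma> h S \<alpha> c \<delta>" (is "val _ _ _ _ ?c _ = _")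
proof -
  let ?k = scalar
  define M where "M = trans_mat \<Sigma> h S c"
  define v where "v = val \<Sigma> h S \<alpha> c \<beta>"
  define b where "b i = (\<Sum>u\<in>S. M i u * ?k (\<beta> u))" for i
  define N where "N x y = (case x of Some i \<Rightarrow> (case y of Some j \<Rightarrow> M i j | None \<Rightarrow> b i)
     | None \<Rightarrow> (case y of Some j \<Rightarrow> ?k (\<alpha> j) | None \<Rightarrow> 0))" for x y
  have MI: "M i j \<in> I" for i j
    unfolding M_def using h by (rule trans_mat_ideal)
  have gM: "guarded M"
    using MI by (rule guarded_ideal)
  have bI: "b i \<in> I" for i
    unfolding b_def using MI by (intro sum_ideal ideal_mult_right scalar_closed)
  have gN: "guarded N"
  proof (rule guardedI)
    show "N x y \<in> A" for x y
      using MI bI by (auto simp: N_def closed scalar_closed split: option.splits)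
    show "N x y \<in> I" if "(if y = None then 0 else 1) \<le> (if x = None then 0 else 1 :: nat)" for x y
      using that MI bI by (auto simp: N_def closed split: option.splits if_splits)
  qed
  have v: "v = (\<Sum>i\<in>S. \<Sum>j\<in>S. ?k (\<alpha> i) * elim S M i j * ?k (\<beta> j))"
    unfolding v_def val_split[OF fin] proper by (simp add: scalar_simps M_def)
  define Q where "Q = elim (Some ` S) N"
  have gQ: "guarded Q"
    unfolding Q_def using gN by (rule guarded_elim)
  have finS: "finite (Some ` S)"
    using fin by simp
  have Q1: "Q (Some i) (Some j) = elim S M i j" if "i \<in> S" "j \<in> S" for i j
    unfolding Q_def using that fin by (intro elim_reindex[OF gM gN, where X = S]) (auto simp: N_def)
  have mstar_N: "mstar (Some ` S) N (Some i) (Some j) = mstar S M i j" if "i \<in> S" "j \<in> S" for i j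
    using Q1[OF that] by (simp add: mstar_def Q_def)
  have Q2: "Q (Some i) None = (\<Sum>u\<in>S. elim S M i u * ?k (\<beta> u))" if "i \<in> S" for i
  proof -
    have "Q (Some i) None = (\<Sum>t\<in>S. mstar S M i t * b t)"
      unfolding Q_def using that mstar_N
      by (subst elim_eq_mstar_mult[OF gN finS]) (auto simp: sum.reindex N_def)
    also have "\<dots> = (\<Sum>t\<in>S. \<Sum>u\<in>S. mstar S M i t * M t u * ?k (\<beta> u))"
      by (simp add: b_def sum_distrib_left mult.assoc)
    also have "\<dots> = (\<Sum>u\<in>S. (\<Sum>t\<in>S. mstar S M i t * M t u) * ?k (\<beta> u))"
      by (subst sum.swap) (simp add: sum_distrib_right)
    finally show ?thesis
      using that by (simp add: elim_eq_mstar_mult[OF gM fin])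
  qed
  have Q3: "Q None (Some j) = (\<Sum>s\<in>S. ?k (\<alpha> s) * mstar S M s j)" if "j \<in> S" for j
    unfolding Q_def using that mstar_N
    by (subst elim_eq_mult_mstar[OF gN finS]) (auto simp: sum.reindex N_def)
  have Q4: "Q None None = v"
  proof -
    have "Q None None = N None None + (\<Sum>x\<in>Some ` S. N None x * Q x None)"
      unfolding Q_def by (rule elim_unfold_left[OF gN finS])
    also have "\<dots> = (\<Sum>i\<in>S. ?k (\<alpha> i) * (\<Sum>u\<in>S. elim S M i u * ?k (\<beta> u)))"
      by (simp add: N_def sum.reindex Q2)
    finally show ?thesis
      by (simp add: v sum_distrib_left mult.assoc)
  qed
  show vI: "val \<Sigma> h S \<alpha> c \<beta> \<in> I"
    using guarded_diag[OF gQ, of None] by (simp add: Q4 v_def)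
  have M': "trans_mat \<Sigma> h S ?c i j = elim {None} N (Some i) (Some j)" if "i \<in> S" "j \<in> S" for i j
  proof -
    have hA: "h a \<in> A" if "a \<in> \<Sigma>" for a
      using h that by (auto intro: ideal_closed)
    have "trans_mat \<Sigma> h S ?c i j =
        M i j + (\<Sum>a\<in>\<Sigma>. \<Sum>u\<in>S. act (c i u a) (h a) * ?k (\<beta> u) * ?k (\<alpha> j))"
      using that hA
      by (simp add: M_def trans_mat_def act_add_left sum.distrib act_mult_scalar act_sum_left sum_distrib_right)
    also have "\<dots> = M i j + b i * ?k (\<alpha> j)"
      using that by (subst sum.swap) (simp add: b_def M_def trans_mat_def sum_distrib_right)
    also have "\<dots> = elim {None} N (Some i) (Some j)"
      by (simp add: elim_singleton[OF gN] elim1_def N_def star_zero)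
    finally show ?thesis .
  qed
  have E: "elim S (trans_mat \<Sigma> h S ?c) i j = elim S M i j + Q (Some i) None * star v * Q None (Some j)"
    if ij: "i \<in> S" "j \<in> S" for i j
  proof -
    have "elim S (trans_mat \<Sigma> h S ?c) i j = elim (Some ` S) (elim {None} N) (Some i) (Some j)"
      using ij fin M' guarded_trans_mat[OF h] guarded_elim[OF gN]
      by (intro elim_reindex[symmetric, where X = S]) auto
    also have "elim (Some ` S) (elim {None} N) = elim {None} Q"
      unfolding Q_def using fin by (intro elim_commute[OF gN]) auto
    finally show ?thesis
      using ij by (simp add: elim_singleton[OF gQ] elim1_def Q1 Q4)
  qed
  have "(\<Sum>i\<in>S. \<Sum>j\<in>S. ?k (\<gamma> i) * (Q (Some i) None * star v * Q None (Some j)) * ?k (\<delta> j)) =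
      (\<Sum>i\<in>S. ?k (\<gamma> i) * Q (Some i) None) * star v * (\<Sum>j\<in>S. Q None (Some j) * ?k (\<delta> j))"
    by (simp add: sum_distrib_left sum_distrib_right mult.assoc)
       (subst sum.swap, simp)
  also have "(\<Sum>i\<in>S. ?k (\<gamma> i) * Q (Some i) None) = (\<Sum>i\<in>S. \<Sum>j\<in>S. ?k (\<gamma> i) * elim S M i j * ?k (\<beta> j))"
    by (simp add: Q2 sum_distrib_left mult.assoc)
  also have "(\<Sum>j\<in>S. Q None (Some j) * ?k (\<delta> j)) = val \<Sigma> h S \<alpha> c \<delta>"
    unfolding val_def M_def[symmetric]
    by (subst sum.swap) (simp add: Q3 sum_distrib_right)
  finally show "val \<Sigma> h S \<gamma> ?c \<delta> = val \<Sigma> h S \<gamma> c \<delta> +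
      (\<Sum>i\<in>S. \<Sum>j\<in>S. ?k (\<gamma> i) * elim S (trans_mat \<Sigma> h S c) i j * ?k (\<beta> j)) *
        star (val \<Sigma> h S \<alpha> c \<beta>) * val \<Sigma> h S \<alpha> c \<delta>"
    unfolding val_split[OF fin, of \<Sigma> h \<gamma> _ \<delta>] M_def[symmetric] v_def[symmetric]
    using E by (simp add: distrib_left distrib_right sum.distrib add.assoc)
qed

lemma val_plus:
  assumes h: "h \<in> \<Sigma> \<rightarrow> I" and fin: "finite S" and proper: "(\<Sum>i\<in>S. \<alpha> i * \<beta> i) = 0"
  shows "val \<Sigma> h S \<alpha> c \<beta> * star (val \<Sigma> h S \<alpha> c \<beta>) =
    val \<Sigma> h S \<alpha> (\<lambda>i j a. c i j a + (\<Sum>u\<in>S. c i u a * \<beta> u) * \<alpha> j) \<beta>"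
proof -
  let ?v = "val \<Sigma> h S \<alpha> c \<beta>"
  have v: "?v \<in> I"
    using h fin proper by (rule val_bridge)
  have "(\<Sum>i\<in>S. \<Sum>j\<in>S. scalar (\<alpha> i) * elim S (trans_mat \<Sigma> h S c) i j * scalar (\<beta> j)) = ?v"
    by (simp add: val_split[OF fin] proper scalar_simps)
  then show ?thesis
    using elim1_same[OF v] star_commute[OF v] by (simp add: val_bridge(2)[OF h fin proper])
qed

text \<open>The product is a bridge in the disjoint union, from the first automaton to the second one. A run
  may also start in the second automaton, with the coefficient of the empty word in the first one.\<close>

lemma val_mult:
  fixes c :: "'i \<Rightarrow> 'i \<Rightarrow> 's \<Rightarrow> 'k" and d :: "'j \<Rightarrow> 'j \<Rightarrow> 's \<Rightarrow> 'k" and \<beta> :: "'i \<Rightarrow> 'k" and \<gamma> :: "'j \<Rightarrow> 'k"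
  assumes h: "h \<in> \<Sigma> \<rightarrow> I" and fin: "finite S" "finite T"
  defines "\<alpha>' \<equiv> case_sum (\<lambda>_. 0) \<gamma> :: 'i + 'j \<Rightarrow> 'k" and "\<beta>' \<equiv> case_sum \<beta> (\<lambda>_. 0) :: 'i + 'j \<Rightarrow> 'k"
    and "c' \<equiv> union_trans c d"
  shows "val \<Sigma> h S \<alpha> c \<beta> * val \<Sigma> h T \<gamma> d \<delta> =
    val \<Sigma> h (S <+> T) (case_sum \<alpha> (\<lambda>t. (\<Sum>i\<in>S. \<alpha> i * \<beta> i) * \<gamma> t))
      (\<lambda>x y a. c' x y a + (\<Sum>u\<in>S <+> T. c' x u a * \<beta>' u) * \<alpha>' y) (case_sum (\<lambda>_. 0) \<delta>)"
proof -
  have fin': "finite (S <+> T)"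
    using fin by simp
  have zero: "(\<Sum>x\<in>S <+> T. \<alpha>' x * \<beta>' x) = 0"
    using fin by (simp add: sum_Plus' \<alpha>'_def \<beta>'_def)
  have val0: "val \<Sigma> h S \<alpha> c (\<lambda>_. 0) = 0" "val \<Sigma> h S (\<lambda>_. 0) c \<beta> = 0" "val \<Sigma> h T \<gamma> d (\<lambda>_. 0) = 0"
    for \<alpha> \<beta>
    by (simp_all add: val_def scalar_simps)
  have "val \<Sigma> h T (\<lambda>t. k * \<gamma> t) d \<delta> = scalar k * val \<Sigma> h T \<gamma> d \<delta>" for k
    using val_scale[OF h, of k T \<gamma> d \<delta>] by (simp add: act_eq_left[OF val_closed[OF h]])
  then show ?thesis
    unfolding val_bridge(2)[OF h fin' zero]
    unfolding \<alpha>'_def \<beta>'_def c'_def val_union[OF h fin] val0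
    using fin by (simp add: val_split[OF fin(1), of \<Sigma> h \<alpha> c \<beta>] sum_Plus' elim_union_trans[OF h fin] scalar_simps
        star_zero distrib_right)
qed

subsection \<open>Invariance under simulations\<close>

lemma lumps_mstar:
  assumes lump: "lumps \<rho> S (elim S M) T (elim T N)" and S: "finite S" and i: "i \<in> S" and q: "q \<in> T"
  shows "(\<Sum>j\<in>{j \<in> S. \<rho> j = q}. mstar S M i j) = mstar T N (\<rho> i) q"
proof -
  have "(\<Sum>j\<in>{j \<in> S. \<rho> j = q}. if i = j then 1 else 0 :: 'a) = (if \<rho> i = q then 1 else 0)"
    using S i by auto
  moreover have "(\<Sum>j\<in>{j \<in> S. \<rho> j = q}. elim S M i j) = elim T N (\<rho> i) q"
    using lump i q by (simp add: lumps_def)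
  ultimately show ?thesis
    by (simp add: mstar_def sum.distrib)
qed

lemma val_invertible_diagonal:
  fixes c d :: "nat \<Rightarrow> nat \<Rightarrow> 's \<Rightarrow> 'k"
  assumes h: "h \<in> \<Sigma> \<rightarrow> I" and u: "\<And>i. i < n \<Longrightarrow> x i * u i = 1"
    and \<gamma>: "\<And>i. i < n \<Longrightarrow> \<gamma> i = \<alpha> i * x i" and \<beta>: "\<And>i. i < n \<Longrightarrow> \<beta> i = x i * \<delta> i"
    and c: "\<And>i j a. i < n \<Longrightarrow> j < n \<Longrightarrow> a \<in> \<Sigma> \<Longrightarrow> c i j a * x j = x i * d i j a"
  shows "val \<Sigma> h {..<n} \<alpha> c \<beta> = val \<Sigma> h {..<n} \<gamma> d \<delta>"
proof -
  let ?M = "trans_mat \<Sigma> h {..<n} c" and ?N = "trans_mat \<Sigma> h {..<n} d"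
  have gM: "guarded ?M" and gN: "guarded ?N"
    using h by (auto intro: guarded_trans_mat)
  have hA: "h a \<in> A" if "a \<in> \<Sigma>" for a
    using h that by (auto intro: ideal_closed)
  have d: "d i j a = u i * (c i j a * x j)" if "i < n" "j < n" "a \<in> \<Sigma>" for i j a
    using c[OF that] u[OF that(1)] by (simp add: mult.assoc[symmetric] mult.commute[of "u i"])
  have N: "?N i j = scalar (u i) * ?M i j * scalar (x j)" if "i < n" "j < n" for i j
  proof -
    have "act (d i j a) (h a) = scalar (u i) * act (c i j a) (h a) * scalar (x j)" if a: "a \<in> \<Sigma>" for a
    proof -
      have "act (d i j a) (h a) = scalar (u i) * act (c i j a * x j) (h a)"
        using d[OF \<open>i < n\<close> \<open>j < n\<close> a] act_mult[of "h a" "u i" "c i j a * x j"] hA[OF a]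
          act_eq_left[of "act (c i j a * x j) (h a)" "u i"]
        by (simp add: closed)
      then show ?thesis
        using hA[OF a] by (simp add: act_mult_scalar mult.assoc)
    qed
    then show ?thesis
      using that by (simp add: trans_mat_def sum_distrib_left sum_distrib_right)
  qed
  have ux: "scalar (x k) * scalar (u k) = 1" if "k < n" for k
    using u[OF that] by (simp add: scalar_simps(4)[symmetric] scalar_simps(2))
  have E: "elim S ?N i j = scalar (u i) * elim S ?M i j * scalar (x j)"
    if "finite S" "S \<subseteq> {..<n}" "i < n" "j < n" for S i j
    using that
  proof (induction S arbitrary: i j)
    case (insert k S)
    let ?P = "elim S ?M"
    have k: "k < n" and S: "S \<subseteq> {..<n}"
      using insert.prems by auto
    note IH = insert.IH[OF S]
    have "?P k k \<in> I"
      by (intro guarded_diag guarded_elim gM)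
    then have diag: "scalar (u k) * ?P k k * scalar (x k) = ?P k k"
      using ux[OF k] scalar_commute[of "?P k k" "u k"] scalar_commute[OF scalar_closed, of "u k" "x k"]
      by (simp add: closed mult.assoc)
    have sA: "star (?P k k) \<in> A"
      using \<open>?P k k \<in> I\<close> by (rule star_closed)
    have "elim (insert k S) ?N i j = scalar (u i) * ?P i j * scalar (x j) +
        scalar (u i) * ?P i k * (scalar (x k) * (star (?P k k) * scalar (u k))) * ?P k j * scalar (x j)"
      using insert(1,2) insert.prems k by (simp add: elim_insert[OF gN] elim1_def IH diag[unfolded mult.assoc] mult.assoc)
    also have "scalar (x k) * (star (?P k k) * scalar (u k)) = star (?P k k)"
      using ux[OF k] scalar_commute[OF sA, of "u k"] by (simp add: mult.assoc[symmetric] flip: scalar_commute[OF sA])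
    finally show ?case
      using insert(1,2) by (simp add: elim_insert[OF gM] elim1_def distrib_left distrib_right mult.assoc)
  qed (simp add: N)
  have "mstar {..<n} ?N i j = scalar (u i) * mstar {..<n} ?M i j * scalar (x j)" if "i < n" "j < n" for i j
    using that E[of "{..<n}" i j] ux[of i] scalar_commute[OF scalar_closed, of "u i" "x i"]
    by (auto simp: mstar_def distrib_left distrib_right)
  then have "scalar (\<gamma> i) * mstar {..<n} ?N i j * scalar (\<delta> j) = scalar (\<alpha> i) * mstar {..<n} ?M i j * scalar (\<beta> j)"
    if "i < n" "j < n" for i j
  proof -
    have "scalar (\<gamma> i) * mstar {..<n} ?N i j * scalar (\<delta> j) =
        scalar (\<alpha> i) * (scalar (x i) * scalar (u i)) * mstar {..<n} ?M i j * (scalar (x j) * scalar (\<delta> j))"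
      using that \<open>\<And>i j. i < n \<Longrightarrow> j < n \<Longrightarrow> mstar {..<n} ?N i j = _ i j\<close>
      by (simp add: \<gamma> scalar_simps mult.assoc)
    then show ?thesis
      using that ux by (simp add: \<beta> scalar_simps)
  qed
  then show ?thesis
    unfolding val_def by simp
qed

end

context partial_iteration_semialgebra
begin

lemma val_functional:
  fixes c d :: "nat \<Rightarrow> nat \<Rightarrow> 's \<Rightarrow> 'k" and \<Sigma> :: "'s set"
  assumes atom: "atomistic TYPE('k)" and \<Sigma>: "finite \<Sigma>" and h: "h \<in> \<Sigma> \<rightarrow> I"
    and \<rho>: "\<And>i. i < m \<Longrightarrow> \<rho> i < n"
    and \<gamma>: "\<And>q. q < n \<Longrightarrow> (\<Sum>i\<in>{i. i < m \<and> \<rho> i = q}. \<alpha> i) = \<gamma> q"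
    and sim: "\<And>i q a. i < m \<Longrightarrow> q < n \<Longrightarrow> a \<in> \<Sigma> \<Longrightarrow> (\<Sum>j\<in>{j. j < m \<and> \<rho> j = q}. c i j a) = d (\<rho> i) q a"
    and \<beta>: "\<And>i. i < m \<Longrightarrow> \<beta> i = \<delta> (\<rho> i)"
  shows "val \<Sigma> h {..<m} \<alpha> c \<beta> = val \<Sigma> h {..<n} \<gamma> d \<delta>"
proof -
  let ?M = "trans_mat \<Sigma> h {..<m} c" and ?N = "trans_mat \<Sigma> h {..<n} d"
  have "lumps \<rho> {..<m} (elim {..<m} ?M) {..<n} (elim {..<n} ?N)"
    using \<rho> sim by (rule functional_simulation[OF atom \<Sigma> h])
  then have lump: "(\<Sum>j\<in>{j. j < m \<and> \<rho> j = q}. mstar {..<m} ?M i j) = mstar {..<n} ?N (\<rho> i) q" if "i < m" "q < n" for i q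
    using that lumps_mstar[of \<rho> "{..<m}" ?M "{..<n}" ?N i q] by simp
  have \<rho>': "\<rho> ` {..<m} \<subseteq> {..<n}"
    using \<rho> by auto
  define f where "f p = (\<Sum>q<n. mstar {..<n} ?N p q * scalar (\<delta> q))" for p
  have "(\<Sum>j<m. mstar {..<m} ?M i j * scalar (\<beta> j)) = f (\<rho> i)" if i: "i < m" for i
  proof -
    have "(\<Sum>j<m. mstar {..<m} ?M i j * scalar (\<beta> j)) = (\<Sum>j<m. mstar {..<m} ?M i j * scalar (\<delta> (\<rho> j)))"
      by (simp add: \<beta>)
    also have "\<dots> = f (\<rho> i)"
      using sum_lump[OF _ _ \<rho>', of "mstar {..<m} ?M i" "\<lambda>q. scalar (\<delta> q)"] i by (simp add: lump f_def)
    finally show ?thesis .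
  qed
  then have "val \<Sigma> h {..<m} \<alpha> c \<beta> = (\<Sum>i<m. scalar (\<alpha> i) * f (\<rho> i))"
    by (simp add: val_def mult.assoc sum_distrib_left[symmetric])
  also have "\<dots> = (\<Sum>p<n. (\<Sum>i\<in>{i \<in> {..<m}. \<rho> i = p}. scalar (\<alpha> i)) * f p)"
    using \<rho>' by (intro sum_lump) auto
  also have "\<dots> = (\<Sum>p<n. scalar (\<gamma> p) * f p)"
    by (simp add: \<gamma>[symmetric] scalar_sum)
  also have "\<dots> = val \<Sigma> h {..<n} \<gamma> d \<delta>"
    by (simp add: val_def f_def sum_distrib_left mult.assoc)
  finally show ?thesis .
qed

end

subsection \<open>The opposite semialgebra\<close>

text \<open>A copy of the type, with the product reversed.\<close>

datatype 'a opp = Opp (unopp: 'a)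

instantiation opp :: (semiring_1) semiring_1
begin

definition zero_opp :: "'a opp" where "0 = Opp 0"
definition one_opp :: "'a opp" where "1 = Opp 1"
definition plus_opp :: "'a opp \<Rightarrow> 'a opp \<Rightarrow> 'a opp" where "x + y = Opp (unopp x + unopp y)"
definition times_opp :: "'a opp \<Rightarrow> 'a opp \<Rightarrow> 'a opp" where "x * y = Opp (unopp y * unopp x)"

instance
  by standard
    (auto simp: zero_opp_def one_opp_def plus_opp_def times_opp_def add_ac mult.assoc
      distrib_left distrib_right)

end

lemma unopp_simps [simp]:
  "unopp 0 = 0" "unopp 1 = 1" "unopp (x + y) = unopp x + unopp y" "unopp (x * y) = unopp y * unopp x"
  by (simp_all add: zero_opp_def one_opp_def plus_opp_def times_opp_def)

lemma unopp_sum: "unopp (sum f X) = (\<Sum>x\<in>X. unopp (f x))"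
  by (induction X rule: infinite_finite_induct) simp_all

text \<open>The action and the star, transported to the copy.\<close>

definition opp_act :: "('k \<Rightarrow> 'a \<Rightarrow> 'a) \<Rightarrow> 'k \<Rightarrow> 'a opp \<Rightarrow> 'a opp" where
  "opp_act act k x = Opp (act k (unopp x))"

definition opp_star :: "('a \<Rightarrow> 'a) \<Rightarrow> 'a opp \<Rightarrow> 'a opp" where
  "opp_star star x = Opp (star (unopp x))"

lemma unopp_act_star [simp]:
  "unopp (opp_act act k x) = act k (unopp x)" "unopp (opp_star star x) = star (unopp x)"
  by (simp_all add: opp_act_def opp_star_def)

lemma Opp_image_iff: "x \<in> Opp ` X \<longleftrightarrow> unopp x \<in> X"
  by (cases x) auto

lemma opp_eqI: "unopp x = unopp y \<Longrightarrow> x = y"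
  by (cases x; cases y) auto

lemma (in partial_conway_semialgebra) opposite_conway:
  "partial_conway_semialgebra (Opp ` A) (opp_act act) (Opp ` I) (opp_star star)"
proof unfold_locales
  fix a b :: "'a opp" and k k' :: 'k
  assume "a \<in> Opp ` A"
  then have a: "unopp a \<in> A"
    by (simp add: Opp_image_iff)
  show "opp_act act (k + k') a = opp_act act k a + opp_act act k' a"
    using a by (intro opp_eqI) (simp add: act_add_left)
  show "opp_act act (k * k') a = opp_act act k (opp_act act k' a)"
    using a by (intro opp_eqI) (simp add: act_mult)
  show "opp_act act 1 a = a" "opp_act act 0 a = 0"
    using a by (intro opp_eqI; simp add: act_one act_zero_left)+
  assume "b \<in> Opp ` A"
  then have b: "unopp b \<in> A"
    by (simp add: Opp_image_iff)
  show "opp_act act k (a + b) = opp_act act k a + opp_act act k b"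
    using a b by (intro opp_eqI) (simp add: act_add_right)
  show "opp_act act k (a * b) = opp_act act k a * b"
    using a b by (intro opp_eqI) (simp add: act_mult_right)
  show "opp_act act k (a * b) = a * opp_act act k b"
    using a b by (intro opp_eqI) (simp add: act_mult_left)
  assume "a \<in> Opp ` I \<or> b \<in> Opp ` I"
  then have "unopp b \<in> I \<or> unopp a \<in> I"
    by (auto simp: Opp_image_iff)
  then show "opp_star star (a * b) = 1 + a * opp_star star (b * a) * b"
    using a b by (intro opp_eqI) (simp add: product_star mult.assoc)
next
  fix a b :: "'a opp"
  assume "a \<in> Opp ` I" "b \<in> Opp ` I"
  then show "opp_star star (a + b) = opp_star star (opp_star star a * b) * opp_star star a"
    by (intro opp_eqI) (simp add: Opp_image_iff sum_star')
next
  show "opp_act act k 0 = 0" for k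
    by (intro opp_eqI) (simp add: act_zero_right)
qed (auto simp: Opp_image_iff closed)

lemma (in partial_conway_semialgebra) elim_opposite:
  assumes M: "\<And>i j. unopp (M i j) \<in> I" and S: "finite S"
  shows "partial_conway_semialgebra.elim (Opp ` A) (Opp ` I) (opp_star star) S M i j =
    Opp (elim S (\<lambda>i j. unopp (M j i)) j i)"
proof -
  interpret op: partial_conway_semialgebra "Opp ` A" "opp_act act" "Opp ` I" "opp_star star"
    by (rule opposite_conway)
  have "op.guarded M" "guarded (\<lambda>i j. unopp (M j i))"
    using M by (auto intro: op.guarded_ideal guarded_ideal simp: Opp_image_iff)
  with S show ?thesis
    by (induction S arbitrary: i j)
      (simp_all add: op.elim_insert elim_insert op.elim1_def elim1_def opp_eqI mult.assoc)
qed

context partial_iteration_semialgebra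
begin

text \<open>The group identity of the opposite semialgebra is about columns. By invariance, the entries of a
  column are those of a row in a different order.\<close>

lemma group_column_sum:
  fixes G (structure) and K :: "'g \<Rightarrow> 'g \<Rightarrow> 'a"
  assumes G: "group G" and fin: "finite (carrier G)" and K: "\<And>g h. K g h \<in> I"
    and inv: "\<And>k g h. k \<in> carrier G \<Longrightarrow> g \<in> carrier G \<Longrightarrow> h \<in> carrier G \<Longrightarrow>
      K (k \<otimes> g) (k \<otimes> h) = K g h"
    and h: "h \<in> carrier G"
  shows "(\<Sum>g\<in>carrier G. mstar (carrier G) K g h) = star (\<Sum>g\<in>carrier G. K g h)"
proof -
  interpret group G by (rule G)
  let ?C = "carrier G"
  have gK: "guarded K"
    using K by (rule guarded_ideal)
  have inv': "mstar ?C K (k \<otimes> g) (k \<otimes> h) = mstar ?C K g h"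
    if "k \<in> ?C" "g \<in> ?C" "h \<in> ?C" for k g h
  proof -
    have "(\<lambda>x. k \<otimes> x) ` ?C = ?C"
      using that by (simp add: surj_const_mult)
    moreover have "elim ((\<lambda>x. k \<otimes> x) ` ?C) K (k \<otimes> g) (k \<otimes> h) = elim ?C K g h"
      using that fin inv by (intro elim_reindex[OF gK gK, where X = ?C]) (auto simp: inj_on_def)
    ultimately show ?thesis
      using that by (simp add: mstar_def)
  qed
  have column: "(\<Sum>g\<in>?C. f g h) = (\<Sum>g\<in>?C. f \<one> g)"
    if "\<And>k g h. k \<in> ?C \<Longrightarrow> g \<in> ?C \<Longrightarrow> h \<in> ?C \<Longrightarrow> f (k \<otimes> g) (k \<otimes> h) = f g h" for f :: "_ \<Rightarrow> _ \<Rightarrow> 'a"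
  proof (rule sum.reindex_bij_witness[of _ "\<lambda>g. h \<otimes> inv g" "\<lambda>g. inv g \<otimes> h"])
    fix g assume "g \<in> ?C"
    then show "f \<one> (inv g \<otimes> h) = f g h"
      using that[of "inv g" g h] h by simp
  qed (use h in \<open>auto simp: inv_mult_group m_assoc[symmetric]\<close>, simp add: m_assoc)
  have "(\<Sum>g\<in>?C. mstar ?C K g h) = (\<Sum>g\<in>?C. mstar ?C K \<one> g)"
    using inv' by (rule column)
  also have "\<dots> = star (\<Sum>g\<in>?C. K \<one> g)"
    using G fin K inv one_closed by (rule group_row_sum)
  also have "(\<Sum>g\<in>?C. K \<one> g) = (\<Sum>g\<in>?C. K g h)"
    using column[of K] inv by simp
  finally show ?thesis .
qed

lemma opposite: "partial_iteration_semialgebra (Opp ` A) (opp_act act) (Opp ` I) (opp_star star)"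
proof -
  interpret op: partial_conway_semialgebra "Opp ` A" "opp_act act" "Opp ` I" "opp_star star"
    by (rule opposite_conway)
  show ?thesis
  proof unfold_locales
    fix G :: "nat monoid" and n and x :: "nat \<Rightarrow> 'a opp"
    assume G: "group G" and C: "carrier G = {..<n}" and x: "x \<in> {..<n} \<rightarrow> Opp ` I"
    interpret group G by (rule G)
    let ?M = "group_mat G n x"
    have n: "0 < n"
      using one_closed by (auto simp: C)
    have prod: "inv\<^bsub>G\<^esub> i \<otimes>\<^bsub>G\<^esub> j < n" if "i < n" "j < n" for i j
      using that m_closed[of "inv\<^bsub>G\<^esub> i" j] inv_closed[of i] by (auto simp: C)
    have xI: "unopp (x i) \<in> I" if "i < n" for i
      using that x by (auto simp: Opp_image_iff[symmetric])
    define K where "K j i = unopp (op.entries n ?M i j)" for i j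
    have K_eq: "K j i = unopp (x (inv\<^bsub>G\<^esub> i \<otimes>\<^bsub>G\<^esub> j))" if "i < n" "j < n" for i j
      using that by (simp add: K_def op.entries_def group_mat_def)
    have KI: "K i j \<in> I" for i j
      using prod xI by (auto simp: K_def op.entries_def group_mat_def closed)
    have inv: "K (k \<otimes>\<^bsub>G\<^esub> g) (k \<otimes>\<^bsub>G\<^esub> h) = K g h" if kgh: "k \<in> carrier G" "g \<in> carrier G" "h \<in> carrier G" for k g h
    proof -
      have "inv\<^bsub>G\<^esub> (k \<otimes>\<^bsub>G\<^esub> h) \<otimes>\<^bsub>G\<^esub> (k \<otimes>\<^bsub>G\<^esub> g) = inv\<^bsub>G\<^esub> h \<otimes>\<^bsub>G\<^esub> g"
        using kgh by (simp add: inv_mult_group m_assoc) (simp add: m_assoc[symmetric])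
      then show ?thesis
        using kgh m_closed[OF kgh(1,2)] m_closed[OF kgh(1,3)] by (simp add: K_eq C)
    qed
    have 0: "0 \<in> carrier G"
      using n C by simp
    have "unopp (\<Sum>j<n. mat_star (opp_star star) n ?M $$ (0, j)) = (\<Sum>j<n. mstar {..<n} K j 0)"
    proof -
      have "mat_star (opp_star star) n ?M $$ (0, j) = op.mstar {..<n} (op.entries n ?M) 0 j" if "j < n" for j
      proof -
        have "?M \<in> carrier_mat n n" "\<And>i j. i < n \<Longrightarrow> j < n \<Longrightarrow> ?M $$ (i, j) \<in> Opp ` I"
          using prod xI by (auto simp: group_mat_def Opp_image_iff)
        then show ?thesis
          using op.mat_star_eq[of n ?M] n that by simp
      qed
      moreover have "unopp (op.mstar {..<n} (op.entries n ?M) 0 j) = mstar {..<n} K j 0" for j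
        using KI by (simp add: op.mstar_def mstar_def elim_opposite K_def[symmetric])
      ultimately show ?thesis
        by (simp add: unopp_sum)
    qed
    also have "\<dots> = star (\<Sum>j<n. K j 0)"
      using group_column_sum[where K = K, OF G _ KI inv 0] C by simp
    also have "(\<Sum>j<n. K j 0) = (\<Sum>j<n. unopp (x (inv\<^bsub>G\<^esub> 0 \<otimes>\<^bsub>G\<^esub> j)))"
      using n by (simp add: K_eq)
    also have "\<dots> = (\<Sum>j<n. unopp (x j))"
      using inj_on_cmult[OF inv_closed[OF 0]] surj_const_mult[OF inv_closed[OF 0]]
      by (intro sum.reindex_bij_betw[of _ _ _ "\<lambda>j. unopp (x j)"]) (simp add: bij_betw_def C)
    finally show "(\<Sum>j<n. mat_star (opp_star star) n ?M $$ (0, j)) = opp_star star (\<Sum>i<n. x i)"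
      by (intro opp_eqI) (simp add: unopp_sum)
  qed
qed

lemma val_dual_functional:
  fixes c d :: "nat \<Rightarrow> nat \<Rightarrow> 's \<Rightarrow> 'k" and \<Sigma> :: "'s set"
  assumes atom: "atomistic TYPE('k)" and \<Sigma>: "finite \<Sigma>" and h: "h \<in> \<Sigma> \<rightarrow> I"
    and \<sigma>: "\<And>j. j < n \<Longrightarrow> \<sigma> j < m"
    and \<gamma>: "\<And>j. j < n \<Longrightarrow> \<gamma> j = \<alpha> (\<sigma> j)"
    and sim: "\<And>i j a. i < m \<Longrightarrow> j < n \<Longrightarrow> a \<in> \<Sigma> \<Longrightarrow> (\<Sum>j'\<in>{j'. j' < n \<and> \<sigma> j' = i}. d j' j a) = c i (\<sigma> j) a"
    and \<beta>: "\<And>i. i < m \<Longrightarrow> (\<Sum>j\<in>{j. j < n \<and> \<sigma> j = i}. \<delta> j) = \<beta> i"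
  shows "val \<Sigma> h {..<m} \<alpha> c \<beta> = val \<Sigma> h {..<n} \<gamma> d \<delta>"
proof -
  interpret op: partial_iteration_semialgebra "Opp ` A" "opp_act act" "Opp ` I" "opp_star star"
    by (rule opposite)
  let ?h = "Opp \<circ> h"
  have op_val: "unopp (op.val \<Sigma> ?h S \<beta> (\<lambda>i j. c j i) \<alpha>) = val \<Sigma> h S \<alpha> c \<beta>" if S: "finite S"
    for S :: "nat set" and \<alpha> c \<beta>
  proof -
    define M where "M = op.trans_mat \<Sigma> ?h S (\<lambda>i j. c j i)"
    have M: "unopp (M i j) = trans_mat \<Sigma> h S c j i" for i j
      by (simp add: M_def op.trans_mat_def trans_mat_def unopp_sum)
    have "unopp (op.mstar S M i j) = mstar S (trans_mat \<Sigma> h S c) j i" for i j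
      using S by (simp add: op.mstar_def mstar_def elim_opposite M trans_mat_ideal[OF h])
    moreover have "unopp (op.scalar k) = scalar k" for k
      by (simp add: op.scalar_def scalar_def)
    ultimately show ?thesis
      unfolding op.val_def val_def M_def[symmetric]
      by (subst sum.swap) (simp add: unopp_sum mult.assoc)
  qed
  have "op.val \<Sigma> ?h {..<n} \<delta> (\<lambda>i j. d j i) \<gamma> = op.val \<Sigma> ?h {..<m} \<beta> (\<lambda>i j. c j i) \<alpha>"
    using h \<sigma> \<gamma> sim \<beta> by (intro op.val_functional[OF atom \<Sigma>, where \<rho> = \<sigma>]) auto
  from arg_cong[OF this, of unopp] show ?thesis
    by (simp add: op_val)
qed

end

section \<open>Formal series\<close>

lemma coeff_simps:
  "coeff 0 w = 0" "coeff 1 w = (if w = [] then 1 else 0)" "coeff (s + t) w = coeff s w + coeff t w"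
  "coeff (s * t) w = (\<Sum>i\<le>length w. coeff s (take i w) * coeff t (drop i w))"
  "coeff (const k) w = (if w = [] then k else 0)" "coeff (letter a) w = (if w = [a] then 1 else 0)"
  "coeff (scale k s) w = k * coeff s w"
  by (transfer; simp)+

lemma coeff_sum: "coeff (sum f X) w = (\<Sum>x\<in>X. coeff (f x) w)"
  by (induction X rule: infinite_finite_induct) (simp_all add: coeff_simps)

lemma const_mult: "const k * s = scale k (s :: ('s, 'k::comm_semiring_1) series)"
proof (rule series_eqI)
  fix w
  have "coeff (const k * s) w = (\<Sum>i\<le>length w. if i = 0 then k * coeff s w else 0)"
    unfolding coeff_simps by (rule sum.cong) auto
  then show "coeff (const k * s) w = coeff (scale k s) w"
    by (simp add: coeff_simps)
qed

lemma mult_const: "s * const k = scale k (s :: ('s, 'k::comm_semiring_1) series)"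
proof (rule series_eqI)
  fix w
  have "coeff (s * const k) w = (\<Sum>i\<le>length w. if i = length w then k * coeff s w else 0)"
    unfolding coeff_simps by (rule sum.cong) (auto simp: mult.commute)
  then show "coeff (s * const k) w = coeff (scale k s) w"
    by (simp add: coeff_simps)
qed

lemma proper_simps: "proper (0 :: ('s, 'k::semiring_1) series)" "proper (letter a)"
  "proper s \<Longrightarrow> proper t \<Longrightarrow> proper (s + t :: ('s, 'k) series)"
  "proper s \<or> proper t \<Longrightarrow> proper (s * t :: ('s, 'k) series)"
  by (auto simp: proper_def coeff_simps)

lemma proper_scale: "proper s \<Longrightarrow> proper (scale k (s :: ('s, 'k::semiring_1) series))"
  by (simp add: proper_def coeff_simps)

lemma coeff_mult_cong:
  fixes s x y :: "('s, 'k::semiring_1) series"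
  assumes "proper s" and "\<And>v. length v < length w \<Longrightarrow> coeff x v = coeff y v"
  shows "coeff (s * x) w = coeff (s * y) w"
  unfolding coeff_simps
proof (rule sum.cong[OF refl])
  fix i assume "i \<in> {..length w}"
  show "coeff s (take i w) * coeff x (drop i w) = coeff s (take i w) * coeff y (drop i w)"
  proof (cases "i = 0 \<or> w = []")
    case True
    then show ?thesis
      using assms(1) by (auto simp: proper_def)
  next
    case False
    then show ?thesis
      using assms(2) by simp
  qed
qed

text \<open>A proper factor is nonempty on every word in its support, so that coefficients are determined by
  those of shorter words.\<close>

lemma proper_system_unique:
  fixes M :: "'i \<Rightarrow> 'i \<Rightarrow> ('s, 'k::semiring_1) series"
  assumes M: "\<And>i j. i \<in> S \<Longrightarrow> j \<in> S \<Longrightarrow> proper (M i j)"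
    and x: "\<And>i. i \<in> S \<Longrightarrow> x i = (\<Sum>j\<in>S. M i j * x j) + b i"
    and y: "\<And>i. i \<in> S \<Longrightarrow> y i = (\<Sum>j\<in>S. M i j * y j) + b i"
    and i: "i \<in> S"
  shows "x i = y i"
proof (rule series_eqI)
  fix w
  show "coeff (x i) w = coeff (y i) w"
    using i
  proof (induction w arbitrary: i rule: measure_induct_rule[of length])
    case (less w)
    have "coeff (x i) w = (\<Sum>j\<in>S. coeff (M i j * x j) w) + coeff (b i) w"
      by (subst x[OF less.prems]) (simp add: coeff_simps(3) coeff_sum)
    also have "\<dots> = (\<Sum>j\<in>S. coeff (M i j * y j) w) + coeff (b i) w"
      using less M by (intro arg_cong2[where f = "(+)"] sum.cong refl coeff_mult_cong) auto
    also have "\<dots> = coeff (y i) w"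
      by (subst y[OF less.prems]) (simp add: coeff_simps(3) coeff_sum)
    finally show ?case .
  qed
qed

text \<open>The coefficients of \<open>s\<^sup>*\<close> for proper \<open>s\<close>, by recursion on the remaining word.\<close>

fun star_coeff :: "('s list \<Rightarrow> 'k::semiring_1) \<Rightarrow> 's list \<Rightarrow> 'k" where
  "star_coeff s w = (if w = [] then 1 else \<Sum>i\<in>{1..length w}. s (take i w) * star_coeff s (drop i w))"

declare star_coeff.simps [simp del]

lemma star_exists:
  fixes s :: "('s, 'k::semiring_1) series"
  assumes s: "proper s"
  shows "\<exists>x. x = s * x + 1"
proof
  let ?x = "Series (star_coeff (coeff s)) :: ('s, 'k) series"
  have x: "coeff ?x = star_coeff (coeff s)"
    by (simp add: Series_inverse)
  show "?x = s * ?x + 1"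
  proof (rule series_eqI)
    fix w
    have "coeff (s * ?x + 1) w =
        (\<Sum>i\<le>length w. coeff s (take i w) * star_coeff (coeff s) (drop i w)) + (if w = [] then 1 else 0)"
      by (simp add: coeff_simps x)
    also have "{..length w} = insert 0 {1..length w}"
      by auto
    also have "(\<Sum>i\<in>insert 0 {1..length w}. coeff s (take i w) * star_coeff (coeff s) (drop i w)) =
        (\<Sum>i\<in>{1..length w}. coeff s (take i w) * star_coeff (coeff s) (drop i w))"
      using s by (simp add: proper_def)
    finally show "coeff ?x w = coeff (s * ?x + 1) w"
      unfolding x by (subst star_coeff.simps) auto
  qed
qed

lemma proper_equation_unique:
  fixes s x y :: "('s, 'k::semiring_1) series"
  assumes "proper s" "x = s * x + b" "y = s * y + b"
  shows "x = y"
  using proper_system_unique[of "{()}" "\<lambda>_ _. s" "\<lambda>_. x" "\<lambda>_. b" "\<lambda>_. y" "()"] assms by simp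

lemma series_star_unfold:
  fixes s :: "('s, 'k::semiring_1) series"
  assumes s: "proper s"
  shows "series_star s = s * series_star s + 1"
proof -
  have "\<exists>!x. x = s * x + 1"
    using star_exists[OF s] proper_equation_unique[OF s] by blast
  then show ?thesis
    unfolding series_star_def by (rule theI')
qed

lemma series_star_solves:
  fixes s x b :: "('s, 'k::semiring_1) series"
  assumes s: "proper s" and x: "x = s * x + b"
  shows "x = series_star s * b"
proof (rule proper_equation_unique[OF s x])
  have "series_star s * b = (s * series_star s + 1) * b"
    using series_star_unfold[OF s] by simp
  then show "series_star s * b = s * (series_star s * b) + b"
    by (simp add: distrib_right mult.assoc)
qed

lemma series_conway:
  "partial_conway_semialgebra (UNIV :: ('s, 'k::comm_semiring_1) series set) scale {s. proper s} series_star"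
proof unfold_locales
  fix a b :: "('s, 'k) series" and k k' :: 'k
  show "scale (k + k') a = scale k a + scale k' a"
    by (rule series_eqI) (simp add: coeff_simps distrib_right)
  show "scale k (a + b) = scale k a + scale k b"
    by (rule series_eqI) (simp add: coeff_simps distrib_left)
  show "scale (k * k') a = scale k (scale k' a)"
    by (rule series_eqI) (simp add: coeff_simps mult.assoc)
  show "scale 1 a = a" "scale 0 a = 0" "scale k (0 :: ('s, 'k) series) = 0"
    by (rule series_eqI; simp add: coeff_simps)+
  show "scale k (a * b) = scale k a * b"
    by (simp only: const_mult[symmetric] mult.assoc)
  show "scale k (a * b) = a * scale k b"
    by (simp only: mult_const[symmetric] mult.assoc)
next
  fix a b :: "('s, 'k) series"
  assume "a \<in> {s. proper s}" "b \<in> {s. proper s}"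
  then have a: "proper a" and b: "proper b"
    by auto
  define z where "z = series_star (a + b)"
  have "z = (a + b) * z + 1"
    unfolding z_def using a b by (intro series_star_unfold proper_simps)
  then have "z = a * z + (b * z + 1)"
    by (simp add: distrib_right add.assoc)
  then have "z = series_star a * (b * z + 1)"
    by (rule series_star_solves[OF a])
  then have "z = (series_star a * b) * z + series_star a"
    by (simp add: distrib_left mult.assoc)
  then have "z = series_star (series_star a * b) * series_star a"
    using b by (intro series_star_solves) (simp_all add: proper_simps)
  then show "series_star (a + b) = series_star (series_star a * b) * series_star a"
    by (simp add: z_def)
next
  fix a b :: "('s, 'k) series"
  assume "a \<in> {s. proper s} \<or> b \<in> {s. proper s}"
  then have p: "proper (a * b)" "proper (b * a)"
    by (auto simp: proper_simps)
  define w where "w = series_star (b * a)"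
  have w: "b * a * w + 1 = w"
    unfolding w_def using series_star_unfold[OF p(2)] by simp
  have "a * b * (1 + a * w * b) + 1 = 1 + a * (b * a * w + 1) * b"
    by (simp add: distrib_left distrib_right mult.assoc add_ac)
  then have "1 + a * w * b = a * b * (1 + a * w * b) + 1"
    by (simp only: w)
  then have "1 + a * w * b = series_star (a * b) * 1"
    by (rule series_star_solves[OF p(1)])
  then show "series_star (a * b) = 1 + a * series_star (b * a) * b"
    by (simp add: w_def)
qed (auto simp: proper_simps proper_scale)

text \<open>In the group identity both sides solve the same proper system, since all row sums of the group
  matrix are equal.\<close>

lemma series_iteration:
  "partial_iteration_semialgebra (UNIV :: ('s, 'k::comm_semiring_1) series set) scale {s. proper s} series_star"
proof -
  interpret ser: partial_conway_semialgebra "UNIV :: ('s, 'k) series set" scale "{s. proper s}" series_star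
    by (rule series_conway)
  show ?thesis
  proof unfold_locales
    fix G :: "nat monoid" and n and x :: "nat \<Rightarrow> ('s, 'k) series"
    assume G: "group G" and C: "carrier G = {..<n}" and x: "x \<in> {..<n} \<rightarrow> {s. proper s}"
    interpret group G by (rule G)
    define M where "M = ser.entries n (group_mat G n x)"
    have n: "0 < n"
      using one_closed by (auto simp: C)
    have prod: "inv\<^bsub>G\<^esub> i \<otimes>\<^bsub>G\<^esub> j < n" if "i < n" "j < n" for i j
      using that m_closed[of "inv\<^bsub>G\<^esub> i" j] inv_closed[of i] by (auto simp: C)
    have M: "M i j = x (inv\<^bsub>G\<^esub> i \<otimes>\<^bsub>G\<^esub> j)" if "i < n" "j < n" for i j
      using that by (simp add: M_def ser.entries_def group_mat_def)
    have Mp: "proper (M i j)" for i j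
      using prod x by (auto simp: M_def ser.entries_def group_mat_def proper_simps)
    have gM: "ser.guarded M"
      using Mp by (intro ser.guarded_ideal) auto
    define r where "r i = (\<Sum>j<n. ser.mstar {..<n} M i j)" for i
    define t where "t = series_star (\<Sum>i<n. x i)"
    have "r 0 = t"
    proof (rule proper_system_unique[of "{..<n}" M r "\<lambda>_. 1" "\<lambda>_. t"])
      fix i assume i: "i \<in> {..<n}"
      have "r i = (\<Sum>j<n. if i = j then 1 else 0) + (\<Sum>j<n. \<Sum>k<n. M i k * ser.mstar {..<n} M k j)"
        unfolding r_def ser.mstar_def[of _ _ i] sum.distrib
        by (intro arg_cong2[where f = "(+)"] refl sum.cong ser.elim_eq_mult_mstar[OF gM]) auto
      also have "\<dots> = 1 + (\<Sum>k<n. M i k * r k)"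
        using i by (subst sum.swap) (simp add: r_def sum_distrib_left)
      finally show "r i = (\<Sum>k<n. M i k * r k) + 1"
        by (simp add: add.commute)
      have "(\<Sum>k<n. M i k) = (\<Sum>k<n. x (inv\<^bsub>G\<^esub> i \<otimes>\<^bsub>G\<^esub> k))"
        using i by (simp add: M)
      also have "\<dots> = (\<Sum>k<n. x k)"
        using i inj_on_cmult[of "inv\<^bsub>G\<^esub> i"] surj_const_mult[of "inv\<^bsub>G\<^esub> i"] inv_closed[of i]
        by (intro sum.reindex_bij_betw[of _ _ _ x]) (simp add: bij_betw_def C)
      finally have sum: "(\<Sum>k<n. M i k) = (\<Sum>k<n. x k)" .
      have "proper (\<Sum>k<n. x k)"
        using x ser.sum_ideal[of "{..<n}" x] by auto
      then have "t = (\<Sum>k<n. x k) * t + 1"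
        unfolding t_def by (rule series_star_unfold)
      then show "t = (\<Sum>k<n. M i k * t) + 1"
        by (simp only: sum_distrib_right[symmetric] sum)
    qed (use n Mp in auto)
    moreover have "mat_star series_star n (group_mat G n x) $$ (0, j) = ser.mstar {..<n} M 0 j" if "j < n" for j
    proof -
      have "group_mat G n x \<in> carrier_mat n n"
          "\<And>i j. i < n \<Longrightarrow> j < n \<Longrightarrow> group_mat G n x $$ (i, j) \<in> {s. proper s}"
        using prod x by (auto simp: group_mat_def)
      then show ?thesis
        using ser.mat_star_eq[of n "group_mat G n x"] n that by (simp add: M_def)
    qed
    ultimately show "(\<Sum>j<n. mat_star series_star n (group_mat G n x) $$ (0, j)) = series_star (\<Sum>i<n. x i)"
      by (simp add: r_def t_def)
  qed
qed

global_interpretation ser: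
  partial_iteration_semialgebra "UNIV :: ('s, 'k::comm_semiring_1) series set" scale "{s. proper s}" series_star
  by (rule series_iteration)

subsection \<open>Rational series\<close>

lemma const_add: "const (k + l) = const k + (const l :: ('s, 'k::semiring_1) series)"
  by (rule series_eqI) (simp add: coeff_simps)

lemma const_simps: "const 0 = (0 :: ('s, 'k::semiring_1) series)" "const 1 = (1 :: ('s, 'k) series)"
  by (rule series_eqI; simp add: coeff_simps)+

lemma scale_const: "scale k (const l) = (const (k * l) :: ('s, 'k::semiring_1) series)"
  by (rule series_eqI) (simp add: coeff_simps)

lemma proper_rat_gen: "s \<in> rat_gen \<Sigma> \<Longrightarrow> proper s"
  by (induction rule: rat_gen.induct) (simp_all add: proper_simps proper_scale)

lemma rat_seriesI: "b \<in> rat_gen \<Sigma> \<Longrightarrow> const k + b \<in> rat_series \<Sigma>"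
  by (auto simp: rat_series_def)

lemma rat_gen_subset: "rat_gen \<Sigma> \<subseteq> rat_series \<Sigma>"
  using rat_seriesI[of _ \<Sigma> 0] by (auto simp: const_simps)

lemma proper_rat_series_eq: "proper_rat_series \<Sigma> = rat_gen \<Sigma>"
proof -
  have "s \<in> rat_gen \<Sigma>" if "s \<in> rat_series \<Sigma>" "proper s" for s
  proof -
    obtain k b where s: "s = const k + b" "b \<in> rat_gen \<Sigma>"
      using \<open>s \<in> rat_series \<Sigma>\<close> by (auto simp: rat_series_def)
    then have "k = 0"
      using \<open>proper s\<close> proper_rat_gen[of b] by (simp add: proper_def coeff_simps)
    then show ?thesis
      using s by (simp add: const_simps)
  qed
  then show ?thesis
    using rat_gen_subset proper_rat_gen by (auto simp: proper_rat_series_def)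
qed

lemma rat_series_iteration:
  "partial_iteration_semialgebra (rat_series \<Sigma> :: ('s, 'k::comm_semiring_1) series set) scale
    (proper_rat_series \<Sigma>) series_star"
  unfolding proper_rat_series_eq
proof unfold_locales
  note rat_gen.intros [intro]
  fix a b :: "('s, 'k) series" and k :: 'k
  show "(0 :: ('s, 'k) series) \<in> rat_series \<Sigma>" "(1 :: ('s, 'k) series) \<in> rat_series \<Sigma>"
    using rat_seriesI[OF rat_gen.zero, of 0] rat_seriesI[OF rat_gen.zero, of 1] by (auto simp: const_simps)
  assume "a \<in> rat_series \<Sigma>"
  then obtain l s where a: "a = const l + s" and s: "s \<in> rat_gen \<Sigma>"
    by (auto simp: rat_series_def)
  show "scale k (a * b) = scale k a * b"
    by (rule ser.act_mult_left) simp_all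
  show "scale k (a * b) = a * scale k b"
    by (rule ser.act_mult_right) simp_all
  have "scale k a = const (k * l) + scale k s"
    by (simp add: a ser.act_add_right scale_const)
  then show "scale k a \<in> rat_series \<Sigma>"
    using s by (auto intro: rat_seriesI)
  show "a * t \<in> rat_gen \<Sigma>" if "t \<in> rat_gen \<Sigma>" for t
    using s that by (auto simp: a distrib_right const_mult)
  show "t * a \<in> rat_gen \<Sigma>" if "t \<in> rat_gen \<Sigma>" for t
    using s that by (auto simp: a distrib_left mult_const)
  assume "b \<in> rat_series \<Sigma>"
  then obtain m t where b: "b = const m + t" and t: "t \<in> rat_gen \<Sigma>"
    by (auto simp: rat_series_def)
  have "a + b = const (l + m) + (s + t)"
    by (simp add: a b const_add add_ac)
  then show "a + b \<in> rat_series \<Sigma>"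
    using s t by (auto intro: rat_seriesI)
  have "a * b = const (l * m) + (scale l t + scale m s + s * t)"
    by (simp add: a b distrib_left distrib_right mult_const const_mult scale_const
        ser.act_add_right mult.commute[of m] add_ac)
  then show "a * b \<in> rat_series \<Sigma>"
    using s t by (auto intro!: rat_seriesI)
next
  fix a :: "('s, 'k) series" assume a: "a \<in> rat_gen \<Sigma>"
  then have "series_star a = const 1 + a * series_star a"
    using series_star_unfold[OF proper_rat_gen[OF a]] by (simp add: const_simps add.commute)
  then show "series_star a \<in> rat_series \<Sigma>"
    using rat_seriesI[OF rat_gen.plus[OF a], of 1] by simp
next
  fix a b :: "('s, 'k) series"
  assume "a \<in> rat_gen \<Sigma>" "b \<in> rat_gen \<Sigma>"
  then show "series_star (a + b) = series_star (series_star a * b) * series_star a"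
    by (intro ser.sum_star) (simp_all add: proper_rat_gen)
next
  fix a b :: "('s, 'k) series"
  assume "a \<in> rat_gen \<Sigma> \<or> b \<in> rat_gen \<Sigma>"
  then show "series_star (a * b) = 1 + a * series_star (b * a) * b"
    by (intro ser.product_star) (auto simp: proper_rat_gen)
next
  fix G :: "nat monoid" and n and x :: "nat \<Rightarrow> ('s, 'k) series"
  assume "group G" "carrier G = {..<n}" "x \<in> {..<n} \<rightarrow> rat_gen \<Sigma>"
  then show "(\<Sum>j<n. mat_star series_star n (group_mat G n x) $$ (0, j)) = series_star (\<Sum>i<n. x i)"
    by (intro ser.group_identity) (auto intro: proper_rat_gen)
qed (auto intro: rat_gen.intros rat_gen_subset[THEN subsetD] simp: ser.act_add_left ser.act_add_right ser.act_mult
    ser.act_one ser.act_zero_left ser.act_zero_right)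

section \<open>Behaviors\<close>

lemma letter_proper: "letter \<in> \<Sigma> \<rightarrow> {s :: ('s, 'k::comm_semiring_1) series. proper s}"
  by (simp add: proper_simps)

lemma coeff_letter_mult:
  fixes x :: "('s, 'k::comm_semiring_1) series"
  shows "coeff (letter b * x) (a # w) = (if a = b then coeff x w else 0)"
proof -
  have "coeff (letter b * x) (a # w) =
      (\<Sum>i\<le>length (a # w). if i = 1 then if a = b then coeff x w else 0 else 0)"
    unfolding coeff_simps(4)
  proof (rule sum.cong[OF refl])
    fix i assume i: "i \<in> {..length (a # w)}"
    show "coeff (letter b) (take i (a # w)) * coeff x (drop i (a # w)) =
        (if i = 1 then if a = b then coeff x w else 0 else 0)"
      using i by (cases i) (auto simp: coeff_simps)
  qed
  also have "\<dots> = (if a = b then coeff x w else 0)"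
    by (subst sum.delta) auto
  finally show ?thesis .
qed

text \<open>The sum of the weights of the runs on a word from a state, final coefficients included.\<close>

fun run :: "'i set \<Rightarrow> ('i \<Rightarrow> 'i \<Rightarrow> 's \<Rightarrow> 'k::comm_semiring_1) \<Rightarrow> ('i \<Rightarrow> 'k) \<Rightarrow> 's list \<Rightarrow> 'i \<Rightarrow> 'k" where
  "run S c \<beta> [] i = \<beta> i"
| "run S c \<beta> (a # w) i = (\<Sum>j\<in>S. c i j a * run S c \<beta> w j)"

lemma scalar_series: "ser.scalar k = (const k :: ('s, 'k::comm_semiring_1) series)"
  using scale_const[of k 1] by (simp add: ser.scalar_def const_simps)

lemma coeff_val:
  fixes c :: "'i \<Rightarrow> 'i \<Rightarrow> 's \<Rightarrow> 'k::comm_semiring_1"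
  assumes \<Sigma>: "finite \<Sigma>" and S: "finite S"
  shows "coeff (ser.val \<Sigma> letter S \<alpha> c \<beta>) w = (if set w \<subseteq> \<Sigma> then \<Sum>i\<in>S. \<alpha> i * run S c \<beta> w i else 0)"
proof -
  define M where "M = ser.trans_mat \<Sigma> letter S c"
  have gM: "ser.guarded M"
    unfolding M_def by (rule ser.guarded_trans_mat[OF letter_proper])
  have M: "M i j = (\<Sum>a\<in>\<Sigma>. scale (c i j a) (letter a))" if "i \<in> S" "j \<in> S" for i j
    using that by (simp add: M_def ser.trans_mat_def)
  have Mp: "proper (M i j)" for i j
    using ser.trans_mat_ideal[OF letter_proper] by (simp add: M_def)
  define X where "X i = (\<Sum>j\<in>S. ser.mstar S M i j * const (\<beta> j))" for i
  have X: "X i = (\<Sum>k\<in>S. M i k * X k) + const (\<beta> i)" if i: "i \<in> S" for i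
  proof -
    have "X i = (\<Sum>j\<in>S. (if i = j then 1 else 0) * const (\<beta> j)) +
        (\<Sum>j\<in>S. (\<Sum>k\<in>S. M i k * ser.mstar S M k j) * const (\<beta> j))"
      unfolding X_def ser.mstar_def[of _ _ i] distrib_right sum.distrib
      by (intro arg_cong2[where f = "(+)"] refl sum.cong arg_cong2[where f = "(*)"]
          ser.elim_eq_mult_mstar[OF gM S]) auto
    also have "(\<Sum>j\<in>S. (if i = j then 1 else 0) * const (\<beta> j)) = const (\<beta> i)"
      using S i by (rule ser.sum_delta_mult)
    also have "(\<Sum>j\<in>S. (\<Sum>k\<in>S. M i k * ser.mstar S M k j) * const (\<beta> j)) = (\<Sum>k\<in>S. M i k * X k)"
      unfolding X_def sum_distrib_right sum_distrib_left by (subst sum.swap) (simp add: mult.assoc)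
    finally show ?thesis
      by (simp add: add.commute)
  qed
  have coeff_X: "coeff (X i) w = (if set w \<subseteq> \<Sigma> then run S c \<beta> w i else 0)" if "i \<in> S" for i
    using that
  proof (induction w arbitrary: i)
    case Nil
    have "coeff (M i k * X k) [] = 0" for k
      using Mp[of i k] by (simp add: coeff_simps(4) proper_def)
    then have "coeff ((\<Sum>k\<in>S. M i k * X k) + const (\<beta> i)) [] = \<beta> i"
      by (simp add: coeff_simps(3,5) coeff_sum)
    then show ?case
      using X[OF Nil] by simp
  next
    case (Cons a w)
    have "coeff (M i k * X k) (a # w) = (if a \<in> \<Sigma> then c i k a * coeff (X k) w else 0)" if k: "k \<in> S" for k
    proof -
      have "coeff (M i k * X k) (a # w) = (\<Sum>b\<in>\<Sigma>. c i k b * coeff (letter b * X k) (a # w))"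
        using Cons.prems k
        by (simp add: M sum_distrib_right coeff_sum coeff_simps(7) flip: ser.act_mult_left)
      also have "\<dots> = (\<Sum>b\<in>\<Sigma>. if a = b then c i k a * coeff (X k) w else 0)"
        by (intro sum.cong) (auto simp: coeff_letter_mult)
      finally show ?thesis
        using \<Sigma> by simp
    qed
    then have "coeff ((\<Sum>k\<in>S. M i k * X k) + const (\<beta> i)) (a # w) =
        (\<Sum>k\<in>S. if a \<in> \<Sigma> then c i k a * coeff (X k) w else 0)"
      by (simp add: coeff_simps(3,5) coeff_sum)
    then show ?case
      using X[OF Cons.prems] Cons.IH by (cases "a \<in> \<Sigma>"; cases "set w \<subseteq> \<Sigma>") simp_all
  qed
  have "ser.val \<Sigma> letter S \<alpha> c \<beta> = (\<Sum>i\<in>S. const (\<alpha> i) * X i)"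
    by (simp add: ser.val_def scalar_series M_def X_def sum_distrib_left mult.assoc)
  then show ?thesis
    by (simp add: coeff_sum const_mult coeff_simps(7) coeff_X)
qed

subsection \<open>Automata as triples of matrices\<close>

context partial_iteration_semialgebra
begin

text \<open>The value in \<open>A\<close> of an automaton over the series; the coefficient of the letter \<open>a\<close> in an entry of the
  transition matrix is its coefficient at the word \<open>[a]\<close>.\<close>

definition aut_val :: "'s set \<Rightarrow> ('s \<Rightarrow> 'a) \<Rightarrow> ('s, 'k) automaton \<Rightarrow> 'a" where
  "aut_val \<Sigma> h = (\<lambda>(\<alpha>, M, \<beta>). val \<Sigma> h {..<dim_row M} (\<lambda>i. \<alpha> $$ (0, i))
     (\<lambda>i j a. coeff (M $$ (i, j)) [a]) (\<lambda>j. \<beta> $$ (j, 0)))"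

end

lemma coeff_letter_combination:
  fixes c :: "'s \<Rightarrow> 'k::comm_semiring_1"
  assumes "finite \<Sigma>"
  shows "coeff (\<Sum>a\<in>\<Sigma>. scale (c a) (letter a)) [b] = (if b \<in> \<Sigma> then c b else 0)"
proof -
  have "coeff (\<Sum>a\<in>\<Sigma>. scale (c a) (letter a)) [b] = (\<Sum>a\<in>\<Sigma>. if b = a then c b else 0)"
    unfolding coeff_sum by (intro sum.cong) (auto simp: coeff_simps)
  then show ?thesis
    using assms by simp
qed

lemma behavior_eq_aut_val:
  fixes P :: "('s, 'k::comm_semiring_1) automaton"
  assumes \<Sigma>: "finite \<Sigma>" and P: "is_automaton \<Sigma> n P"
  shows "behavior P = ser.aut_val \<Sigma> letter P"
proof -
  obtain \<alpha> M \<beta> where P_eq: "P = (\<alpha>, M, \<beta>)"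
    by (cases P)
  have n: "1 \<le> n" and \<alpha>: "\<alpha> \<in> carrier_mat 1 n" and M: "M \<in> carrier_mat n n" and \<beta>: "\<beta> \<in> carrier_mat n 1"
    and lc: "elements_mat M \<subseteq> letter_combinations \<Sigma>"
    using P by (auto simp: P_eq is_automaton_def)
  define N where "N = ser.trans_mat \<Sigma> letter {..<n} (\<lambda>i j a. coeff (M $$ (i, j)) [a])"
  have entry: "M $$ (i, j) = N i j" if ij: "i < n" "j < n" for i j
  proof -
    have "M $$ (i, j) \<in> letter_combinations \<Sigma>"
      using lc elements_matI[OF M ij] by auto
    then obtain c where c: "M $$ (i, j) = (\<Sum>a\<in>\<Sigma>. scale (c a) (letter a))"
      by (auto simp: letter_combinations_def)
    then show ?thesis
      using ij by (simp add: N_def ser.trans_mat_def coeff_letter_combination[OF \<Sigma>])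
  qed
  have NI: "proper (N i j)" for i j
    using ser.trans_mat_ideal[OF letter_proper] by (simp add: N_def)
  have "ser.entries n M = N"
    using entry by (auto simp: fun_eq_iff ser.entries_def N_def ser.trans_mat_def)
  then have *: "mat_star series_star n M \<in> carrier_mat n n \<and>
      (\<forall>i<n. \<forall>j<n. mat_star series_star n M $$ (i, j) = ser.mstar {..<n} N i j)"
    using n M entry NI ser.mat_star_eq[of n M] by auto
  then have star: "mat_star series_star n M \<in> carrier_mat n n"
    by blast
  have star_eq: "mat_star series_star n M $$ (i, j) = ser.mstar {..<n} N i j" if "i < n" "j < n" for i j
    using * that by blast
  have "behavior P = (\<Sum>i<n. const (\<alpha> $$ (0, i)) * (\<Sum>j<n. ser.mstar {..<n} N i j * const (\<beta> $$ (j, 0))))"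
    using \<alpha> \<beta> M star star_eq n
    by (simp add: behavior_def P_eq scalar_prod_def atLeast0LessThan)
  also have "\<dots> = ser.aut_val \<Sigma> letter P"
    using M unfolding ser.aut_val_def P_eq ser.val_def
    by (simp add: scalar_series N_def sum_distrib_left mult.assoc)
  finally show ?thesis .
qed

context partial_iteration_semialgebra
begin

lemma aut_val_simulation:
  fixes P Q :: "('s, 'k) automaton"
  assumes atom: "atomistic TYPE('k)" and \<Sigma>: "finite \<Sigma>" and h: "h \<in> \<Sigma> \<rightarrow> I"
    and step: "elementary_step \<Sigma> P Q"
  shows "aut_val \<Sigma> h P = aut_val \<Sigma> h Q"
proof -
  obtain \<alpha> M \<beta> where P: "P = (\<alpha>, M, \<beta>)"
    by (cases P)
  obtain \<gamma> N \<delta> where Q: "Q = (\<gamma>, N, \<delta>)"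
    by (cases Q)
  obtain m n X where aut: "is_automaton \<Sigma> m P" "is_automaton \<Sigma> n Q" and sim: "simulation X P Q"
    and X: "functional_mat X \<or> dual_functional_mat X \<or> invertible_diagonal_mat X"
    using step by (auto simp: elementary_step_def)
  have dim: "\<alpha> \<in> carrier_mat 1 m" "M \<in> carrier_mat m m" "\<beta> \<in> carrier_mat m 1"
      "\<gamma> \<in> carrier_mat 1 n" "N \<in> carrier_mat n n" "\<delta> \<in> carrier_mat n 1"
    using aut by (auto simp: P Q is_automaton_def)
  have Xc: "X \<in> carrier_mat m n" and sim_\<alpha>: "\<alpha> * X = \<gamma>"
    and sim_M: "M * map_mat const X = map_mat const X * N" and sim_\<beta>: "\<beta> = X * \<delta>"
    using sim dim by (auto simp: P Q simulation_def)
  let ?x = "\<lambda>i j. X $$ (i, j)"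
  let ?c = "\<lambda>i j a. coeff (M $$ (i, j)) [a]" and ?d = "\<lambda>i j a. coeff (N $$ (i, j)) [a]"
  have \<gamma>: "\<gamma> $$ (0, j) = (\<Sum>i<m. \<alpha> $$ (0, i) * ?x i j)" if "j < n" for j
    using that dim Xc unfolding sim_\<alpha>[symmetric] by (simp add: scalar_prod_def atLeast0LessThan)
  have \<beta>: "\<beta> $$ (i, 0) = (\<Sum>j<n. ?x i j * \<delta> $$ (j, 0))" if "i < m" for i
    using that dim Xc unfolding sim_\<beta> by (simp add: scalar_prod_def atLeast0LessThan)
  have M: "(\<Sum>k<m. ?c i k a * ?x k j) = (\<Sum>k<n. ?x i k * ?d k j a)" if ij: "i < m" "j < n" for i j a
  proof -
    have "(\<Sum>k<m. M $$ (i, k) * const (?x k j)) = (M * map_mat const X) $$ (i, j)"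
      using ij dim Xc by (simp add: scalar_prod_def atLeast0LessThan)
    also have "\<dots> = (\<Sum>k<n. const (?x i k) * N $$ (k, j))"
      using ij dim Xc unfolding sim_M by (simp add: scalar_prod_def atLeast0LessThan)
    finally have "coeff (\<Sum>k<m. M $$ (i, k) * const (?x k j)) [a] = coeff (\<Sum>k<n. const (?x i k) * N $$ (k, j)) [a]"
      by simp
    then show ?thesis
      by (simp add: coeff_sum mult_const const_mult coeff_simps(7) mult.commute)
  qed
  have dims: "dim_row M = m" "dim_row N = n" "dim_row X = m" "dim_col X = n"
    using dim Xc by auto
  have delta: "(\<Sum>k<l. f k * (if g k = j then 1 else 0)) = (\<Sum>k\<in>{k. k < l \<and> g k = j}. f k)"
    "(\<Sum>k<l. (if j = g k then 1 else 0) * f k) = (\<Sum>k\<in>{k. k < l \<and> g k = j}. f k)"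
    for f :: "nat \<Rightarrow> 'k" and g :: "nat \<Rightarrow> nat" and l j
  proof -
    have *: "(\<Sum>k<l. if g k = j then f k else 0) = (\<Sum>k\<in>{k. k < l \<and> g k = j}. f k)"
      using sum.inter_filter[of "{..<l}" f "\<lambda>k. g k = j"] by simp
    show "(\<Sum>k<l. f k * (if g k = j then 1 else 0)) = (\<Sum>k\<in>{k. k < l \<and> g k = j}. f k)"
      "(\<Sum>k<l. (if j = g k then 1 else 0) * f k) = (\<Sum>k\<in>{k. k < l \<and> g k = j}. f k)"
      unfolding *[symmetric] by (auto intro!: sum.cong)
  qed
  have delta': "(\<Sum>k<l. f k * (if k = j then 1 else 0)) = f j" if "j < l" for f :: "nat \<Rightarrow> 'k" and l j
    using that by (simp add: if_distrib[of "\<lambda>x. _ * x"] cong: if_cong)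
  show ?thesis
    using X
  proof (elim disjE)
    assume "functional_mat X"
    then have "\<forall>i. \<exists>j. i < m \<longrightarrow> j < n \<and> ?x i j = 1 \<and> (\<forall>j'<n. j' \<noteq> j \<longrightarrow> ?x i j' = 0)"
      unfolding functional_mat_def dims by blast
    then obtain \<rho> where \<rho>: "\<And>i. i < m \<Longrightarrow> \<rho> i < n \<and> ?x i (\<rho> i) = 1 \<and> (\<forall>j'<n. j' \<noteq> \<rho> i \<longrightarrow> ?x i j' = 0)"
      by metis
    have x: "?x i j = (if \<rho> i = j then 1 else 0)" if "i < m" "j < n" for i j
      using \<rho>[OF that(1)] that by auto
    have row: "(\<Sum>k<n. ?x i k * f k) = f (\<rho> i)" if "i < m" for i f
    proof -
      have "(\<Sum>k<n. ?x i k * f k) = (\<Sum>k<n. if k = \<rho> i then f (\<rho> i) else 0)"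
        using that by (intro sum.cong) (auto simp: x)
      then show ?thesis
        using \<rho>[OF that] by simp
    qed
    have "val \<Sigma> h {..<m} (\<lambda>i. \<alpha> $$ (0, i)) ?c (\<lambda>i. \<beta> $$ (i, 0)) = val \<Sigma> h {..<n} (\<lambda>i. \<gamma> $$ (0, i)) ?d (\<lambda>i. \<delta> $$ (i, 0))"
    proof (rule val_functional[OF atom \<Sigma> h, of m \<rho>])
      show "(\<Sum>i\<in>{i. i < m \<and> \<rho> i = q}. \<alpha> $$ (0, i)) = \<gamma> $$ (0, q)" if "q < n" for q
        using that by (simp add: \<gamma> x delta(1))
      show "(\<Sum>j\<in>{j. j < m \<and> \<rho> j = q}. ?c i j a) = ?d (\<rho> i) q a" if "i < m" "q < n" for i q a
        using that M[OF that, of a] unfolding row[OF that(1)] by (simp add: x delta(1))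
      show "\<beta> $$ (i, 0) = \<delta> $$ (\<rho> i, 0)" if "i < m" for i
        using that by (simp add: \<beta> row)
    qed (use \<rho> in auto)
    then show ?thesis
      by (simp add: aut_val_def P Q dims)
  next
    assume "dual_functional_mat X"
    then have "\<forall>j. \<exists>i. j < n \<longrightarrow> i < m \<and> ?x i j = 1 \<and> (\<forall>i'<m. i' \<noteq> i \<longrightarrow> ?x i' j = 0)"
      unfolding dual_functional_mat_def dims by blast
    then obtain \<sigma> where \<sigma>: "\<And>j. j < n \<Longrightarrow> \<sigma> j < m \<and> ?x (\<sigma> j) j = 1 \<and> (\<forall>i'<m. i' \<noteq> \<sigma> j \<longrightarrow> ?x i' j = 0)"
      by metis
    have x: "?x i j = (if i = \<sigma> j then 1 else 0)" if "i < m" "j < n" for i j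
      using \<sigma>[OF that(2)] that by auto
    have "val \<Sigma> h {..<m} (\<lambda>i. \<alpha> $$ (0, i)) ?c (\<lambda>i. \<beta> $$ (i, 0)) = val \<Sigma> h {..<n} (\<lambda>i. \<gamma> $$ (0, i)) ?d (\<lambda>i. \<delta> $$ (i, 0))"
    proof (rule val_dual_functional[OF atom \<Sigma> h, of n \<sigma>])
      show "\<gamma> $$ (0, j) = \<alpha> $$ (0, \<sigma> j)" if "j < n" for j
        using that \<sigma>[OF that(1)] by (simp add: \<gamma> x delta')
      show "(\<Sum>j'\<in>{j'. j' < n \<and> \<sigma> j' = i}. ?d j' j a) = ?c i (\<sigma> j) a" if "i < m" "j < n" for i j a
        using that \<sigma>[OF that(2)] M[OF that, of a] by (simp add: x delta(2) delta')
      show "(\<Sum>j\<in>{j. j < n \<and> \<sigma> j = i}. \<delta> $$ (j, 0)) = \<beta> $$ (i, 0)" if "i < m" for i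
        using that by (simp add: \<beta> x delta(2))
    qed (use \<sigma> in auto)
    then show ?thesis
      by (simp add: aut_val_def P Q dims)
  next
    assume "invertible_diagonal_mat X"
    then have mn: "m = n" and off: "\<And>i j. i < n \<Longrightarrow> j < n \<Longrightarrow> i \<noteq> j \<Longrightarrow> ?x i j = 0"
      and "\<forall>i<n. ?x i i dvd 1"
      unfolding invertible_diagonal_mat_def diagonal_mat_def by (auto simp: dims)
    then have "\<forall>i. \<exists>u. i < n \<longrightarrow> ?x i i * u = 1"
      by (metis dvd_def)
    then obtain u where u: "\<And>i. i < n \<Longrightarrow> ?x i i * u i = 1"
      by metis
    have row: "(\<Sum>k<n. ?x i k * f k) = ?x i i * f i" if "i < n" for f i
    proof -
      have "(\<Sum>k<n. ?x i k * f k) = (\<Sum>k<n. if i = k then ?x i i * f i else 0)"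
        using off that by (intro sum.cong) auto
      then show ?thesis
        using that by simp
    qed
    have col: "(\<Sum>k<n. f k * ?x k j) = f j * ?x j j" if "j < n" for f j
    proof -
      have "(\<Sum>k<n. f k * ?x k j) = (\<Sum>k<n. if j = k then f j * ?x j j else 0)"
        using off that by (intro sum.cong) auto
      then show ?thesis
        using that by simp
    qed
    have "val \<Sigma> h {..<n} (\<lambda>i. \<alpha> $$ (0, i)) ?c (\<lambda>i. \<beta> $$ (i, 0)) = val \<Sigma> h {..<n} (\<lambda>i. \<gamma> $$ (0, i)) ?d (\<lambda>i. \<delta> $$ (i, 0))"
    proof (rule val_invertible_diagonal[OF h u])
      show "?c i j a * ?x j j = ?x i i * ?d i j a" if "i < n" "j < n" for i j a
        using that M[of i j a] by (simp add: mn row col)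
    qed (simp_all add: \<gamma> \<beta> mn row col)
    then show ?thesis
      by (simp add: aut_val_def P Q dims mn)
  qed
qed

end

section \<open>The free partial iteration semialgebra\<close>

text \<open>The automaton over the series with given coefficients and \<open>n\<close> states.\<close>

definition automaton_of ::
  "'s set \<Rightarrow> nat \<Rightarrow> (nat \<Rightarrow> 'k) \<Rightarrow> (nat \<Rightarrow> nat \<Rightarrow> 's \<Rightarrow> 'k) \<Rightarrow> (nat \<Rightarrow> 'k) \<Rightarrow> ('s, 'k::comm_semiring_1) automaton" where
  "automaton_of \<Sigma> n \<alpha> c \<beta> = (mat 1 n (\<lambda>(_, j). \<alpha> j),
     mat n n (\<lambda>(i, j). \<Sum>a\<in>\<Sigma>. scale (c i j a) (letter a)), mat n 1 (\<lambda>(i, _). \<beta> i))"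

lemma is_automaton_of: "1 \<le> n \<Longrightarrow> is_automaton \<Sigma> n (automaton_of \<Sigma> n \<alpha> c \<beta>)"
  by (auto simp: is_automaton_def automaton_of_def elements_mat_def letter_combinations_def)

context partial_iteration_semialgebra
begin

lemma aut_val_automaton_of:
  "finite \<Sigma> \<Longrightarrow> aut_val \<Sigma> h (automaton_of \<Sigma> n \<alpha> c \<beta>) = val \<Sigma> h {..<n} \<alpha> c \<beta>"
  by (auto simp: aut_val_def automaton_of_def coeff_letter_combination intro!: val_cong)

end

lemma val_series_eq_behavior:
  "finite \<Sigma> \<Longrightarrow> 1 \<le> n \<Longrightarrow>
     ser.val \<Sigma> letter {..<n} \<alpha> c \<beta> = behavior (automaton_of \<Sigma> n \<alpha> c \<beta>)"
  by (simp add: behavior_eq_aut_val[OF _ is_automaton_of] ser.aut_val_automaton_of)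

context partial_iteration_semialgebra
begin

lemma val_unique_nat:
  fixes \<Sigma> :: "nat set" and m n :: nat
  assumes sp: "strongly_proper TYPE('k)" and atom: "atomistic TYPE('k)"
    and \<Sigma>: "finite \<Sigma>" and h: "h \<in> \<Sigma> \<rightarrow> I" and mn: "1 \<le> m" "1 \<le> n"
    and eq: "ser.val \<Sigma> letter {..<m} \<alpha> c \<beta> = ser.val \<Sigma> letter {..<n} \<gamma> d \<delta>"
  shows "val \<Sigma> h {..<m} \<alpha> c \<beta> = val \<Sigma> h {..<n} \<gamma> d \<delta>"
proof -
  let ?P = "automaton_of \<Sigma> m \<alpha> c \<beta>" and ?Q = "automaton_of \<Sigma> n \<gamma> d \<delta>"
  have "behavior ?P = behavior ?Q"
    using eq mn \<Sigma> by (simp add: val_series_eq_behavior)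
  then have "equivclp (elementary_step \<Sigma>) ?P ?Q"
    by (rule sp[unfolded strongly_proper_def, rule_format,
        OF \<Sigma> is_automaton_of[OF mn(1)] is_automaton_of[OF mn(2)]])
  then have "aut_val \<Sigma> h ?P = aut_val \<Sigma> h ?Q"
  proof (induction rule: equivclp_induct)
    case (step y z)
    then show ?case
      using aut_val_simulation[OF atom \<Sigma> h] by metis
  qed simp
  then show ?thesis
    using \<Sigma> by (simp add: aut_val_automaton_of)
qed

text \<open>Any finite alphabet is renamed to one of natural numbers. Equal behaviors remain equal, because
  they are compared word by word.\<close>

lemma val_unique:
  fixes \<Sigma> :: "'s set" and m n :: nat
  assumes sp: "strongly_proper TYPE('k)" and atom: "atomistic TYPE('k)"
    and \<Sigma>: "finite \<Sigma>" and h: "h \<in> \<Sigma> \<rightarrow> I" and mn: "1 \<le> m" "1 \<le> n"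
    and eq: "ser.val \<Sigma> letter {..<m} \<alpha> c \<beta> = ser.val \<Sigma> letter {..<n} \<gamma> d \<delta>"
  shows "val \<Sigma> h {..<m} \<alpha> c \<beta> = val \<Sigma> h {..<n} \<gamma> d \<delta>"
proof -
  obtain e :: "'s \<Rightarrow> nat" where e: "inj_on e \<Sigma>"
    using finite_imp_inj_to_nat_seg[OF \<Sigma>] by blast
  define g where "g = inv_into \<Sigma> e"
  have ge: "g (e a) = a" if "a \<in> \<Sigma>" for a
    using e that by (simp add: g_def)
  have g\<Sigma>: "g b \<in> \<Sigma>" if "b \<in> e ` \<Sigma>" for b
    using that by (auto simp: ge)
  let ?r = "\<lambda>(c :: nat \<Rightarrow> nat \<Rightarrow> 's \<Rightarrow> 'k) i j b. c i j (g b)"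
  have run: "run S (?r c) \<beta> w i = run S c \<beta> (map g w) i" for S :: "nat set" and c \<beta> w i
    by (induction w arbitrary: i) simp_all
  have coeff: "coeff (ser.val (e ` \<Sigma>) letter {..<n} \<alpha> (?r c) \<beta>) w =
      (if set w \<subseteq> e ` \<Sigma> then coeff (ser.val \<Sigma> letter {..<n} \<alpha> c \<beta>) (map g w) else 0)" for n \<alpha> c \<beta> w
  proof -
    have "set (map g w) \<subseteq> \<Sigma>" if "set w \<subseteq> e ` \<Sigma>"
      using that g\<Sigma> by auto
    then show ?thesis
      using \<Sigma> by (simp add: coeff_val run)
  qed
  have val: "val (e ` \<Sigma>) (\<lambda>b. h (g b)) {..<n :: nat} \<alpha> (?r c) \<beta> = val \<Sigma> h {..<n} \<alpha> c \<beta>" for n \<alpha> c \<beta>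
  proof -
    have "trans_mat (e ` \<Sigma>) (\<lambda>b. h (g b)) {..<n} (?r c) = trans_mat \<Sigma> h {..<n} c"
      using e by (auto simp: trans_mat_def fun_eq_iff sum.reindex ge)
    then show ?thesis
      by (simp add: val_def)
  qed
  have "val (e ` \<Sigma>) (\<lambda>b. h (g b)) {..<m} \<alpha> (?r c) \<beta> = val (e ` \<Sigma>) (\<lambda>b. h (g b)) {..<n} \<gamma> (?r d) \<delta>"
  proof (rule val_unique_nat[OF sp atom _ _ mn])
    show "ser.val (e ` \<Sigma>) letter {..<m} \<alpha> (?r c) \<beta> = ser.val (e ` \<Sigma>) letter {..<n} \<gamma> (?r d) \<delta>"
      by (rule series_eqI) (simp add: coeff eq)
  qed (use \<Sigma> h g\<Sigma> in auto)
  then show ?thesis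
    by (simp add: val)
qed

text \<open>Some automaton has the behavior \<open>s\<close> in the series and the value \<open>v\<close> in \<open>A\<close>.\<close>

definition realizes :: "'s set \<Rightarrow> ('s \<Rightarrow> 'a) \<Rightarrow> ('s, 'k) series \<Rightarrow> 'a \<Rightarrow> bool" where
  "realizes \<Sigma> h s v \<longleftrightarrow> (\<exists>(n :: nat) \<alpha> c \<beta>. 1 \<le> n \<and>
     s = ser.val \<Sigma> letter {..<n} \<alpha> c \<beta> \<and> v = val \<Sigma> h {..<n} \<alpha> c \<beta>)"

lemma realizes_unique:
  assumes "strongly_proper TYPE('k)" "atomistic TYPE('k)" "finite \<Sigma>" "h \<in> \<Sigma> \<rightarrow> I"
    and "realizes \<Sigma> h s v" "realizes \<Sigma> h s w"
  shows "v = w"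
  using assms(5,6) val_unique[OF assms(1-4)] unfolding realizes_def by metis

lemma realizesI:
  fixes S :: "'i set"
  assumes h: "h \<in> \<Sigma> \<rightarrow> I" and S: "finite S" "S \<noteq> {}"
  shows "realizes \<Sigma> h (ser.val \<Sigma> letter S \<alpha> c \<beta>) (val \<Sigma> h S \<alpha> c \<beta>)"
proof -
  obtain e where e: "bij_betw e {..<card S} S"
    using ex_bij_betw_nat_finite[OF S(1)] by (auto simp: atLeast0LessThan)
  then have inj: "inj_on e {..<card S}" and img: "e ` {..<card S} = S"
    by (auto simp: bij_betw_def)
  have "1 \<le> card S"
    using S by (simp add: Suc_le_eq card_gt_0_iff)
  then show ?thesis
    unfolding realizes_def
    using val_reindex[OF h finite_lessThan inj, of \<alpha> c \<beta>]
      ser.val_reindex[OF letter_proper finite_lessThan inj, of \<Sigma> \<alpha> c \<beta>]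
    unfolding img by blast
qed

lemma realizes_closed: "h \<in> \<Sigma> \<rightarrow> I \<Longrightarrow> realizes \<Sigma> h s v \<Longrightarrow> v \<in> A"
  by (auto simp: realizes_def val_closed)

lemma realizes_const: "h \<in> \<Sigma> \<rightarrow> I \<Longrightarrow> realizes \<Sigma> h (const k) (act k 1)"
  using realizesI[of h \<Sigma> "{0 :: nat}" "\<lambda>_. k" "\<lambda>_ _ _. 0" "\<lambda>_. 1"]
  by (simp add: val_const ser.val_const[OF letter_proper] scalar_series) (simp add: scalar_def)

lemma realizes_letter:
  assumes "h \<in> \<Sigma> \<rightarrow> I" "finite \<Sigma>" "a \<in> \<Sigma>" shows "realizes \<Sigma> h (letter a) (h a)"
proof -
  have "realizes \<Sigma> h
      (ser.val \<Sigma> letter {0, 1 :: nat} (\<lambda>i. if i = 0 then 1 else 0)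
        (\<lambda>i j b. if i = 0 \<and> j = 1 \<and> b = a then 1 else 0) (\<lambda>j. if j = 0 then 0 else 1))
      (val \<Sigma> h {0, 1 :: nat} (\<lambda>i. if i = 0 then 1 else 0)
        (\<lambda>i j b. if i = 0 \<and> j = 1 \<and> b = a then 1 else 0) (\<lambda>j. if j = 0 then 0 else 1))"
    using assms by (intro realizesI) auto
  then show ?thesis
    unfolding val_letter[OF assms(1,3,2)] ser.val_letter[OF letter_proper assms(3,2)] .
qed

lemma realizes_add:
  assumes h: "h \<in> \<Sigma> \<rightarrow> I" and "realizes \<Sigma> h s v" "realizes \<Sigma> h t w"
  shows "realizes \<Sigma> h (s + t) (v + w)"
proof -
  obtain m \<alpha> c \<beta> where 1: "1 \<le> (m :: nat)" "s = ser.val \<Sigma> letter {..<m} \<alpha> c \<beta>" "v = val \<Sigma> h {..<m} \<alpha> c \<beta>"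
    using assms(2) by (auto simp: realizes_def)
  obtain n \<gamma> d \<delta> where 2: "1 \<le> (n :: nat)" "t = ser.val \<Sigma> letter {..<n} \<gamma> d \<delta>" "w = val \<Sigma> h {..<n} \<gamma> d \<delta>"
    using assms(3) by (auto simp: realizes_def)
  show ?thesis
    unfolding 1(2,3) 2(2,3) val_union[OF h finite_lessThan finite_lessThan, symmetric]
      ser.val_union[symmetric, OF letter_proper finite_lessThan finite_lessThan]
    using 1(1) by (intro realizesI h) (auto simp: lessThan_empty_iff)
qed

lemma realizes_mult:
  assumes h: "h \<in> \<Sigma> \<rightarrow> I" and "realizes \<Sigma> h s v" "realizes \<Sigma> h t w"
  shows "realizes \<Sigma> h (s * t) (v * w)"
proof -
  obtain m \<alpha> c \<beta> where 1: "1 \<le> (m :: nat)" "s = ser.val \<Sigma> letter {..<m} \<alpha> c \<beta>" "v = val \<Sigma> h {..<m} \<alpha> c \<beta>"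
    using assms(2) by (auto simp: realizes_def)
  obtain n \<gamma> d \<delta> where 2: "1 \<le> (n :: nat)" "t = ser.val \<Sigma> letter {..<n} \<gamma> d \<delta>" "w = val \<Sigma> h {..<n} \<gamma> d \<delta>"
    using assms(3) by (auto simp: realizes_def)
  show ?thesis
    unfolding 1(2,3) 2(2,3) val_mult[OF h finite_lessThan finite_lessThan]
      ser.val_mult[OF letter_proper finite_lessThan finite_lessThan]
    using 1(1) by (intro realizesI h) (auto simp: lessThan_empty_iff)
qed

lemma realizes_scale:
  assumes h: "h \<in> \<Sigma> \<rightarrow> I" and "realizes \<Sigma> h s v"
  shows "realizes \<Sigma> h (scale k s) (act k v)"
proof -
  obtain m \<alpha> c \<beta> where 1: "1 \<le> (m :: nat)" "s = ser.val \<Sigma> letter {..<m} \<alpha> c \<beta>" "v = val \<Sigma> h {..<m} \<alpha> c \<beta>"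
    using assms(2) by (auto simp: realizes_def)
  show ?thesis
    unfolding 1(2,3) val_scale[OF h] ser.val_scale[OF letter_proper]
    using 1(1) by (intro realizesI h) (auto simp: lessThan_empty_iff)
qed

lemma realizes_plus:
  assumes h: "h \<in> \<Sigma> \<rightarrow> I" and \<Sigma>: "finite \<Sigma>" and "realizes \<Sigma> h s v" and s: "proper s"
  shows "v \<in> I" and "realizes \<Sigma> h (s * series_star s) (v * star v)"
proof -
  obtain m \<alpha> c \<beta> where 1: "1 \<le> (m :: nat)" "s = ser.val \<Sigma> letter {..<m} \<alpha> c \<beta>" "v = val \<Sigma> h {..<m} \<alpha> c \<beta>"
    using assms(3) by (auto simp: realizes_def)
  have zero: "(\<Sum>i<m. \<alpha> i * \<beta> i) = 0"
  proof -
    have "coeff s [] = 0"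
      using s by (simp add: proper_def)
    then show ?thesis
      using coeff_val[OF \<Sigma> finite_lessThan, of m \<alpha> c \<beta> "[]"] by (simp add: 1(2))
  qed
  show "v \<in> I"
    unfolding 1(3) by (rule val_bridge(1)[OF h finite_lessThan zero])
  show "realizes \<Sigma> h (s * series_star s) (v * star v)"
    unfolding 1(2,3) val_plus[OF h finite_lessThan zero]
      ser.val_plus[OF letter_proper finite_lessThan zero]
    using 1(1) by (intro realizesI h) (auto simp: lessThan_empty_iff)
qed

lemma realizes_star:
  assumes h: "h \<in> \<Sigma> \<rightarrow> I" and \<Sigma>: "finite \<Sigma>" and "realizes \<Sigma> h s v" and s: "proper s"
  shows "realizes \<Sigma> h (series_star s) (star v)"
proof -
  have "realizes \<Sigma> h (const 1 + s * series_star s) (act 1 1 + v * star v)"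
    using assms by (intro realizes_add realizes_const realizes_plus)
  moreover have "const 1 + s * series_star s = series_star s"
    using series_star_unfold[OF s] by (simp add: const_simps add.commute)
  moreover have "act 1 1 + v * star v = star v"
    using star_unfold_left[OF realizes_plus(1)[OF assms]] by (simp add: act_one closed)
  ultimately show ?thesis
    by simp
qed

lemma realizes_exists:
  assumes h: "h \<in> \<Sigma> \<rightarrow> I" and \<Sigma>: "finite \<Sigma>" and "s \<in> rat_series \<Sigma>"
  shows "\<exists>v. realizes \<Sigma> h s v"
proof -
  have gen: "\<exists>v. realizes \<Sigma> h b v" if "b \<in> rat_gen \<Sigma>" for b
    using that
  proof (induction rule: rat_gen.induct)
    case zero
    show ?case
      using realizes_const[OF h, of 0] by (auto simp: const_simps)
  next
    case (letter a)
    then show ?case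
      using realizes_letter[OF h \<Sigma>] by blast
  next
    case (add s t)
    then show ?case
      using realizes_add[OF h] by blast
  next
    case (mult s t)
    then show ?case
      using realizes_mult[OF h] by blast
  next
    case (scale s k)
    then show ?case
      using realizes_scale[OF h] by blast
  next
    case (plus s)
    then show ?case
      using realizes_plus(2)[OF h \<Sigma> _ proper_rat_gen] by blast
  qed
  obtain k b where "s = const k + b" "b \<in> rat_gen \<Sigma>"
    using assms(3) by (auto simp: rat_series_def)
  then show ?thesis
    using gen realizes_add[OF h realizes_const[OF h]] by blast
qed

end

lemma rational_morphism_unique:
  fixes f g :: "('s, 'k::comm_semiring_1) series \<Rightarrow> 'a::semiring_1"
  assumes f: "partial_iteration_morphism (rat_series \<Sigma>) scale (proper_rat_series \<Sigma>) series_star A act I star f"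
    and g: "partial_iteration_morphism (rat_series \<Sigma>) scale (proper_rat_series \<Sigma>) series_star A act I star g"
    and letters: "\<And>a. a \<in> \<Sigma> \<Longrightarrow> f (letter a) = g (letter a)"
    and s: "s \<in> rat_series \<Sigma>"
  shows "f s = g s"
proof -
  interpret rat: partial_iteration_semialgebra "rat_series \<Sigma> :: ('s, 'k) series set" scale
      "proper_rat_series \<Sigma>" series_star
    by (rule rat_series_iteration)
  note morph = f[unfolded partial_iteration_morphism_def] g[unfolded partial_iteration_morphism_def]
  have R: "t \<in> rat_series \<Sigma>" "t \<in> proper_rat_series \<Sigma>" if "t \<in> rat_gen \<Sigma>" for t :: "('s, 'k) series"
    using that rat_gen_subset by (auto simp: proper_rat_series_eq)
  have gen: "f b = g b" if "b \<in> rat_gen \<Sigma>" for b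
    using that
  proof (induction rule: rat_gen.induct)
    case (plus s)
    then have "f (s * series_star s) = f s * star (f s)" "g (s * series_star s) = g s * star (g s)"
      using morph R[OF plus.hyps] rat.star_closed[of s] by auto
    then show ?case
      using plus.IH by simp
  qed (use morph letters R in auto)
  obtain k b where s_eq: "s = const k + b" and b: "b \<in> rat_gen \<Sigma>"
    using s by (auto simp: rat_series_def)
  have "const k = scale k (1 :: ('s, 'k) series)"
    by (simp add: scale_const flip: const_simps(2))
  then have "f (const k) = act k 1" "g (const k) = act k 1" "const k \<in> rat_series \<Sigma>"
    using morph rat.one_closed rat.act_closed[OF rat.one_closed, of k] by auto
  then show ?thesis
    using morph gen[OF b] R(1)[OF b] by (simp add: s_eq)
qed

lemma (in partial_iteration_semialgebra) rational_morphism_exists: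
  fixes \<Sigma> :: "'s set"
  assumes sp: "strongly_proper TYPE('k)" and atom: "atomistic TYPE('k)"
    and \<Sigma>: "finite \<Sigma>" and h: "h \<in> \<Sigma> \<rightarrow> I"
  obtains f where "f \<in> extensional (rat_series \<Sigma> :: ('s, 'k) series set)"
    and "partial_iteration_morphism (rat_series \<Sigma>) scale (proper_rat_series \<Sigma>) series_star A act I star f"
    and "\<And>a. a \<in> \<Sigma> \<Longrightarrow> f (letter a) = h a"
proof -
  interpret rat: partial_iteration_semialgebra "rat_series \<Sigma> :: ('s, 'k) series set" scale
      "proper_rat_series \<Sigma>" series_star
    by (rule rat_series_iteration)
  define f where "f = restrict (\<lambda>s. THE v. realizes \<Sigma> h s v) (rat_series \<Sigma>)"
  have f_eq: "f s = v" if "s \<in> rat_series \<Sigma>" "realizes \<Sigma> h s v" for s v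
    unfolding f_def using that realizes_unique[OF sp atom \<Sigma> h] by (simp, intro the_equality) auto
  have f: "realizes \<Sigma> h s (f s)" if "s \<in> rat_series \<Sigma>" for s
    using realizes_exists[OF h \<Sigma> that] f_eq[OF that] by blast
  have R: "t \<in> rat_series \<Sigma>" "proper t" if "t \<in> proper_rat_series \<Sigma>" for t :: "('s, 'k) series"
    using that by (auto simp: proper_rat_series_def)
  show ?thesis
  proof (rule that)
    show "f \<in> extensional (rat_series \<Sigma>)"
      by (simp add: f_def)
    show "f (letter a) = h a" if "a \<in> \<Sigma>" for a
      using that by (intro f_eq realizes_letter h \<Sigma>) (auto intro: rat_gen.letter rat_gen_subset[THEN subsetD])
    show "partial_iteration_morphism (rat_series \<Sigma>) scale (proper_rat_series \<Sigma>) series_star A act I star f"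
      unfolding partial_iteration_morphism_def
    proof (intro conjI ballI allI funcsetI)
      show "f s \<in> A" if "s \<in> rat_series \<Sigma>" for s
        using realizes_closed[OF h f[OF that]] .
      have "realizes \<Sigma> h 0 0" "realizes \<Sigma> h 1 1"
        using realizes_const[OF h, of 0] realizes_const[OF h, of 1]
        by (simp_all add: const_simps act_zero_left act_one closed)
      then show "f 0 = 0" "f 1 = 1"
        by (auto intro: f_eq rat.zero_closed rat.one_closed)
      fix s t :: "('s, 'k) series" assume s: "s \<in> rat_series \<Sigma>"
      show "f (scale k s) = act k (f s)" for k
        using s by (intro f_eq rat.act_closed realizes_scale h f)
      assume t: "t \<in> rat_series \<Sigma>"
      show "f (s + t) = f s + f t"
        using s t by (intro f_eq rat.add_closed realizes_add h f)
      show "f (s * t) = f s * f t"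
        using s t by (intro f_eq rat.mult_closed realizes_mult h f)
    next
      fix s :: "('s, 'k) series" assume s: "s \<in> proper_rat_series \<Sigma>"
      show "f s \<in> I"
        by (rule realizes_plus(1)[OF h \<Sigma> f[OF R(1)[OF s]] R(2)[OF s]])
      show "f (series_star s) = star (f s)"
        using s R[OF s] by (intro f_eq rat.star_closed realizes_star h \<Sigma> f)
    qed
  qed
qed

theorem theorem8p5:
  fixes \<Sigma> :: "'s set"
  assumes "strongly_proper TYPE('k::comm_semiring_1)"
    and "atomistic TYPE('k)"
    and "finite \<Sigma>"
  shows "partial_iteration_semialgebra (rat_series \<Sigma> :: ('s, 'k) series set) scale
           (proper_rat_series \<Sigma>) series_star \<and>
         letter ` \<Sigma> \<subseteq> (proper_rat_series \<Sigma> :: ('s, 'k) series set) \<and>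
         (\<forall>(A :: 'a::semiring_1 set) (act :: 'k \<Rightarrow> 'a \<Rightarrow> 'a) I star h.
            partial_iteration_semialgebra A act I star \<longrightarrow> h \<in> \<Sigma> \<rightarrow> I \<longrightarrow>
            (\<exists>!f. f \<in> extensional (rat_series \<Sigma> :: ('s, 'k) series set) \<and>
               partial_iteration_morphism (rat_series \<Sigma>) scale (proper_rat_series \<Sigma>) series_star
                 A act I star f \<and>
               (\<forall>a\<in>\<Sigma>. f (letter a) = h a)))"
proof (intro conjI allI impI)
  show "partial_iteration_semialgebra (rat_series \<Sigma> :: ('s, 'k) series set) scale
      (proper_rat_series \<Sigma>) series_star"
    by (rule rat_series_iteration)
  show "letter ` \<Sigma> \<subseteq> (proper_rat_series \<Sigma> :: ('s, 'k) series set)"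
    by (auto simp: proper_rat_series_eq intro: rat_gen.letter)
  fix A :: "'a set" and act :: "'k \<Rightarrow> 'a \<Rightarrow> 'a" and I star h
  assume "partial_iteration_semialgebra A act I star" and h: "h \<in> \<Sigma> \<rightarrow> I"
  then interpret partial_iteration_semialgebra A act I star
    by simp
  obtain f where f: "f \<in> extensional (rat_series \<Sigma> :: ('s, 'k) series set)"
      "partial_iteration_morphism (rat_series \<Sigma>) scale (proper_rat_series \<Sigma>) series_star A act I star f"
      "\<And>a. a \<in> \<Sigma> \<Longrightarrow> f (letter a) = h a"
    using rational_morphism_exists[OF assms h] by blast
  show "\<exists>!f. f \<in> extensional (rat_series \<Sigma> :: ('s, 'k) series set) \<and>
      partial_iteration_morphism (rat_series \<Sigma>) scale (proper_rat_series \<Sigma>) series_star A act I star f \<and>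
      (\<forall>a\<in>\<Sigma>. f (letter a) = h a)"
  proof (rule ex1I)
    fix g
    assume g: "g \<in> extensional (rat_series \<Sigma> :: ('s, 'k) series set) \<and>
      partial_iteration_morphism (rat_series \<Sigma>) scale (proper_rat_series \<Sigma>) series_star A act I star g \<and>
      (\<forall>a\<in>\<Sigma>. g (letter a) = h a)"
    have "g s = f s" if "s \<in> rat_series \<Sigma>" for s
      using g f by (intro rational_morphism_unique[OF _ f(2) _ that]) auto
    then show "g = f"
      using g f(1) by (intro extensionalityI) auto
  qed (use f in auto)
qed

end
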